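(* Let $\tilde T$ and $T$ be rank-one automorphisms of a Lebesgue probability space $(X,\mu)$, with height sequences $\tilde h_j$ and $h_j$, respectively. Suppose that at least one of $T$, $\tilde T$ is mixing and that $$\frac{\tilde h_j}{h_j}\to\alpha\in(0,1)\qquad (j\to\infty).$$ Then every ergodic joining $\nu$ of $\tilde T$ and $T$ equals $\mu\otimes\mu$; that is, $\tilde T$ and $T$ are disjoint.
   Context: An automorphism is an invertible measure-preserving transformation of a (non-atomic) Lebesgue probability space $(X,\mu)$. An automorphism $T$ is of rank one if there are measurable sets $E_j$ and integers $h_j$ such that, for each $j$, the sets $E_j,TE_j,T^2E_j,\dots,T^{h_j}E_j$ are pairwise disjoint and the partitions $\xi_j=\{E_j,TE_j,\dots,T^{h_j}E_j,E_j'\}$, with $E_j'=X\setminus\bigsqcup_{i=0}^{h_j}T^iE_j$, converge to the partition into points. The convergence means that for every measurable $A$ there are $\xi_j$-measurable sets $A_j$ with $\mu(A\,\triangle\, A_j)\to0$. The sequence $h_j$ of such a sequence of towers is called a height sequence of $T$. For $\tilde T$ the corresponding objects are denoted $\tilde E_j,\tilde h_j$. $T$ is mixing if $\mu(A\cap T^mB)\to\mu(A)\mu(B)$ as $m\to\infty$ for all measurable $A,B$. A joining of $\tilde T$ and $T$ is a $(\tilde T\times T)$-invariant measure $\nu$ on $X\times X$ with $\nu(A\times X)=\nu(X\times A)=\mu(A)$ for all measurable $A$. It is ergodic if the system $(\tilde T\times T,X\times X,\nu)$ is ergodic. $\tilde T$ and $T$ are disjoint if $\mu\times\mu$ is their only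 joining. *)

theory Defs
  imports "HOL-Probability.Probability"
begin

definition measure_isomorphism :: "'a measure \<Rightarrow> 'b measure \<Rightarrow> ('a \<Rightarrow> 'b) \<Rightarrow> bool" where
  "measure_isomorphism M N f \<longleftrightarrow>
     bij_betw f (space M) (space N) \<and>
     f \<in> measurable M N \<and>
     inv_into (space M) f \<in> measurable N M \<and>
     distr M N f = N"

definition isomorphic_mod_0 :: "'a measure \<Rightarrow> 'b measure \<Rightarrow> bool" where
  "isomorphic_mod_0 M N \<longleftrightarrow>
     (\<exists>A\<in>null_sets M. \<exists>B\<in>null_sets N. \<exists>f.
        measure_isomorphism (restrict_space M (space M - A)) (restrict_space N (space N - B)) f)"

text \<open>Non-atomic Lebesgue (Rokhlin) probability spaces. Completeness is required separately,
  since the isomorphism says nothing about the subsets of the discarded null set.\<close>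

definition lebesgue_probability_space :: "'a measure \<Rightarrow> bool" where
  "lebesgue_probability_space M \<longleftrightarrow>
     prob_space M \<and> complete_measure M \<and>
     isomorphic_mod_0 M (lebesgue_on {0..1::real})"

definition automorphism :: "'a measure \<Rightarrow> ('a \<Rightarrow> 'a) \<Rightarrow> bool" where
  "automorphism M T \<longleftrightarrow> measure_isomorphism M M T"

text \<open>A tower of height \<open>h\<close> has the \<open>h + 1\<close> levels \<open>E, T E, \<dots>, T\<^sup>h E\<close>.\<close>

definition tower_levels_disjoint :: "('a \<Rightarrow> 'a) \<Rightarrow> 'a set \<Rightarrow> nat \<Rightarrow> bool" where
  "tower_levels_disjoint T E h \<longleftrightarrow> disjoint_family_on (\<lambda>i. (T ^^ i) ` E) {0..h}"

definition tower_partition :: "'a measure \<Rightarrow> ('a \<Rightarrow> 'a) \<Rightarrow> 'a set \<Rightarrow> nat \<Rightarrow> 'a set set" where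
  "tower_partition M T E h =
     insert (space M - (\<Union>i\<in>{0..h}. (T ^^ i) ` E)) ((\<lambda>i. (T ^^ i) ` E) ` {0..h})"

text \<open>The sets measurable with respect to a finite partition \<open>\<xi>\<close> are the unions of
  subfamilies of \<open>\<xi>\<close>.\<close>

definition converges_to_points :: "'a measure \<Rightarrow> (nat \<Rightarrow> 'a set set) \<Rightarrow> bool" where
  "converges_to_points M \<xi> \<longleftrightarrow>
     (\<forall>A\<in>sets M. \<exists>As. (\<forall>j. \<exists>C\<subseteq>\<xi> j. As j = \<Union>C) \<and>
        (\<lambda>j. measure M ((A - As j) \<union> (As j - A))) \<longlonglongrightarrow> 0)"

definition height_sequence :: "'a measure \<Rightarrow> ('a \<Rightarrow> 'a) \<Rightarrow> (nat \<Rightarrow> nat) \<Rightarrow> bool" where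
  "height_sequence M T h \<longleftrightarrow>
     (\<exists>E. (\<forall>j. E j \<in> sets M \<and> tower_levels_disjoint T (E j) (h j)) \<and>
        converges_to_points M (\<lambda>j. tower_partition M T (E j) (h j)))"

definition rank_one :: "'a measure \<Rightarrow> ('a \<Rightarrow> 'a) \<Rightarrow> bool" where
  "rank_one M T \<longleftrightarrow> automorphism M T \<and> (\<exists>h. height_sequence M T h)"

definition mixing :: "'a measure \<Rightarrow> ('a \<Rightarrow> 'a) \<Rightarrow> bool" where
  "mixing M T \<longleftrightarrow>
     (\<forall>A\<in>sets M. \<forall>B\<in>sets M.
        (\<lambda>m. measure M (A \<inter> (T ^^ m) ` B)) \<longlonglongrightarrow> measure M A * measure M B)"

definition joining ::
  "'a measure \<Rightarrow> ('a \<Rightarrow> 'a) \<Rightarrow> ('a \<Rightarrow> 'a) \<Rightarrow> ('a \<times> 'a) measure \<Rightarrow> bool" where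
  "joining M S T \<nu> \<longleftrightarrow>
     sets \<nu> = sets (M \<Otimes>\<^sub>M M) \<and>
     distr \<nu> \<nu> (map_prod S T) = \<nu> \<and>
     (\<forall>A\<in>sets M. emeasure \<nu> (A \<times> space M) = emeasure M A \<and>
                 emeasure \<nu> (space M \<times> A) = emeasure M A)"

definition ergodic :: "'a measure \<Rightarrow> ('a \<Rightarrow> 'a) \<Rightarrow> bool" where
  "ergodic M T \<longleftrightarrow>
     (\<forall>A\<in>sets M. T -` A \<inter> space M = A \<longrightarrow> emeasure M A = 0 \<or> emeasure M (space M - A) = 0)"

definition ergodic_joining ::
  "'a measure \<Rightarrow> ('a \<Rightarrow> 'a) \<Rightarrow> ('a \<Rightarrow> 'a) \<Rightarrow> ('a \<times> 'a) measure \<Rightarrow> bool" where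
  "ergodic_joining M S T \<nu> \<longleftrightarrow> joining M S T \<nu> \<and> ergodic \<nu> (map_prod S T)"

definition disjoint_automorphisms :: "'a measure \<Rightarrow> ('a \<Rightarrow> 'a) \<Rightarrow> ('a \<Rightarrow> 'a) \<Rightarrow> bool" where
  "disjoint_automorphisms M S T \<longleftrightarrow> (\<forall>\<nu>. joining M S T \<nu> \<longleftrightarrow> \<nu> = M \<Otimes>\<^sub>M M)"

end

theory Submission imports Defs begin

text \<open>Why the theorem holds. Let \<open>S\<close> and \<open>T\<close> stand for the two automorphisms, \<open>T\<close> being the mixing one,
and let \<open>\<nu>\<close> be any joining of them, ergodic or not. Cut the product space
into the rectangles \<open>A\<^sub>a \<times> B\<^sub>b\<close> spanned by the levels of a tower of \<open>S\<close> (height \<open>p\<close>) and a tower of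
\<open>T\<close> (height \<open>q\<close>). By invariance the \<open>\<nu>\<close>-mass of a rectangle depends only on its diagonal \<open>b - a\<close>.

\<^emph>\<open>Spreading.\<close> Consider the mass on those diagonals that, even together with their neighbours within
distance \<open>N\<close>, carry only a small share \<open>\<theta>\<close>. For a fixed level \<open>A\<^sub>a\<close> this mass averages the
images of a set under many powers of \<open>T\<close> that are mostly far apart, and these are nearly pairwise
independent by mixing. A second moment estimate shows that this part of \<open>\<nu>\<close> is close to a multiple
of \<open>\<mu> \<times> \<mu>\<close> on rectangles (\<open>spread_bound\<close>, \<open>spread_component\<close>). So if \<open>\<nu> \<ge> \<rho> (\<mu> \<times> \<mu>)\<close> holds for no
\<open>\<rho> > 0\<close>, then at every late stage nearly all of \<open>\<nu>\<close> sits on boundedly many diagonals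
(\<open>concentration\<close>).

\<^emph>\<open>Concentration contradicts mixing.\<close> This is where the ratio of the heights differs from 1.

\<^item> If the tower of \<open>T\<close> is shorter, let a point of \<open>S\<close> climb from the bottom of its tower nearly to the
  top, in time \<open>m\<close> larger than \<open>q\<close> by a fixed proportion. At both ends the partner point lies in one
  of boundedly many levels, so that some shift by at least \<open>m - q\<close> brings a fixed proportion of the space
  back to the same level of the tower of \<open>T\<close>. This is partial rigidity, which mixing excludes
  (\<open>self_overlap_small\<close>, \<open>component_if_mixing_tower_shorter\<close>).

\<^item> If the tower of \<open>T\<close> is taller, its levels are thinner by a factor \<open>\<gamma> < 1\<close>, and a neighbourhood of
  one diagonal carries at most the share \<open>\<gamma>\<close> of the mass over a level of \<open>S\<close>. So two partners drawn
  independently over one point of \<open>S\<close> are far apart with positive probability. Both are tied to the same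
  point of \<open>S\<close> by boundedly many diagonals of a fixed coarser stage, hence their coarse levels nearly
  determine each other; but two far apart levels of one tower move independently, by mixing
  (\<open>twin_bound\<close>, \<open>coarse_coincidences\<close>, \<open>component_if_mixing_tower_taller\<close>).

Hence every joining dominates \<open>\<rho> (\<mu> \<times> \<mu>)\<close> for some \<open>\<rho> > 0\<close>. Removing the largest such multiple would
leave, after normalisation, another joining, and that one dominates a multiple as well; so the largest
multiple is 1 and \<open>\<nu> = \<mu> \<times> \<mu>\<close> (\<open>bijoining_is_product\<close>).\<close>

section \<open>Powers of an automorphism\<close>

lemma aut_image:
  assumes "automorphism M T" "A \<in> sets M"
  shows "T ` A \<in> sets M" "measure M (T ` A) = measure M A"
proof -
  have bij: "bij_betw T (space M) (space M)" and T: "T \<in> measurable M M"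
    and inv: "inv_into (space M) T \<in> measurable M M" and distr: "distr M M T = M"
    using assms(1) by (auto simp: automorphism_def measure_isomorphism_def)
  have sub: "A \<subseteq> space M" using assms(2) sets.sets_into_space by auto
  have img: "T ` A = inv_into (space M) T -` A \<inter> space M" (is "?L = ?R")
  proof
    show "?L \<subseteq> ?R"
      using sub bij by (auto simp: bij_betw_def inv_into_f_f)
    show "?R \<subseteq> ?L"
    proof
      fix x assume x: "x \<in> ?R"
      then have "T (inv_into (space M) T x) = x"
        using bij by (intro f_inv_into_f) (auto simp: bij_betw_def)
      with x show "x \<in> ?L" by (metis IntD1 imageI vimageE)
    qed
  qed
  show TA: "T ` A \<in> sets M"
    unfolding img using inv assms(2) by (rule measurable_sets)
  have pre: "T -` (T ` A) \<inter> space M = A"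
    using sub bij by (auto simp: bij_betw_def inj_on_def)
  have "measure M (T ` A) = measure (distr M M T) (T ` A)" by (simp add: distr)
  also have "\<dots> = measure M A"
    using measure_distr[OF T TA] by (simp add: pre)
  finally show "measure M (T ` A) = measure M A" .
qed

lemma aut_bij: "automorphism M T \<Longrightarrow> bij_betw T (space M) (space M)"
  by (simp add: automorphism_def measure_isomorphism_def)

lemma aut_measurable: "automorphism M T \<Longrightarrow> T \<in> measurable M M"
  by (simp add: automorphism_def measure_isomorphism_def)

lemma aut_funpow_image:
  assumes "automorphism M T" "A \<in> sets M"
  shows "(T ^^ m) ` A \<in> sets M" "measure M ((T ^^ m) ` A) = measure M A"
proof (induction m)
  case (Suc m)
  { case 1 then show ?case
      using aut_image(1)[OF assms(1) Suc(1)] by (simp add: image_comp) }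
  { case 2 then show ?case
      using aut_image(2)[OF assms(1) Suc(1)] Suc(2) by (simp add: image_comp) }
qed (use assms in auto)

lemma funpow_bij_betw:
  assumes "bij_betw f A A" shows "bij_betw (f ^^ m) A A"
proof (induction m)
  case 0 then show ?case by (simp add: bij_betw_def)
next
  case (Suc m) then show ?case using bij_betw_trans[OF Suc assms] by (simp add: comp_def)
qed

lemma aut_funpow:
  assumes "automorphism M T"
  shows "inj_on (T ^^ m) (space M)" "(T ^^ m) ` space M = space M"
  using funpow_bij_betw[OF aut_bij[OF assms]] by (auto simp: bij_betw_def)

lemma aut_funpow_measurable:
  assumes "automorphism M T" shows "T ^^ m \<in> measurable M M"
proof (induction m)
  case (Suc m)
  then show ?case
    using measurable_comp[OF Suc aut_measurable[OF assms]] by (simp add: comp_def)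
qed simp

lemma aut_funpow_Int:
  assumes "automorphism M T" "A \<in> sets M" "B \<in> sets M"
  shows "(T ^^ m) ` (A \<inter> B) = (T ^^ m) ` A \<inter> (T ^^ m) ` B"
  using assms by (intro inj_on_image_Int[OF aut_funpow(1)[OF assms(1)]])
    (auto dest: sets.sets_into_space)

lemma aut_funpow_Diff:
  assumes "automorphism M T" "A \<in> sets M" "B \<in> sets M"
  shows "(T ^^ m) ` (A - B) = (T ^^ m) ` A - (T ^^ m) ` B"
  using assms by (intro inj_on_image_set_diff[OF aut_funpow(1)[OF assms(1)]])
    (auto dest: sets.sets_into_space)

lemma aut_funpow_vimage:
  assumes "automorphism M T" "A \<in> sets M"
  shows "(T ^^ m) -` ((T ^^ m) ` A) \<inter> space M = A"
proof -
  have "A \<subseteq> space M" using assms(2) sets.sets_into_space by auto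
  then show ?thesis
    using aut_funpow(1)[OF assms(1), of m] by (auto simp: inj_on_def)
qed

lemma funpow_add_image: "(T ^^ (m + n)) ` A = (T ^^ m) ` ((T ^^ n) ` A)"
  by (simp add: funpow_add image_comp)

section \<open>Small covers and elementary inequalities\<close>

lemma additive_sum:
  fixes f :: "'a set \<Rightarrow> real"
  assumes add: "\<And>A B. A \<in> sets M \<Longrightarrow> B \<in> sets M \<Longrightarrow> A \<inter> B = {} \<Longrightarrow> f (A \<union> B) = f A + f B"
    and "finite I" "\<And>i. i \<in> I \<Longrightarrow> A i \<in> sets M" "disjoint_family_on A I"
  shows "f (\<Union>i\<in>I. A i) = (\<Sum>i\<in>I. f (A i))"
  using assms(2-)
proof (induction I)
  case empty
  show ?case using add[of "{}" "{}"] by simp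
next
  case (insert i I)
  have "A i \<inter> (\<Union>i\<in>I. A i) = {}" "disjoint_family_on A I"
    using insert.prems(2) insert.hyps(2) by (auto simp: disjoint_family_on_def)
  then show ?case
    using insert add[of "A i" "\<Union>i\<in>I. A i"] by (auto simp: sets.finite_UN)
qed

lemma (in prob_space) prob_le_add_Diff:
  assumes "A \<in> sets M" "B \<in> sets M" shows "prob A \<le> prob B + prob (A - B)"
  using finite_measure_mono[of A "B \<union> (A - B)"] measure_Un_le[of B M "A - B"] assms by fastforce

lemma (in prob_space) overlap_perturb:
  assumes aut: "automorphism M T" and X: "X \<in> sets M" "X' \<in> sets M" and Y: "Y \<in> sets M" "Y' \<in> sets M"
  shows "prob ((T ^^ m) ` X \<inter> Y) \<le> prob ((T ^^ m) ` X' \<inter> Y') + prob (X - X') + prob (Y - Y')"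
proof -
  note img = aut_funpow_image[OF aut]
  have "prob ((T ^^ m) ` X \<inter> Y) \<le> prob (((T ^^ m) ` X' \<inter> Y') \<union> (T ^^ m) ` (X - X') \<union> (Y - Y'))"
    unfolding aut_funpow_Diff[OF aut X]
    using X Y img(1) by (intro finite_measure_mono sets.Un sets.Int sets.Diff) auto
  also have "\<dots> \<le> prob ((T ^^ m) ` X' \<inter> Y') + prob ((T ^^ m) ` (X - X')) + prob (Y - Y')"
    using X Y img(1) by (meson measure_Un_le add_mono order_trans order_refl sets.Diff sets.Int sets.Un)
  finally show ?thesis using X img(2) by simp
qed

lemma sum_UN_le:
  fixes f :: "'b \<Rightarrow> real"
  assumes "finite I" "\<And>i. i \<in> I \<Longrightarrow> finite (X i)" "\<And>x. 0 \<le> f x"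
  shows "(\<Sum>x\<in>(\<Union>i\<in>I. X i). f x) \<le> (\<Sum>i\<in>I. \<Sum>x\<in>X i. f x)"
  using assms(1,2)
proof (induction I)
  case (insert i I)
  have "(\<Sum>x\<in>(\<Union>i\<in>insert i I. X i). f x) = (\<Sum>x\<in>X i \<union> (\<Union>i\<in>I. X i). f x)" by simp
  also have "\<dots> \<le> (\<Sum>x\<in>X i. f x) + (\<Sum>x\<in>(\<Union>i\<in>I. X i). f x)"
    using insert by (subst sum.union_inter[symmetric]) (auto intro!: sum_nonneg assms(3))
  finally show ?case using insert by (simp add: insert.hyps)
qed simp

text \<open>The isomorphism with the unit interval turns its division into \<open>q\<close> intervals into a cover of the space.
The intervals are closed, so the sets of the cover may overlap in null sets.\<close>

lemma nonatomic_small_cover: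
  assumes "lebesgue_probability_space M" "q > 0"
  obtains P :: "nat \<Rightarrow> 'a set" where
    "\<And>s. P s \<in> sets M" "\<And>s. measure M (P s) \<le> 1 / real q" "(\<Union>s<q. P s) = space M"
proof -
  let ?N = "lebesgue_on {0..1::real}"
  interpret prob_space M using assms(1) by (simp add: lebesgue_probability_space_def)
  obtain A B f where A: "A \<in> null_sets M" and B: "B \<in> null_sets ?N"
    and iso: "measure_isomorphism (restrict_space M (space M - A)) (restrict_space ?N (space ?N - B)) f"
    using assms(1) by (auto simp: lebesgue_probability_space_def isomorphic_mod_0_def)
  let ?M' = "restrict_space M (space M - A)" and ?N' = "restrict_space ?N (space ?N - B)"
  have f: "f \<in> measurable ?M' ?N'" and distr: "distr ?M' ?N' f = ?N'"
    using iso by (auto simp: measure_isomorphism_def)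
  have Aset: "A \<in> sets M" and Bset: "B \<in> sets ?N" using A B by auto
  have MA: "space M - A \<in> sets M" and NB: "space ?N - B \<in> sets ?N"
    using Aset Bset by auto
  have spM: "space ?M' = space M - A" using MA by (auto simp: space_restrict_space)
  have spN: "space ?N' = {0..1} - B" by (auto simp: space_restrict_space)
  define J where "J s = {real s / q .. (real s + 1) / q} \<inter> ({0..1} - B)" for s :: nat
  have J0: "{real s / q .. (real s + 1) / q} \<inter> {0..1} \<in> sets ?N" for s :: nat
    unfolding sets_restrict_space by (rule image_eqI[of _ _ "{real s / q .. (real s + 1) / q}"]) auto
  have J: "J s \<in> sets ?N'" for s
  proof -
    have "J s = ({0..1} - B) \<inter> ({real s / q .. (real s + 1) / q} \<inter> {0..1})"
      by (auto simp: J_def)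
    then show ?thesis
      using J0[of s] by (auto simp: sets_restrict_space[of ?N])
  qed
  have Jm: "emeasure ?N' (J s) \<le> ennreal (1 / q)" for s
  proof -
    have "J s = ({0..1} - B) \<inter> ({real s / q .. (real s + 1) / q} \<inter> {0..1})"
      by (auto simp: J_def)
    then have Js: "J s \<in> sets ?N"
      using J0[of s] NB by (metis sets.Int space_lebesgue_on)
    have "emeasure ?N' (J s) = emeasure ?N (J s)"
      using NB by (subst emeasure_restrict_space) (auto simp: J_def)
    also have "\<dots> = emeasure lebesgue (J s)"
      using Js by (subst emeasure_restrict_space) (auto simp: J_def)
    also have "\<dots> \<le> emeasure lebesgue {real s / q .. (real s + 1) / q}"
      by (intro emeasure_mono) (auto simp: J_def)
    also have "\<dots> = ennreal (1 / q)"
      using assms(2) by (simp add: divide_right_mono diff_divide_distrib[symmetric])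
    finally show ?thesis .
  qed
  define P0 where "P0 s = f -` J s \<inter> space ?M'" for s
  have P0': "P0 s \<in> sets ?M'" for s unfolding P0_def using f J by (rule measurable_sets)
  have P0: "P0 s \<in> sets M" for s
    using P0'[of s] MA by (metis sets_restrict_space_iff sets.Int sets.top inf.absorb_iff2 sets.sets_into_space)
  have P0sub: "P0 s \<subseteq> space M - A" for s by (auto simp: P0_def spM)
  have "emeasure M (P0 s) \<le> ennreal (1 / q)" for s
  proof -
    have "emeasure M (P0 s) = emeasure ?M' (P0 s)"
      using MA P0sub[of s] by (subst emeasure_restrict_space) auto
    also have "\<dots> = emeasure (distr ?M' ?N' f) (J s)"
      unfolding P0_def by (rule emeasure_distr[OF f J, symmetric])
    also have "\<dots> \<le> ennreal (1 / q)" unfolding distr by (rule Jm)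
    finally show ?thesis .
  qed
  then have P0m: "measure M (P0 s) \<le> 1 / q" for s
    by (simp add: emeasure_eq_measure)
  have cov: "(\<Union>s<q. P0 s) = space M - A"
  proof
    show "(\<Union>s<q. P0 s) \<subseteq> space M - A" using P0sub by auto
    show "space M - A \<subseteq> (\<Union>s<q. P0 s)"
    proof
      fix x assume x: "x \<in> space M - A"
      then have "f x \<in> space ?N'" by (intro measurable_space[OF f]) (simp add: spM)
      then have "f x \<in> {0..1} - B" unfolding spN .
      then have y: "0 \<le> f x" "f x \<le> 1" "f x \<notin> B" by auto
      show "x \<in> (\<Union>s<q. P0 s)"
      proof (cases "f x = 1")
        case True
        have "f x \<in> J (q - 1)" using True y assms(2) by (auto simp: J_def of_nat_diff field_simps)
        then have "x \<in> P0 (q - 1)" using x by (auto simp: P0_def spM)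
        then show ?thesis using assms(2) by auto
      next
        case False
        define s where "s = nat \<lfloor>f x * q\<rfloor>"
        have r: "real s = of_int \<lfloor>f x * q\<rfloor>" using y by (simp add: s_def)
        have s1: "real s \<le> f x * q" "f x * q < real s + 1" unfolding r by linarith+
        have "f x * q < q" using y False assms(2) by auto
        with s1 have "s < q" by linarith
        moreover have "f x \<in> J s" using s1 y assms(2) by (auto simp: J_def field_simps)
        ultimately show ?thesis using x by (auto simp: P0_def spM)
      qed
    qed
  qed
  show thesis
  proof
    show "P0 s \<union> A \<in> sets M" for s using P0 Aset by auto
    show "measure M (P0 s \<union> A) \<le> 1 / real q" for s
      using P0m[of s] A P0 measure_Un_null_set[of "P0 s" M A] by simp
    have "A \<subseteq> space M" using Aset sets.sets_into_space by auto
    then show "(\<Union>s<q. P0 s \<union> A) = space M"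
      using cov assms(2) by auto
  qed
qed

section \<open>Towers\<close>

text \<open>From here on a tower is described by the number \<open>n\<close> of its levels, which is one more than its height in
the convention of the theorem. The majority set of \<open>A\<close> indexes the levels that lie in \<open>A\<close> for more than
half: it turns disjoint sets into disjoint sets of levels, which an arbitrary choice of approximating
unions of levels would not do.\<close>

definition tower :: "'a measure \<Rightarrow> ('a \<Rightarrow> 'a) \<Rightarrow> 'a set \<Rightarrow> nat \<Rightarrow> bool" where
  "tower M T E n \<longleftrightarrow> E \<in> sets M \<and> disjoint_family_on (\<lambda>i. (T ^^ i) ` E) {..<n}"

definition majority :: "'a measure \<Rightarrow> ('a \<Rightarrow> 'a) \<Rightarrow> 'a set \<Rightarrow> nat \<Rightarrow> 'a set \<Rightarrow> nat set" where
  "majority M T E n A = {i. i < n \<and> measure M ((T ^^ i) ` E \<inter> A) > measure M E / 2}"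

definition union_levels :: "('a \<Rightarrow> 'a) \<Rightarrow> 'a set \<Rightarrow> nat set \<Rightarrow> 'a set" where
  "union_levels T E I = (\<Union>i\<in>I. (T ^^ i) ` E)"

text \<open>The quantitative content of convergence to the partition into points: the levels become small, the towers
fill the space, and majority sets approximate. The first two are consequences of the absence of atoms.\<close>

definition exhausting :: "'a measure \<Rightarrow> ('a \<Rightarrow> 'a) \<Rightarrow> (nat \<Rightarrow> 'a set) \<Rightarrow> (nat \<Rightarrow> nat) \<Rightarrow> bool" where
  "exhausting M T E n \<longleftrightarrow>
     (\<forall>j. tower M T (E j) (n j)) \<and>
     (\<lambda>j. measure M (E j)) \<longlonglongrightarrow> 0 \<and>
     (\<lambda>j. real (n j) * measure M (E j)) \<longlonglongrightarrow> 1 \<and>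
     (\<forall>A\<in>sets M. (\<lambda>j. measure M (sym_diff A (union_levels T (E j) (majority M T (E j) (n j) A)))) \<longlonglongrightarrow> 0)"

lemma majority_subset: "majority M T E n A \<subseteq> {..<n}"
  by (auto simp: majority_def)

lemma finite_majority [simp]: "finite (majority M T E n A)"
  by (rule finite_subset[OF majority_subset]) simp

lemma majority_disjoint:
  assumes "prob_space M" "automorphism M T" "E \<in> sets M" "A \<in> sets M" "B \<in> sets M" "A \<inter> B = {}"
  shows "majority M T E n A \<inter> majority M T E n B = {}"
proof -
  interpret prob_space M by fact
  { fix i assume i: "i \<in> majority M T E n A" "i \<in> majority M T E n B"
    let ?L = "(T ^^ i) ` E"
    have L: "?L \<in> sets M" "prob ?L = prob E"
      using aut_funpow_image[OF assms(2,3)] by auto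
    have "prob (?L \<inter> A) + prob (?L \<inter> B) = prob ((?L \<inter> A) \<union> (?L \<inter> B))"
      using L assms by (intro finite_measure_Union[symmetric]) auto
    also have "\<dots> \<le> prob ?L" using L by (intro finite_measure_mono) auto
    finally have False using i L by (auto simp: majority_def) }
  then show ?thesis by auto
qed

lemma sets_union_levels:
  assumes "automorphism M T" "E \<in> sets M" "finite I"
  shows "union_levels T E I \<in> sets M"
  unfolding union_levels_def using aut_funpow_image(1)[OF assms(1,2)] assms(3) by auto

lemma union_levels_Int_level:
  assumes "tower M T E n" "I \<subseteq> {..<n}" "a < n"
  shows "union_levels T E I \<inter> (T ^^ a) ` E = (if a \<in> I then (T ^^ a) ` E else {})"
proof -
  define B where "B i = (T ^^ i) ` E" for i
  have d: "B i \<inter> B a = {}" if "i \<in> I" "i \<noteq> a" for i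
    using assms that unfolding tower_def B_def[symmetric] disjoint_family_on_def by blast
  show ?thesis
    unfolding union_levels_def B_def[symmetric] using d by (cases "a \<in> I") auto
qed

lemma measure_union_levels:
  assumes "prob_space M" "automorphism M T" "tower M T E n" "I \<subseteq> {..<n}"
  shows "measure M (union_levels T E I) = real (card I) * measure M E"
proof -
  interpret prob_space M by fact
  have E: "E \<in> sets M" and d: "disjoint_family_on (\<lambda>i. (T ^^ i) ` E) {..<n}"
    using assms(3) by (auto simp: tower_def)
  have fin: "finite I" using assms(4) by (rule finite_subset) simp
  have "measure M (union_levels T E I) = (\<Sum>i\<in>I. measure M ((T ^^ i) ` E))"
    unfolding union_levels_def
    using aut_funpow_image(1)[OF assms(2) E] fin disjoint_family_on_mono[OF assms(4) d]
    by (intro finite_measure_finite_Union) auto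
  also have "\<dots> = real (card I) * measure M E"
    using aut_funpow_image(2)[OF assms(2) E] by simp
  finally show ?thesis .
qed

lemma tower_height_le:
  assumes "prob_space M" "automorphism M T" "tower M T E n"
  shows "real n * measure M E \<le> 1"
  using measure_union_levels[OF assms, of "{..<n}"] prob_space.prob_le_1[OF assms(1)]
  by (metis card_lessThan order_refl)

lemma tower_partition_atoms:
  assumes "tower_levels_disjoint T E h"
    and "C \<in> tower_partition M T E h" "D \<in> tower_partition M T E h"
  shows "C \<inter> D = {} \<or> C = D"
proof -
  define B where "B i = (T ^^ i) ` E" for i
  have d: "B i \<inter> B k = {} \<or> B i = B k" if "i \<in> {0..h}" "k \<in> {0..h}" for i k
    using assms(1) that unfolding tower_levels_disjoint_def B_def[symmetric] disjoint_family_on_def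
    by metis
  show ?thesis
    using assms(2,3) d unfolding tower_partition_def B_def[symmetric] by blast
qed

text \<open>Test the convergence on a cover by \<open>q\<close> sets of measure at most \<open>1 / q\<close>. An atom is either contained in the
approximant of some set of the cover, and is then hardly larger than that set, or it misses all
approximants, and is then covered by the \<open>q\<close> errors. This applies to the leftover set as well, which is
why the towers exhaust the space.\<close>

lemma tower_atoms_small:
  assumes "lebesgue_probability_space M"
    and aut: "automorphism M T"
    and E: "\<And>j. E j \<in> sets M" and disj: "\<And>j. tower_levels_disjoint T (E j) (h j)"
    and conv: "converges_to_points M (\<lambda>j. tower_partition M T (E j) (h j))"
    and "\<epsilon> > 0"
  shows "\<forall>\<^sub>F j in sequentially. \<forall>Z\<in>tower_partition M T (E j) (h j). measure M Z < \<epsilon>"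
proof -
  interpret prob_space M using assms(1) by (simp add: lebesgue_probability_space_def)
  obtain q :: nat where q: "1 / real q < \<epsilon> / 2" "q > 0"
    using real_arch_inverse[of "\<epsilon>/2"] \<open>\<epsilon> > 0\<close> by (auto simp: inverse_eq_divide)
  obtain P :: "nat \<Rightarrow> 'a set" where P: "\<And>s. P s \<in> sets M" "\<And>s. measure M (P s) \<le> 1 / real q"
    "(\<Union>s<q. P s) = space M"
    using nonatomic_small_cover[OF assms(1) q(2)] by metis
  have "\<forall>s. \<exists>As. (\<forall>j. \<exists>C\<subseteq>tower_partition M T (E j) (h j). As j = \<Union>C) \<and>
        (\<lambda>j. measure M ((P s - As j) \<union> (As j - P s))) \<longlonglongrightarrow> 0"
    using conv P(1) by (auto simp: converges_to_points_def)
  from choice[OF this] obtain As where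
    "\<forall>s. (\<forall>j. \<exists>C\<subseteq>tower_partition M T (E j) (h j). As s j = \<Union>C) \<and>
        (\<lambda>j. measure M ((P s - As s j) \<union> (As s j - P s))) \<longlonglongrightarrow> 0" by (elim exE)
  then have As: "\<And>s j. \<exists>C\<subseteq>tower_partition M T (E j) (h j). As s j = \<Union>C"
    and lim: "\<And>s. (\<lambda>j. measure M ((P s - As s j) \<union> (As s j - P s))) \<longlonglongrightarrow> 0"
    by blast+
  define \<delta> where "\<delta> = \<epsilon> / (2 * real q)"
  have \<delta>: "\<delta> > 0" "\<delta> \<le> \<epsilon> / 2" "real q * \<delta> = \<epsilon> / 2"
    using \<open>\<epsilon> > 0\<close> q(2) by (auto simp: \<delta>_def field_simps)
  have "\<forall>\<^sub>F j in sequentially. \<forall>s<q. measure M ((P s - As s j) \<union> (As s j - P s)) < \<delta>"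
    using order_tendstoD(2)[OF lim \<delta>(1)]
    by (subst eventually_ball_finite_distrib[of "{..<q}", simplified Ball_def lessThan_iff, simplified]) auto
  then show ?thesis
  proof eventually_elim
    case (elim j)
    show ?case
    proof
      fix Z assume Z: "Z \<in> tower_partition M T (E j) (h j)"
      have lev: "(T ^^ i) ` E j \<in> sets M" for i using aut_funpow_image(1)[OF aut E] .
      have atoms: "C \<in> sets M" if "C \<in> tower_partition M T (E j) (h j)" for C
        using that lev by (auto simp: tower_partition_def)
      have fin: "finite (tower_partition M T (E j) (h j))" by (simp add: tower_partition_def)
      have dis: "C \<inter> D = {} \<or> C = D"
        if "C \<in> tower_partition M T (E j) (h j)" "D \<in> tower_partition M T (E j) (h j)" for C D
        using tower_partition_atoms[OF disj that] .
      have Asm: "As s j \<in> sets M" for s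
      proof -
        obtain C where C: "C \<subseteq> tower_partition M T (E j) (h j)" "As s j = \<Union>C"
          using As[where s1=s and j1=j] by (elim exE conjE)
        have "C \<subseteq> sets M" using C(1) atoms by blast
        then show ?thesis
          unfolding C(2) using finite_subset[OF C(1) fin] by (intro sets.finite_Union)
      qed
      have cases: "Z \<subseteq> As s j \<or> Z \<inter> As s j = {}" for s
        using As[of j s] dis Z by blast
      show "prob Z < \<epsilon>"
      proof (cases "\<exists>s<q. Z \<subseteq> As s j")
        case True
        then obtain s where s: "s < q" "Z \<subseteq> As s j" by auto
        have "prob Z \<le> prob (P s \<union> ((P s - As s j) \<union> (As s j - P s)))"
          using s P Asm by (intro finite_measure_mono) auto
        also have "\<dots> \<le> prob (P s) + prob ((P s - As s j) \<union> (As s j - P s))"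
          using P Asm by (intro measure_Un_le) auto
        also have "\<dots> < \<epsilon>" using elim s(1) P(2)[of s] q(1) \<delta>(2) by force
        finally show ?thesis .
      next
        case False
        have "prob Z \<le> prob (\<Union>s<q. (P s - As s j) \<union> (As s j - P s))"
        proof (rule finite_measure_mono)
          show "Z \<subseteq> (\<Union>s<q. (P s - As s j) \<union> (As s j - P s))"
          proof
            fix x assume x: "x \<in> Z"
            then have "x \<in> space M" using atoms[OF Z] sets.sets_into_space by auto
            then obtain s where "s < q" "x \<in> P s" using P(3) by auto
            then show "x \<in> (\<Union>s<q. (P s - As s j) \<union> (As s j - P s))"
              using False cases[of s] x by auto
          qed
        qed (use P Asm in auto)
        also have "\<dots> \<le> (\<Sum>s<q. prob ((P s - As s j) \<union> (As s j - P s)))"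
          using P Asm by (intro finite_measure_subadditive_finite) auto
        also have "\<dots> \<le> (\<Sum>s<q. \<delta>)" using elim by (intro sum_mono) (auto intro: less_imp_le)
        also have "\<dots> < \<epsilon>" using \<delta>(3) \<open>\<epsilon> > 0\<close> by simp
        finally show ?thesis .
      qed
    qed
  qed
qed

text \<open>On a single level the majority choice is at least as good as any other choice of keeping or dropping the
whole level, so only the complement of the tower is lost.\<close>

lemma majority_error:
  assumes "prob_space M" and aut: "automorphism M T" and tw: "tower M T E n"
    and A: "A \<in> sets M" and A': "A' \<in> sets M"
    and dich: "\<And>i. i < n \<Longrightarrow> (T ^^ i) ` E \<subseteq> A' \<or> (T ^^ i) ` E \<inter> A' = {}"
  shows "measure M (sym_diff A (union_levels T E (majority M T E n A)))
     \<le> measure M (sym_diff A A') + measure M (space M - union_levels T E {..<n})"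
proof -
  interpret prob_space M by fact
  define Q where "Q = union_levels T E (majority M T E n A)"
  define B where "B i = (T ^^ i) ` E" for i
  define D where "D = sym_diff A Q"
  have E: "E \<in> sets M" and disj: "disjoint_family_on B {..<n}"
    using tw by (auto simp: tower_def B_def[abs_def])
  have B: "B i \<in> sets M" "prob (B i) = prob E" for i
    using aut_funpow_image[OF aut E] by (auto simp: B_def)
  have Q: "Q \<in> sets M" unfolding Q_def by (rule sets_union_levels[OF aut E]) simp
  have D: "D \<in> sets M" using A Q by (auto simp: D_def)
  have W: "union_levels T E {..<n} = (\<Union>i<n. B i)" by (simp add: union_levels_def B_def)
  have lev: "prob (B i \<inter> D) \<le> prob (B i \<inter> sym_diff A A')" if i: "i < n" for i
  proof -
    have split: "prob (B i) = prob (B i \<inter> A) + prob (B i - A)"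
      using finite_measure_Union[of "B i \<inter> A" "B i - A"] A B[of i]
      by (metis Int_Diff_disjoint Int_Diff_Un sets.Diff sets.Int)
    have Qi: "B i \<inter> Q = (if i \<in> majority M T E n A then B i else {})"
    proof (cases "i \<in> majority M T E n A")
      case True then show ?thesis by (auto simp: Q_def union_levels_def B_def)
    next
      case False
      then have "B i \<inter> B k = {}" if "k \<in> majority M T E n A" for k
        using that i disj majority_subset[of M T E n A]
        by (metis disjoint_family_onD lessThan_iff subsetD)
      then show ?thesis using False by (auto simp: Q_def union_levels_def B_def)
    qed
    show ?thesis
    proof (cases "i \<in> majority M T E n A")
      case True
      then have "B i \<inter> D = B i - A" using Qi by (auto simp: D_def)
      moreover have "prob (B i - A) \<le> prob (B i \<inter> A)"
        using True split B(2)[of i] by (auto simp: majority_def B_def)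
      ultimately show ?thesis
        using dich[OF i] A A' B[of i]
        by (auto simp: B_def intro: finite_measure_mono order_trans[OF _ finite_measure_mono])
    next
      case False
      then have "B i \<inter> D = B i \<inter> A" using Qi by (auto simp: D_def)
      moreover have "prob (B i \<inter> A) \<le> prob (B i - A)"
        using False i split B(2)[of i] by (auto simp: majority_def B_def)
      ultimately show ?thesis
        using dich[OF i] A A' B[of i]
        by (auto simp: B_def intro: finite_measure_mono order_trans[OF _ finite_measure_mono])
    qed
  qed
  have sum: "prob (\<Union>i<n. B i \<inter> C) = (\<Sum>i<n. prob (B i \<inter> C))" if "C \<in> sets M" for C
  proof (rule finite_measure_finite_Union)
    show "disjoint_family_on (\<lambda>i. B i \<inter> C) {..<n}"
      using disj unfolding disjoint_family_on_def by blast
  qed (use B that in auto)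
  have "prob D \<le> prob ((\<Union>i<n. B i \<inter> D) \<union> (space M - (\<Union>i<n. B i)))"
    using D B sets.sets_into_space[OF D] by (intro finite_measure_mono) auto
  also have "\<dots> \<le> prob (\<Union>i<n. B i \<inter> D) + prob (space M - (\<Union>i<n. B i))"
    using D B by (intro measure_Un_le) auto
  also have "prob (\<Union>i<n. B i \<inter> D) \<le> prob (\<Union>i<n. B i \<inter> sym_diff A A')"
    unfolding sum[OF D] using A A' by (subst sum) (auto intro!: sum_mono lev)
  also have "\<dots> \<le> prob (sym_diff A A')"
    using A A' by (intro finite_measure_mono) auto
  finally show ?thesis by (simp add: W D_def Q_def)
qed

lemma exhausting_of_height_sequence:
  assumes L: "lebesgue_probability_space M" and aut: "automorphism M T" and hs: "height_sequence M T h"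
  obtains E where "exhausting M T E (\<lambda>j. h j + 1)"
proof -
  interpret prob_space M using L by (simp add: lebesgue_probability_space_def)
  obtain E where E: "\<And>j. E j \<in> sets M" and disj: "\<And>j. tower_levels_disjoint T (E j) (h j)"
    and conv: "converges_to_points M (\<lambda>j. tower_partition M T (E j) (h j))"
    using hs by (auto simp: height_sequence_def)
  let ?\<xi> = "\<lambda>j. tower_partition M T (E j) (h j)"
  note small = tower_atoms_small[OF L aut E disj conv]
  have ivl: "{0..h j} = {..<h j + 1}" for j by auto
  have tw: "tower M T (E j) (h j + 1)" for j
    using E disj[of j] by (auto simp: tower_def tower_levels_disjoint_def ivl)
  define R where "R j = space M - union_levels T (E j) {..<h j + 1}" for j
  have Rin: "R j \<in> ?\<xi> j" for j by (simp add: R_def tower_partition_def union_levels_def ivl)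
  have Ein: "E j \<in> ?\<xi> j" for j
    unfolding tower_partition_def by (rule insertI2, rule image_eqI[of _ _ 0]) auto
  have lim0: "(\<lambda>j. prob (Z j)) \<longlonglongrightarrow> 0" if "\<And>j. Z j \<in> ?\<xi> j" for Z
  proof (rule tendstoI)
    fix r :: real assume "r > 0"
    from small[OF this] show "\<forall>\<^sub>F j in sequentially. dist (prob (Z j)) 0 < r"
      by eventually_elim (use that in auto)
  qed
  have Um: "union_levels T (E j) {..<h j + 1} \<in> sets M" for j
    by (rule sets_union_levels[OF aut E]) simp
  have "real (h j + 1) * prob (E j) = 1 - prob (R j)" for j
    using measure_union_levels[OF prob_space_axioms aut tw order_refl, of j] prob_compl[OF Um, of j]
    by (simp add: R_def)
  moreover have "(\<lambda>j. 1 - prob (R j)) \<longlonglongrightarrow> 1 - 0"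
    by (intro tendsto_diff tendsto_const lim0 Rin)
  ultimately have h1: "(\<lambda>j. real (h j + 1) * prob (E j)) \<longlonglongrightarrow> 1" by simp
  have maj: "(\<lambda>j. prob (sym_diff A (union_levels T (E j) (majority M T (E j) (h j + 1) A)))) \<longlonglongrightarrow> 0"
    if A: "A \<in> sets M" for A
  proof -
    obtain As where As: "\<And>j. \<exists>C\<subseteq>?\<xi> j. As j = \<Union>C"
      and lim: "(\<lambda>j. prob (sym_diff A (As j))) \<longlonglongrightarrow> 0"
      using conv A unfolding converges_to_points_def by metis
    have dis: "C \<inter> D = {} \<or> C = D" if "C \<in> ?\<xi> j" "D \<in> ?\<xi> j" for C D j
      using tower_partition_atoms[OF disj that] .
    have atoms: "C \<in> sets M" if "C \<in> ?\<xi> j" for C j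
      using that aut_funpow_image(1)[OF aut E] by (auto simp: tower_partition_def)
    have Asm: "As j \<in> sets M" for j
    proof -
      obtain C where C: "C \<subseteq> ?\<xi> j" "As j = \<Union>C" using As[where j1=j] by (elim exE conjE)
      have "finite C" using C(1) by (rule finite_subset) (simp add: tower_partition_def)
      moreover have "C \<subseteq> sets M" using C(1) atoms by blast
      ultimately show ?thesis unfolding C(2) by (rule sets.finite_Union)
    qed
    have bound: "prob (sym_diff A (union_levels T (E j) (majority M T (E j) (h j + 1) A)))
        \<le> prob (sym_diff A (As j)) + prob (R j)" for j
      unfolding R_def
    proof (rule majority_error[OF prob_space_axioms aut tw A Asm])
      fix i assume "i < h j + 1"
      then have "(T ^^ i) ` E j \<in> ?\<xi> j" by (auto simp: tower_partition_def)
      then show "(T ^^ i) ` E j \<subseteq> As j \<or> (T ^^ i) ` E j \<inter> As j = {}"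
        using As[of j] dis by blast
    qed
    have "(\<lambda>j. prob (sym_diff A (As j)) + prob (R j)) \<longlonglongrightarrow> 0 + 0"
      by (intro tendsto_add lim lim0 Rin)
    then have "(\<lambda>j. prob (sym_diff A (As j)) + prob (R j)) \<longlonglongrightarrow> 0" by simp
    then show ?thesis
      by (rule Lim_null_comparison[rotated]) (use bound in simp)
  qed
  have "exhausting M T E (\<lambda>j. h j + 1)"
    unfolding exhausting_def using tw lim0[OF Ein] h1 maj by blast
  then show thesis by (rule that)
qed

section \<open>Joinings as bimeasures on rectangles\<close>

text \<open>The argument only sees a joining through its values on rectangles, and uses nothing but finite additivity
in each factor, the marginals and invariance. Forgetting the measure on the product makes it trivial to
subtract a multiple of the product measure later on: if the difference is nonnegative on rectangles, it is
after normalisation again an object of the same kind.\<close>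

locale bijoining = prob_space M for M :: "'a measure" +
  fixes S T :: "'a \<Rightarrow> 'a" and \<beta> :: "'a set \<Rightarrow> 'a set \<Rightarrow> real"
  assumes aut_S: "automorphism M S" and aut_T: "automorphism M T"
    and \<beta>_nonneg: "A \<in> sets M \<Longrightarrow> B \<in> sets M \<Longrightarrow> 0 \<le> \<beta> A B"
    and \<beta>_Un_left: "A \<in> sets M \<Longrightarrow> A' \<in> sets M \<Longrightarrow> B \<in> sets M \<Longrightarrow> A \<inter> A' = {} \<Longrightarrow>
          \<beta> (A \<union> A') B = \<beta> A B + \<beta> A' B"
    and \<beta>_Un_right: "A \<in> sets M \<Longrightarrow> B \<in> sets M \<Longrightarrow> B' \<in> sets M \<Longrightarrow> B \<inter> B' = {} \<Longrightarrow>
          \<beta> A (B \<union> B') = \<beta> A B + \<beta> A B'"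
    and marginal_left: "A \<in> sets M \<Longrightarrow> \<beta> A (space M) = prob A"
    and marginal_right: "B \<in> sets M \<Longrightarrow> \<beta> (space M) B = prob B"
    and \<beta>_invariant: "A \<in> sets M \<Longrightarrow> B \<in> sets M \<Longrightarrow> \<beta> (S ` A) (T ` B) = \<beta> A B"
begin

lemma \<beta>_empty_left [simp]: "B \<in> sets M \<Longrightarrow> \<beta> {} B = 0"
  using \<beta>_Un_left[of "{}" "{}" B] by simp

lemma \<beta>_empty_right [simp]: "A \<in> sets M \<Longrightarrow> \<beta> A {} = 0"
  using \<beta>_Un_right[of A "{}" "{}"] by simp

lemma \<beta>_split_left:
  assumes "A \<in> sets M" "A' \<in> sets M" "B \<in> sets M"
  shows "\<beta> A B = \<beta> (A \<inter> A') B + \<beta> (A - A') B"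
  using \<beta>_Un_left[of "A \<inter> A'" "A - A'" B] assms by (simp add: Int_Diff_Un Int_Diff_disjoint)

lemma \<beta>_split_right:
  assumes "A \<in> sets M" "B \<in> sets M" "B' \<in> sets M"
  shows "\<beta> A B = \<beta> A (B \<inter> B') + \<beta> A (B - B')"
  using \<beta>_Un_right[of A "B \<inter> B'" "B - B'"] assms by (simp add: Int_Diff_Un Int_Diff_disjoint)

lemma \<beta>_mono:
  assumes "A \<in> sets M" "A' \<in> sets M" "B \<in> sets M" "B' \<in> sets M" "A \<subseteq> A'" "B \<subseteq> B'"
  shows "\<beta> A B \<le> \<beta> A' B'"
proof -
  have "\<beta> A B \<le> \<beta> A' B"
    using \<beta>_split_left[of A' A B] assms \<beta>_nonneg[of "A' - A" B] by (simp add: Int_absorb1)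
  also have "\<dots> \<le> \<beta> A' B'"
    using \<beta>_split_right[of A' B' B] assms \<beta>_nonneg[of A' "B' - B"] by (simp add: Int_absorb1)
  finally show ?thesis .
qed

lemma \<beta>_le_left: "A \<in> sets M \<Longrightarrow> B \<in> sets M \<Longrightarrow> \<beta> A B \<le> prob A"
  using \<beta>_mono[of A A B "space M"] sets.sets_into_space[of B M] by (simp add: marginal_left)

lemma \<beta>_le_right: "A \<in> sets M \<Longrightarrow> B \<in> sets M \<Longrightarrow> \<beta> A B \<le> prob B"
  using \<beta>_mono[of A "space M" B B] sets.sets_into_space[of A M] by (simp add: marginal_right)

lemma \<beta>_perturb:
  assumes "A \<in> sets M" "A' \<in> sets M" "B \<in> sets M" "B' \<in> sets M"
  shows "\<beta> A B \<le> \<beta> A' B' + prob (A - A') + prob (B - B')"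
proof -
  have "\<beta> A B = \<beta> (A \<inter> A') B + \<beta> (A - A') B" using assms by (intro \<beta>_split_left) auto
  moreover have "\<beta> (A \<inter> A') B = \<beta> (A \<inter> A') (B \<inter> B') + \<beta> (A \<inter> A') (B - B')"
    using assms by (intro \<beta>_split_right) auto
  moreover have "\<beta> (A \<inter> A') (B \<inter> B') \<le> \<beta> A' B'" using assms by (intro \<beta>_mono) auto
  moreover have "\<beta> (A - A') B \<le> prob (A - A')" "\<beta> (A \<inter> A') (B - B') \<le> prob (B - B')"
    using assms by (auto intro: \<beta>_le_left \<beta>_le_right)
  ultimately show ?thesis by linarith
qed

lemma \<beta>_sum_left:
  assumes "finite I" "\<And>i. i \<in> I \<Longrightarrow> A i \<in> sets M" "disjoint_family_on A I" "B \<in> sets M"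
  shows "\<beta> (\<Union>i\<in>I. A i) B = (\<Sum>i\<in>I. \<beta> (A i) B)"
  by (rule additive_sum[where M = M and f = "\<lambda>A. \<beta> A B"]) (use assms \<beta>_Un_left in auto)

lemma \<beta>_sum_right:
  assumes "finite I" "\<And>i. i \<in> I \<Longrightarrow> B i \<in> sets M" "disjoint_family_on B I" "A \<in> sets M"
  shows "\<beta> A (\<Union>i\<in>I. B i) = (\<Sum>i\<in>I. \<beta> A (B i))"
  by (rule additive_sum[where M = M and f = "\<beta> A"]) (use assms \<beta>_Un_right in auto)

lemma \<beta>_funpow:
  assumes "A \<in> sets M" "B \<in> sets M"
  shows "\<beta> ((S ^^ m) ` A) ((T ^^ m) ` B) = \<beta> A B"
proof (induction m)
  case (Suc m)
  show ?case
    using \<beta>_invariant[OF aut_funpow_image(1)[OF aut_S assms(1), of m]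
        aut_funpow_image(1)[OF aut_T assms(2), of m]] Suc
    by (simp add: image_comp)
qed simp

end

section \<open>Correlations along a tower\<close>

definition correlation :: "'a measure \<Rightarrow> ('a \<Rightarrow> 'a) \<Rightarrow> 'a set \<Rightarrow> real \<Rightarrow> nat \<Rightarrow> nat \<Rightarrow> real" where
  "correlation M T Q v b b' =
     (\<integral>y. (indicat_real Q ((T ^^ b) y) - v) * (indicat_real Q ((T ^^ b') y) - v) \<partial>M)"

lemma correlation_integral:
  assumes "prob_space M" and aut: "automorphism M T" and Q: "Q \<in> sets M" and le: "b \<le> b'"
  shows "correlation M T Q v b b' = measure M ((T ^^ (b' - b)) ` Q \<inter> Q) - 2 * v * measure M Q + v\<^sup>2"
proof -
  interpret prob_space M by fact
  define P where "P i = (T ^^ i) -` Q \<inter> space M" for i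
  have P: "P i \<in> sets M" for i
    unfolding P_def by (rule measurable_sets[OF aut_funpow_measurable[OF aut] Q])
  have Qsub: "Q \<subseteq> space M" using Q sets.sets_into_space by auto
  have img: "(T ^^ i) ` P i = Q" for i
  proof -
    have "(T ^^ i) ` P i = Q \<inter> (T ^^ i) ` space M" unfolding P_def by blast
    then show ?thesis using Qsub by (simp add: aut_funpow(2)[OF aut] Int_absorb2)
  qed
  have pP: "prob (P i) = prob Q" for i
    using aut_funpow_image(2)[OF aut P, of i i] by (simp add: img)
  have "(T ^^ b') ` P b = (T ^^ (b' - b)) ` Q"
    using funpow_add_image[of "b' - b" b T "P b"] le by (simp add: img)
  then have "(T ^^ b') ` (P b \<inter> P b') = (T ^^ (b' - b)) ` Q \<inter> Q"
    using aut_funpow_Int[OF aut P P, of b' b b'] by (simp add: img)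
  then have pPP: "prob (P b \<inter> P b') = prob ((T ^^ (b' - b)) ` Q \<inter> Q)"
    using aut_funpow_image(2)[OF aut, of "P b \<inter> P b'" b'] P by simp
  have "correlation M T Q v b b' = (\<integral>y. indicat_real (P b \<inter> P b') y - v * indicat_real (P b) y - v * indicat_real (P b') y + v\<^sup>2 \<partial>M)"
    unfolding correlation_def
    by (rule Bochner_Integration.integral_cong) (auto simp: P_def indicator_def power2_eq_square algebra_simps)
  also have "\<dots> = prob (P b \<inter> P b') - v * prob (P b) - v * prob (P b') + v\<^sup>2"
    using P by (simp add: emeasure_eq_measure prob_space)
  finally show ?thesis by (simp add: pPP pP)
qed

text \<open>Summing the square over the segment of \<open>L\<close> consecutive levels is integrating \<open>(\<Sum>b. u b * g (T ^^ b y))\<^sup>2\<close>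
over part of the tower. The square is nonnegative, so the integral over the whole space is larger, and
there the mixed terms are correlations of \<open>g\<close> under powers of \<open>T\<close>. Over the segment alone, mixing
would give no control of a single mixed term.\<close>

lemma segment_energy_le:
  fixes u :: "nat \<Rightarrow> real" and v :: real
  assumes "prob_space M" and aut: "automorphism M T" and tw: "tower M T E q" and J: "J \<subseteq> {..<q}"
    and Bs: "finite Bs" "\<And>b. b \<in> Bs \<Longrightarrow> b + L \<le> q"
  defines "Q \<equiv> union_levels T E J"
  shows "measure M E * (\<Sum>t<L. (\<Sum>b\<in>Bs. u b * (indicat_real J (b + t) - v))\<^sup>2)
    \<le> (\<Sum>b\<in>Bs. \<Sum>b'\<in>Bs. u b * u b' * correlation M T Q v b b')"
proof (cases "Bs = {}")
  case False
  interpret prob_space M by fact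
  have Lq: "L \<le> q" using False Bs(2) by (metis add_leE ex_in_conv)
  define B where "B i = (T ^^ i) ` E" for i
  have E: "E \<in> sets M" and disj: "disjoint_family_on B {..<q}"
    using tw by (auto simp: tower_def B_def[abs_def])
  have B: "B i \<in> sets M" "prob (B i) = prob E" for i
    using aut_funpow_image[OF aut E] by (auto simp: B_def)
  have finJ: "finite J" using J by (rule finite_subset) simp
  have Q: "Q \<in> sets M" unfolding Q_def by (rule sets_union_levels[OF aut E finJ])
  note Tm = aut_funpow_measurable[OF aut]
  have meas [measurable]: "(\<lambda>y. indicat_real Q ((T ^^ b) y)) \<in> borel_measurable M" for b
  proof -
    have "indicat_real Q \<in> borel_measurable M" using Q by simp
    then show ?thesis by (rule measurable_compose[OF Tm])
  qed
  define g where "g b y = indicat_real Q ((T ^^ b) y) - v" for b y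
  have gm [measurable]: "g b \<in> borel_measurable M" for b
    unfolding g_def[abs_def] by measurable
  have gb: "\<bar>g b y\<bar> \<le> 1 + \<bar>v\<bar>" for b y by (auto simp: g_def indicator_def)
  have ggi: "integrable M (\<lambda>y. g b y * g b' y)" for b b'
  proof (rule integrable_const_bound[where B = "(1 + \<bar>v\<bar>) * (1 + \<bar>v\<bar>)"])
    show "AE y in M. norm (g b y * g b' y) \<le> (1 + \<bar>v\<bar>) * (1 + \<bar>v\<bar>)"
      using mult_mono[OF gb gb] by (auto simp: abs_mult)
  qed simp
  define G where "G y = (\<Sum>b\<in>Bs. u b * g b y)" for y
  have G2: "(G y)\<^sup>2 = (\<Sum>b\<in>Bs. \<Sum>b'\<in>Bs. u b * u b' * (g b y * g b' y))" for y
    unfolding G_def power2_eq_square sum_product by (simp add: algebra_simps)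
  have Gi: "integrable M (\<lambda>y. (G y)\<^sup>2)"
    unfolding G2 by (intro Bochner_Integration.integrable_sum integrable_mult_right ggi)
  have onB: "G y = (\<Sum>b\<in>Bs. u b * (indicat_real J (b + t) - v))" if "t < L" "y \<in> B t" for t y
    unfolding G_def
  proof (rule sum.cong[OF refl])
    fix b assume b: "b \<in> Bs"
    have "(T ^^ b) y \<in> B (b + t)"
      using that(2) by (auto simp: B_def funpow_add)
    moreover have "b + t < q" using Bs(2)[OF b] that(1) by simp
    moreover have "B (b + t) \<inter> B k = {}" if "k \<in> J" "k \<noteq> b + t" for k
      using disj that J calculation(2) unfolding disjoint_family_on_def by (metis lessThan_iff subsetD)
    ultimately have "(T ^^ b) y \<in> Q \<longleftrightarrow> b + t \<in> J"
      unfolding Q_def union_levels_def B_def[symmetric] by auto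
    then show "u b * g b y = u b * (indicat_real J (b + t) - v)"
      by (simp add: g_def indicator_def)
  qed
  let ?W = "\<Union>t<L. B t"
  have indW: "indicat_real ?W y = (\<Sum>t<L. indicat_real (B t) y)" for y
  proof (rule indicator_UN_disjoint)
    show "disjoint_family_on B {..<L}"
      using disjoint_family_on_mono[OF _ disj] Lq by auto
  qed simp
  have "measure M E * (\<Sum>t<L. (\<Sum>b\<in>Bs. u b * (indicat_real J (b + t) - v))\<^sup>2)
      = (\<Sum>t<L. \<integral>y. (\<Sum>b\<in>Bs. u b * (indicat_real J (b + t) - v))\<^sup>2 * indicat_real (B t) y \<partial>M)"
    unfolding sum_distrib_left using B by (intro sum.cong) auto
  also have "\<dots> = (\<Sum>t<L. \<integral>y. (G y)\<^sup>2 * indicat_real (B t) y \<partial>M)"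
    by (intro sum.cong Bochner_Integration.integral_cong refl) (auto simp: onB indicator_def)
  also have "\<dots> = (\<integral>y. (\<Sum>t<L. (G y)\<^sup>2 * indicat_real (B t) y) \<partial>M)"
    using B Gi by (intro Bochner_Integration.integral_sum[symmetric] integrable_real_mult_indicator) auto
  also have "\<dots> \<le> (\<integral>y. (G y)\<^sup>2 \<partial>M)"
  proof (rule integral_mono)
    show "integrable M (\<lambda>y. \<Sum>t<L. (G y)\<^sup>2 * indicat_real (B t) y)"
      using B Gi by (intro Bochner_Integration.integrable_sum integrable_real_mult_indicator) auto
    show "(\<Sum>t<L. (G y)\<^sup>2 * indicat_real (B t) y) \<le> (G y)\<^sup>2" for y
      unfolding sum_distrib_left[symmetric] indW[symmetric] by (auto simp: indicator_def)
  qed (rule Gi)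
  also have "\<dots> = (\<Sum>b\<in>Bs. \<integral>y. (\<Sum>b'\<in>Bs. u b * u b' * (g b y * g b' y)) \<partial>M)"
    unfolding G2
    by (intro Bochner_Integration.integral_sum Bochner_Integration.integrable_sum integrable_mult_right ggi)
  also have "\<dots> = (\<Sum>b\<in>Bs. \<Sum>b'\<in>Bs. \<integral>y. u b * u b' * (g b y * g b' y) \<partial>M)"
    by (intro sum.cong refl Bochner_Integration.integral_sum integrable_mult_right ggi)
  also have "\<dots> = (\<Sum>b\<in>Bs. \<Sum>b'\<in>Bs. u b * u b' * (\<integral>y. g b y * g b' y \<partial>M))"
    by simp
  finally show ?thesis by (simp add: g_def correlation_def)
qed simp

section \<open>A pair of towers and its diagonals\<close>

locale tower_pair = bijoining M S T \<beta> for M :: "'a measure" and S T :: "'a \<Rightarrow> 'a" and \<beta> +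
  fixes F :: "'a set" and p :: nat and E :: "'a set" and q :: nat
  assumes tower_S: "tower M S F p" and tower_T: "tower M T E q"
begin

abbreviation "levF a \<equiv> (S ^^ a) ` F"
abbreviation "levE b \<equiv> (T ^^ b) ` E"
abbreviation "\<phi> \<equiv> prob F"
abbreviation "\<eta> \<equiv> prob E"

lemma F_sets: "F \<in> sets M" and E_sets: "E \<in> sets M"
  using tower_S tower_T by (auto simp: tower_def)

lemma levF_sets [simp, intro]: "levF a \<in> sets M" and levF_prob [simp]: "prob (levF a) = \<phi>"
  using aut_funpow_image[OF aut_S F_sets] by auto

lemma levE_sets [simp, intro]: "levE b \<in> sets M" and levE_prob [simp]: "prob (levE b) = \<eta>"
  using aut_funpow_image[OF aut_T E_sets] by auto

lemma disjoint_levF: "I \<subseteq> {..<p} \<Longrightarrow> disjoint_family_on levF I"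
  using tower_S disjoint_family_on_mono by (auto simp: tower_def)

lemma disjoint_levE: "I \<subseteq> {..<q} \<Longrightarrow> disjoint_family_on levE I"
  using tower_T disjoint_family_on_mono by (auto simp: tower_def)

lemma p_\<phi>_le: "real p * \<phi> \<le> 1" by (rule tower_height_le[OF prob_space_axioms aut_S tower_S])
lemma q_\<eta>_le: "real q * \<eta> \<le> 1" by (rule tower_height_le[OF prob_space_axioms aut_T tower_T])

definition w :: "nat \<Rightarrow> nat \<Rightarrow> real" where "w a b = \<beta> (levF a) (levE b)"

text \<open>By invariance the weight of a pair of levels depends only on its diagonal \<open>b - a\<close>, so it can be read off
where the diagonal starts.\<close>

definition c :: "int \<Rightarrow> real" where "c k = w (nat (- k)) (nat k)"

lemma w_nonneg [simp]: "0 \<le> w a b" by (simp add: w_def \<beta>_nonneg)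
lemma c_nonneg [simp]: "0 \<le> c k" by (simp add: c_def)

lemma w_shift: "w (a + t) (b + t) = w a b"
  using \<beta>_funpow[OF levF_sets[of a] levE_sets[of b], of t]
  by (simp add: w_def funpow_add_image[symmetric] add.commute)

lemma w_eq_c: "w a b = c (int b - int a)"
proof (cases "a \<le> b")
  case True
  then have "w a b = w 0 (b - a)" using w_shift[of 0 a "b - a"] by simp
  then show ?thesis using True by (simp add: c_def nat_diff_distrib')
next
  case False
  then have "w a b = w (a - b) 0" using w_shift[of "a - b" b 0] by simp
  then show ?thesis using False by (simp add: c_def nat_diff_distrib')
qed

lemma sum_w_row:
  assumes "J \<subseteq> {..<q}" shows "(\<Sum>b\<in>J. w a b) = \<beta> (levF a) (union_levels T E J)"
  unfolding w_def union_levels_def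
  using finite_subset[OF assms] disjoint_levE[OF assms] by (subst \<beta>_sum_right) auto

lemma sum_w_col:
  assumes "I \<subseteq> {..<p}" shows "(\<Sum>a\<in>I. w a b) = \<beta> (union_levels S F I) (levE b)"
  unfolding w_def union_levels_def
  using finite_subset[OF assms] disjoint_levF[OF assms] by (subst \<beta>_sum_left) auto

lemma sets_UF [simp]: "I \<subseteq> {..<p} \<Longrightarrow> union_levels S F I \<in> sets M"
  by (rule sets_union_levels[OF aut_S F_sets]) (rule finite_subset, auto)
lemma sets_UE [simp]: "I \<subseteq> {..<q} \<Longrightarrow> union_levels T E I \<in> sets M"
  by (rule sets_union_levels[OF aut_T E_sets]) (rule finite_subset, auto)

lemma sum_w_row_le: "J \<subseteq> {..<q} \<Longrightarrow> (\<Sum>b\<in>J. w a b) \<le> \<phi>"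
  using \<beta>_le_left[of "levF a" "union_levels T E J"] by (simp add: sum_w_row)
lemma sum_w_col_le: "I \<subseteq> {..<p} \<Longrightarrow> (\<Sum>a\<in>I. w a b) \<le> \<eta>"
  using \<beta>_le_right[of "union_levels S F I" "levE b"] by (simp add: sum_w_col)

lemma sum_w_rect:
  assumes "I \<subseteq> {..<p}" "J \<subseteq> {..<q}"
  shows "(\<Sum>a\<in>I. \<Sum>b\<in>J. w a b) = \<beta> (union_levels S F I) (union_levels T E J)"
  unfolding sum_w_row[OF assms(2)] union_levels_def[of S F]
  using finite_subset[OF assms(1)] disjoint_levF[OF assms(1)] assms(2)
  by (subst \<beta>_sum_left) auto

text \<open>The diagonals that meet the rectangle of index pairs. A diagonal may be very short, but each has its start
on one of the two sides of the rectangle, so the sum of their weights (one cell each) is at most the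
measure of one level of each tower, added up.\<close>

definition diags :: "int set" where "diags = {- int p<..<int q}"

lemma finite_diags [simp]: "finite diags" by (simp add: diags_def)

lemma sum_c_le: "(\<Sum>k\<in>diags. c k) \<le> \<phi> + \<eta>"
proof -
  have "(\<Sum>k\<in>diags. c k) \<le> (\<Sum>k\<in>int ` {..<q} \<union> (\<lambda>a. - int a) ` {..<p}. c k)"
  proof (rule sum_mono2)
    show "diags \<subseteq> int ` {..<q} \<union> (\<lambda>a. - int a) ` {..<p}"
    proof
      fix k assume k: "k \<in> diags"
      show "k \<in> int ` {..<q} \<union> (\<lambda>a. - int a) ` {..<p}"
      proof (cases "k \<ge> 0")
        case True
        then show ?thesis using k by (intro UnI1 image_eqI[of _ _ "nat k"]) (auto simp: diags_def)
      next
        case False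
        then show ?thesis using k by (intro UnI2 image_eqI[of _ _ "nat (- k)"]) (auto simp: diags_def)
      qed
    qed
  qed auto
  also have "\<dots> \<le> (\<Sum>k\<in>int ` {..<q}. c k) + (\<Sum>k\<in>(\<lambda>a. - int a) ` {..<p}. c k)"
    by (subst sum.union_inter[symmetric]) (auto simp: sum_nonneg)
  also have "(\<Sum>k\<in>int ` {..<q}. c k) = (\<Sum>b<q. w 0 b)"
    by (subst sum.reindex) (auto simp: inj_on_def w_eq_c)
  also have "(\<Sum>k\<in>(\<lambda>a. - int a) ` {..<p}. c k) = (\<Sum>a<p. w a 0)"
    by (subst sum.reindex) (auto simp: inj_on_def w_eq_c)
  finally show ?thesis using sum_w_row_le[of "{..<q}" 0] sum_w_col_le[of "{..<p}" 0] by simp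
qed

definition cluster :: "nat \<Rightarrow> int \<Rightarrow> real" where
  "cluster N k = (\<Sum>k'\<in>diags \<inter> {k - int N..k + int N}. c k')"

text \<open>A diagonal is heavy if its neighbourhood carries at least the share \<open>\<theta> / q\<close>. Since all clusters together
weigh at most \<open>2 N + 1\<close> times the sum of all \<open>c k\<close>, which is of order \<open>1 / q\<close>, the number of heavy
diagonals is bounded independently of the stage.\<close>

definition heavy :: "real \<Rightarrow> nat \<Rightarrow> int set" where
  "heavy \<theta> N = {k \<in> diags. \<theta> / real q \<le> cluster N k}"

lemma finite_heavy [simp]: "finite (heavy \<theta> N)" by (simp add: heavy_def)

lemma card_heavy_le:
  assumes "\<theta> > 0" "q > 0"
  shows "real (card (heavy \<theta> N)) \<le> (2 * real N + 1) * (real q * (\<phi> + \<eta>)) / \<theta>"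
proof -
  have "real (card (heavy \<theta> N)) * (\<theta> / real q) \<le> (\<Sum>k\<in>heavy \<theta> N. cluster N k)"
    using sum_bounded_below[of "heavy \<theta> N" "\<theta> / real q" "cluster N"] by (simp add: heavy_def)
  also have "\<dots> \<le> (\<Sum>k\<in>diags. cluster N k)"
    by (intro sum_mono2) (auto simp: heavy_def cluster_def sum_nonneg)
  also have "\<dots> = (\<Sum>k\<in>diags. \<Sum>k'\<in>diags. if \<bar>k - k'\<bar> \<le> int N then c k' else 0)"
  proof (rule sum.cong[OF refl])
    fix k
    have "diags \<inter> {k - int N..k + int N} = diags \<inter> {k'. \<bar>k - k'\<bar> \<le> int N}" by auto
    then show "cluster N k = (\<Sum>k'\<in>diags. if \<bar>k - k'\<bar> \<le> int N then c k' else 0)"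
      unfolding cluster_def by (subst sum.If_cases) simp_all
  qed
  also have "\<dots> = (\<Sum>k'\<in>diags. \<Sum>k\<in>diags. if \<bar>k - k'\<bar> \<le> int N then c k' else 0)"
    by (rule sum.swap)
  also have "\<dots> \<le> (\<Sum>k'\<in>diags. (2 * real N + 1) * c k')"
  proof (rule sum_mono)
    fix k' assume "k' \<in> diags"
    have "(\<Sum>k\<in>diags. if \<bar>k - k'\<bar> \<le> int N then c k' else 0)
        = real (card {k \<in> diags. \<bar>k - k'\<bar> \<le> int N}) * c k'"
      by (subst sum.inter_filter[symmetric]) auto
    also have "card {k \<in> diags. \<bar>k - k'\<bar> \<le> int N} \<le> card {k' - int N..k' + int N}"
      by (intro card_mono) auto
    also have "card {k' - int N..k' + int N} = 2 * N + 1" by simp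
    finally show "(\<Sum>k\<in>diags. if \<bar>k - k'\<bar> \<le> int N then c k' else 0) \<le> (2 * real N + 1) * c k'"
      by (simp add: mult_right_mono algebra_simps)
  qed
  also have "\<dots> \<le> (2 * real N + 1) * (\<phi> + \<eta>)"
    unfolding sum_distrib_left[symmetric] by (intro mult_left_mono sum_c_le) simp
  finally show ?thesis using assms by (simp add: field_simps)
qed

text \<open>Starting cells of diagonal segments of length \<open>L\<close> that stay inside the rectangle and avoid the diagonals
in \<open>K\<close>. For \<open>L = 0\<close> these are all the cells off \<open>K\<close>.\<close>

definition row :: "int set \<Rightarrow> nat \<Rightarrow> nat \<Rightarrow> nat set" where
  "row K L a = {b. b < q \<and> a + L \<le> p \<and> b + L \<le> q \<and> int b - int a \<notin> K}"

definition core :: "int set \<Rightarrow> nat \<Rightarrow> (nat \<times> nat) set" where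
  "core K L = (SIGMA a:{..<p}. row K L a)"

lemma finite_row [simp]: "finite (row K L a)" by (rule finite_subset[of _ "{..<q}"]) (auto simp: row_def)
lemma row_subset: "row K L a \<subseteq> {..<q}" by (auto simp: row_def)
lemma finite_core [simp]: "finite (core K L)" by (simp add: core_def)

lemma sum_core: "(\<Sum>(a,b)\<in>core K L. g a b) = (\<Sum>a<p. \<Sum>b\<in>row K L a. g a b)"
  unfolding core_def by (subst sum.Sigma) auto

lemma sum_w_strip_le:
  assumes "X \<subseteq> {..<p}" "Y \<subseteq> {..<q}"
  shows "(\<Sum>(a,b)\<in>X \<times> {..<q} \<union> {..<p} \<times> Y. w a b) \<le> real (card X) * \<phi> + real (card Y) * \<eta>"
proof -
  have fin: "finite X" "finite Y" using assms by (auto intro: finite_subset)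
  have "(\<Sum>(a,b)\<in>X \<times> {..<q} \<union> {..<p} \<times> Y. w a b)
      \<le> (\<Sum>(a,b)\<in>X \<times> {..<q}. w a b) + (\<Sum>(a,b)\<in>{..<p} \<times> Y. w a b)"
    using fin by (subst sum.union_inter[symmetric]) (auto intro!: sum_nonneg)
  also have "(\<Sum>(a,b)\<in>X \<times> {..<q}. w a b) = (\<Sum>a\<in>X. \<Sum>b<q. w a b)"
    by (simp add: sum.cartesian_product)
  also have "\<dots> \<le> (\<Sum>a\<in>X. \<phi>)" by (intro sum_mono sum_w_row_le) simp
  also have "(\<Sum>(a,b)\<in>{..<p} \<times> Y. w a b) = (\<Sum>b\<in>Y. \<Sum>a<p. w a b)"
    by (simp add: sum.cartesian_product[symmetric] sum.swap[of _ Y])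
  also have "\<dots> \<le> (\<Sum>b\<in>Y. \<eta>)" by (intro sum_mono sum_w_col_le) simp
  finally show ?thesis by simp
qed

text \<open>A sum over cells can be replaced by the average of \<open>g\<close> over segments of length \<open>L\<close>, at the cost of the
cells within \<open>L\<close> of the border: every cell is reached by a shift of \<open>t\<close> along its diagonal, where the
weight is constant.\<close>

lemma segment_shift_le:
  assumes "t < L" "\<And>a b. 0 \<le> g a b"
  shows "(\<Sum>(a,b)\<in>core K L. g (a + t) (b + t) * w a b) \<le> (\<Sum>(a,b)\<in>core K 0. g a b * w a b)"
proof -
  let ?s = "\<lambda>(a,b). (a + t, b + t)"
  have inj: "inj_on ?s (core K L)" by (auto simp: inj_on_def)
  have "(\<Sum>(a,b)\<in>core K L. g (a + t) (b + t) * w a b) = (\<Sum>(a,b)\<in>?s ` core K L. g a b * w a b)"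
    using inj by (subst sum.reindex) (auto simp: case_prod_beta w_shift)
  also have "\<dots> \<le> (\<Sum>(a,b)\<in>core K 0. g a b * w a b)"
    using assms by (intro sum_mono2) (auto simp: core_def row_def mult_nonneg_nonneg)
  finally show ?thesis .
qed

lemma segment_shift_ge:
  assumes "t < L" "\<And>a b. 0 \<le> g a b" "\<And>a b. g a b \<le> 1"
  shows "(\<Sum>(a,b)\<in>core K 0. g a b * w a b)
    \<le> (\<Sum>(a,b)\<in>core K L. g (a + t) (b + t) * w a b) + real L * (\<phi> + \<eta>)"
proof -
  let ?s = "\<lambda>(a,b). (a + t, b + t)"
  define X where "X = {a. a < p \<and> (a < t \<or> p + t < a + L)}"
  define Y where "Y = {b. b < q \<and> (b < t \<or> q + t < b + L)}"
  have cX: "card {a. a < m \<and> (a < t \<or> m + t < a + L)} \<le> L" for m :: nat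
  proof -
    have "card {a. a < m \<and> (a < t \<or> m + t < a + L)} \<le> card ({..<t} \<union> {m + t + 1 - L..<m})"
      by (intro card_mono) auto
    also have "\<dots> \<le> t + (m - (m + t + 1 - L))"
      using card_Un_le[of "{..<t}" "{m + t + 1 - L..<m}"] by simp
    also have "\<dots> \<le> L" using assms(1) by simp
    finally show ?thesis .
  qed
  have cXY: "card X \<le> L" "card Y \<le> L" unfolding X_def Y_def by (rule cX)+
  let ?S = "X \<times> {..<q} \<union> {..<p} \<times> Y"
  have inj: "inj_on ?s (core K L)" by (auto simp: inj_on_def)
  have sub: "core K 0 \<subseteq> ?s ` core K L \<union> ?S"
  proof (rule subrelI)
    fix a b assume ab: "(a, b) \<in> core K 0"
    show "(a, b) \<in> ?s ` core K L \<union> ?S"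
    proof (cases "a \<in> X \<or> b \<in> Y")
      case False
      then have "(a - t, b - t) \<in> core K L" "t \<le> a" "t \<le> b"
        using ab by (auto simp: core_def row_def X_def Y_def of_nat_diff)
      then show ?thesis by (intro UnI1 image_eqI[of _ _ "(a - t, b - t)"]) auto
    qed (use ab in \<open>auto simp: core_def row_def\<close>)
  qed
  have "(\<Sum>(a,b)\<in>core K 0. g a b * w a b)
      \<le> (\<Sum>(a,b)\<in>?s ` core K L \<union> ?S. g a b * w a b)"
    using assms sub by (intro sum_mono2) (auto simp: X_def Y_def)
  also have "\<dots> \<le> (\<Sum>(a,b)\<in>?s ` core K L. g a b * w a b)
      + (\<Sum>(a,b)\<in>?S. g a b * w a b)"
    using assms by (subst sum.union_inter[symmetric]) (auto intro!: sum_nonneg simp: X_def Y_def)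
  also have "(\<Sum>(a,b)\<in>?s ` core K L. g a b * w a b) = (\<Sum>(a,b)\<in>core K L. g (a + t) (b + t) * w a b)"
    using inj by (subst sum.reindex) (auto simp: case_prod_beta w_shift)
  also have "(\<Sum>(a,b)\<in>?S. g a b * w a b)
      \<le> (\<Sum>(a,b)\<in>?S. w a b)"
    using assms by (intro sum_mono) (auto intro: mult_left_le_one_le)
  also have "\<dots> \<le> real (card X) * \<phi> + real (card Y) * \<eta>"
    by (rule sum_w_strip_le) (auto simp: X_def Y_def)
  also have "\<dots> \<le> real L * (\<phi> + \<eta>)"
    using cXY by (auto simp: distrib_left intro!: add_mono mult_right_mono)
  finally show ?thesis by simp
qed

section \<open>The mass off a set of diagonals\<close>

text \<open>As a function of \<open>A\<close> this is the first marginal of the part of the joining carried by the cells off \<open>K\<close>.\<close>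

definition off_mass :: "int set \<Rightarrow> 'a set \<Rightarrow> real" where
  "off_mass K A = (\<Sum>(a,b)\<in>core K 0. \<beta> (A \<inter> levF a) (levE b))"

lemma off_mass_union_levels:
  assumes "I \<subseteq> {..<p}"
  shows "off_mass K (union_levels S F I) = (\<Sum>(a,b)\<in>core K 0. indicat_real I a * w a b)"
  unfolding off_mass_def
proof (intro sum.cong refl, clarify)
  fix a b assume "(a, b) \<in> core K 0"
  then have "a < p" by (auto simp: core_def)
  then have "union_levels S F I \<inter> levF a = (if a \<in> I then levF a else {})"
    using union_levels_Int_level[OF tower_S assms] by simp
  then show "\<beta> (union_levels S F I \<inter> levF a) (levE b) = indicat_real I a * w a b"
    by (simp add: w_def)
qed

text \<open>The second moment estimate behind the spreading argument, for unions of levels. Write the mass on the cells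
off \<open>K\<close> as an average over segments and split the indicator of \<open>J\<close> into its mean \<open>v\<close> and the centred part
\<open>g\<close>. The mean gives the main term. For the centred part, \<open>G a t\<close> is a weighted sum of the values of \<open>g\<close>
seen from the level \<open>a\<close>; the sum of its squares consists of near pairs, which are few because the cells
avoid the heavy diagonals, and of far pairs, which are nearly uncorrelated. The parameter \<open>\<sigma>\<close> comes from
bounding \<open>\<bar>G\<bar>\<close> by \<open>(\<sigma> \<phi> + G\<^sup>2 / (\<sigma> \<phi>)) / 2\<close>.\<close>

lemma spread_bound:
  assumes I: "I \<subseteq> {..<p}" and J: "J \<subseteq> {..<q}" and v: "0 \<le> v" "v \<le> 1"
    and L: "L > 0" and pos: "0 < \<phi>" "0 < \<eta>" "0 < \<sigma>" and \<epsilon>: "0 \<le> \<epsilon>" and \<theta>: "0 \<le> \<theta>"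
    and light: "\<And>k. k \<in> diags \<Longrightarrow> k \<notin> K \<Longrightarrow> cluster N k \<le> \<theta> / real q"
    and corr: "\<And>m. m > N \<Longrightarrow>
      prob ((T ^^ m) ` union_levels T E J \<inter> union_levels T E J) - 2 * v * prob (union_levels T E J) + v\<^sup>2 \<le> \<epsilon>"
    and C: "real p \<le> C * real q" and q: "q > 0"
  shows "v * (off_mass K (union_levels S F I) - real L * (\<phi> + \<eta>)) - (\<sigma> + (\<theta> * C + \<epsilon>) / (\<sigma> * (real L * \<eta>))) / 2
    \<le> \<beta> (union_levels S F I) (union_levels T E J)"
proof -
  let ?m = "off_mass K (union_levels S F I) - real L * (\<phi> + \<eta>)"
  define Q where "Q = union_levels T E J"
  have Q: "Q \<in> sets M" using J by (simp add: Q_def)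
  define X where "X = (\<Sum>(a,b)\<in>core K 0. indicat_real I a * indicat_real J b * w a b)"
  define g where "g b = indicat_real J b - v" for b
  define Z where "Z t = (\<Sum>(a,b)\<in>core K L. indicat_real I (a + t) * w a b)" for t
  define G where "G a t = (\<Sum>b\<in>row K L a. w a b * g (b + t))" for a t
  define R where "R t = (\<Sum>a<p. indicat_real I (a + t) * G a t)" for t
  have fin: "finite I" "finite J" using I J by (auto intro: finite_subset)
  have X1: "X \<le> \<beta> (union_levels S F I) (union_levels T E J)"
  proof -
    have "X \<le> (\<Sum>(a,b)\<in>{..<p} \<times> {..<q}. indicat_real I a * indicat_real J b * w a b)"
      unfolding X_def by (intro sum_mono2) (auto simp: core_def row_def)
    also have "\<dots> = (\<Sum>(a,b)\<in>I \<times> J. w a b)"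
      using I J by (intro sum.mono_neutral_cong_right) (auto simp: indicator_def)
    also have "\<dots> = (\<Sum>a\<in>I. \<Sum>b\<in>J. w a b)" by (simp add: sum.cartesian_product)
    finally show ?thesis by (simp add: sum_w_rect[OF I J])
  qed
  have X2: "v * Z t + R t \<le> X" if t: "t < L" for t
  proof -
    have "v * Z t + R t = (\<Sum>(a,b)\<in>core K L. indicat_real I (a + t) * indicat_real J (b + t) * w a b)"
      unfolding Z_def R_def G_def sum_core g_def sum_distrib_left sum.distrib[symmetric]
      by (intro sum.cong refl) (simp only: algebra_simps)
    also have "\<dots> \<le> X"
      unfolding X_def using t
      by (intro segment_shift_le[where g = "\<lambda>a b. indicat_real I a * indicat_real J b"]) auto
    finally show ?thesis .
  qed
  have Z: "?m \<le> Z t" if t: "t < L" for t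
    using segment_shift_ge[of t L "\<lambda>a b. indicat_real I a" K] t
    by (auto simp: off_mass_union_levels[OF I] Z_def)
  have energy: "(\<Sum>t<L. (G a t)\<^sup>2) \<le> (\<phi> * (\<theta> / real q) + \<epsilon> * \<phi>\<^sup>2) / \<eta>" for a
  proof -
    define \<kappa> where "\<kappa> = correlation M T Q v"
    have \<kappa>sym: "\<kappa> b b' = \<kappa> b' b" for b b' by (simp add: \<kappa>_def correlation_def mult.commute)
    have \<kappa>eq: "\<kappa> b b' = prob ((T ^^ (b' - b)) ` Q \<inter> Q) - 2 * v * prob Q + v\<^sup>2" if "b \<le> b'" for b b'
      unfolding \<kappa>_def by (rule correlation_integral[OF prob_space_axioms aut_T Q that])
    have \<kappa>1: "\<kappa> b b' \<le> 1" if "b \<le> b'" for b b'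
    proof -
      have "(T ^^ (b' - b)) ` Q \<in> sets M" by (rule aut_funpow_image(1)[OF aut_T Q])
      then have "prob ((T ^^ (b' - b)) ` Q \<inter> Q) \<le> prob Q"
        using Q by (intro finite_measure_mono) auto
      then have "\<kappa> b b' \<le> prob Q - 2 * v * prob Q + v\<^sup>2" using \<kappa>eq[OF that] by simp
      also have "\<dots> = (1 - v) * ((1 - v) * prob Q) + (v * v) * (1 - prob Q)"
        by (simp add: power2_eq_square algebra_simps)
      also have "\<dots> \<le> 1 * (1 * prob Q) + (1 * 1) * (1 - prob Q)"
        using v prob_le_1[of Q] by (intro add_mono mult_mono mult_nonneg_nonneg) auto
      finally show ?thesis by simp
    qed
    have \<kappa>le1: "\<kappa> b b' \<le> 1" for b b'
      using \<kappa>1[of b b'] \<kappa>1[of b' b] \<kappa>sym[of b b'] by (cases "b \<le> b'") auto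
    have \<kappa>far1: "\<kappa> b b' \<le> \<epsilon>" if "b + N < b'" for b b'
      using corr[of "b' - b"] \<kappa>eq[of b b'] that by (simp add: Q_def)
    have \<kappa>far: "\<kappa> b b' \<le> \<epsilon>" if "\<not> (b \<le> b' + N \<and> b' \<le> b + N)" for b b'
      using that \<kappa>far1[of b b'] \<kappa>far1[of b' b] \<kappa>sym[of b b'] by (cases "b \<le> b' + N") auto
    have rowsum: "(\<Sum>b\<in>row K L a. w a b) \<le> \<phi>" by (rule sum_w_row_le[OF row_subset])
    have near: "(\<Sum>b'\<in>{b' \<in> row K L a. b \<le> b' + N \<and> b' \<le> b + N}. w a b') \<le> \<theta> / real q"
      if b: "b \<in> row K L a" "a < p" for b
    proof -
      let ?f = "\<lambda>b'. int b' - int a" and ?R = "{b' \<in> row K L a. b \<le> b' + N \<and> b' \<le> b + N}"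
      have "(\<Sum>b'\<in>?R. w a b') = (\<Sum>k\<in>?f ` ?R. c k)"
        by (subst sum.reindex) (auto simp: inj_on_def w_eq_c)
      also have "\<dots> \<le> cluster N (int b - int a)"
        unfolding cluster_def using b by (intro sum_mono2) (auto simp: diags_def row_def)
      also have "\<dots> \<le> \<theta> / real q"
        using b by (intro light) (auto simp: diags_def row_def)
      finally show ?thesis .
    qed
    have "\<eta> * (\<Sum>t<L. (G a t)\<^sup>2) \<le> (\<Sum>b\<in>row K L a. \<Sum>b'\<in>row K L a. w a b * w a b' * \<kappa> b b')"
      unfolding G_def g_def \<kappa>_def Q_def
      by (rule segment_energy_le[OF prob_space_axioms aut_T tower_T J]) (auto simp: row_def)
    also have "\<dots> \<le> (\<Sum>b\<in>row K L a. w a b * (\<theta> / real q + \<epsilon> * \<phi>))"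
    proof (rule sum_mono)
      fix b assume b: "b \<in> row K L a"
      show "(\<Sum>b'\<in>row K L a. w a b * w a b' * \<kappa> b b') \<le> w a b * (\<theta> / real q + \<epsilon> * \<phi>)"
      proof (cases "a < p")
        case True
        have "(\<Sum>b'\<in>row K L a. w a b' * \<kappa> b b')
            \<le> (\<Sum>b'\<in>row K L a. (if b \<le> b' + N \<and> b' \<le> b + N then w a b' else 0) + w a b' * \<epsilon>)"
        proof (rule sum_mono)
          fix b'
          show "w a b' * \<kappa> b b' \<le> (if b \<le> b' + N \<and> b' \<le> b + N then w a b' else 0) + w a b' * \<epsilon>"
          proof (cases "b \<le> b' + N \<and> b' \<le> b + N")
            case True
            have "w a b' * \<kappa> b b' \<le> w a b' * 1" by (intro mult_left_mono \<kappa>le1) simp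
            moreover have "0 \<le> w a b' * \<epsilon>" using \<epsilon> by simp
            ultimately show ?thesis using True by auto
          next
            case False
            have "w a b' * \<kappa> b b' \<le> w a b' * \<epsilon>" by (intro mult_left_mono \<kappa>far False) simp
            then show ?thesis using False by auto
          qed
        qed
        also have "\<dots> = (\<Sum>b'\<in>{b' \<in> row K L a. b \<le> b' + N \<and> b' \<le> b + N}. w a b') + (\<Sum>b'\<in>row K L a. w a b') * \<epsilon>"
          by (simp add: sum.distrib sum.inter_filter sum_distrib_right)
        also have "\<dots> \<le> \<theta> / real q + \<phi> * \<epsilon>"
          using near[OF b True] rowsum \<epsilon> by (intro add_mono mult_right_mono) auto
        finally have "w a b * (\<Sum>b'\<in>row K L a. w a b' * \<kappa> b b') \<le> w a b * (\<theta> / real q + \<phi> * \<epsilon>)"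
          by (rule mult_left_mono) simp
        then show ?thesis by (simp add: sum_distrib_left mult.assoc mult.commute[of \<epsilon>])
      next
        case False
        then have "row K L a = {}" using L by (auto simp: row_def)
        then show ?thesis using b by simp
      qed
    qed
    also have "\<dots> = (\<Sum>b\<in>row K L a. w a b) * (\<theta> / real q + \<epsilon> * \<phi>)" by (simp add: sum_distrib_right)
    also have "\<dots> \<le> \<phi> * (\<theta> / real q + \<epsilon> * \<phi>)"
      using rowsum \<epsilon> \<theta> by (intro mult_right_mono) auto
    finally show ?thesis using pos by (simp add: field_simps power2_eq_square)
  qed
  have Rabs: "- R t \<le> (\<Sum>a<p. (\<sigma> * \<phi> + (G a t)\<^sup>2 / (\<sigma> * \<phi>)) / 2)" for t
  proof -
    have "- R t = (\<Sum>a<p. - (indicat_real I (a + t) * G a t))" by (simp add: R_def sum_negf)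
    also have "\<dots> \<le> (\<Sum>a<p. (\<sigma> * \<phi> + (G a t)\<^sup>2 / (\<sigma> * \<phi>)) / 2)"
    proof (rule sum_mono)
      fix a
      define s where "s = \<sigma> * \<phi>"
      have s: "s > 0" using pos by (simp add: s_def)
      have "- (indicat_real I (a + t) * G a t) \<le> \<bar>G a t\<bar>" by (auto simp: indicator_def)
      moreover have "\<bar>G a t\<bar> \<le> (\<sigma> * \<phi> + (G a t)\<^sup>2 / (\<sigma> * \<phi>)) / 2"
      proof -
        have "(2 * \<bar>G a t\<bar>) * s \<le> s\<^sup>2 + (G a t)\<^sup>2"
          using zero_le_power2[of "\<bar>G a t\<bar> - s"] by (simp add: power2_diff algebra_simps)
        then have "2 * \<bar>G a t\<bar> \<le> (s\<^sup>2 + (G a t)\<^sup>2) / s"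
          using s by (simp add: pos_le_divide_eq)
        also have "\<dots> = s + (G a t)\<^sup>2 / s" using s by (simp add: add_divide_distrib power2_eq_square)
        finally show ?thesis by (simp add: s_def)
      qed
      ultimately show "- (indicat_real I (a + t) * G a t) \<le> (\<sigma> * \<phi> + (G a t)\<^sup>2 / (\<sigma> * \<phi>)) / 2"
        by linarith
    qed
    finally show ?thesis .
  qed
  have Rsum: "- (\<Sum>t<L. R t) \<le> real L * \<sigma> / 2 + (\<theta> * C + \<epsilon>) / (2 * \<sigma> * \<eta>)"
  proof -
    have "- (\<Sum>t<L. R t) = (\<Sum>t<L. - R t)" by (simp add: sum_negf)
    also have "\<dots> \<le> (\<Sum>t<L. \<Sum>a<p. (\<sigma> * \<phi> + (G a t)\<^sup>2 / (\<sigma> * \<phi>)) / 2)"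
      by (intro sum_mono Rabs)
    also have "\<dots> = real L * (real p * \<phi>) * \<sigma> / 2 + (\<Sum>a<p. \<Sum>t<L. (G a t)\<^sup>2) / (2 * \<sigma> * \<phi>)"
      by (simp add: sum.distrib sum_divide_distrib[symmetric] add_divide_distrib sum.swap[of _ "{..<p}"] mult_ac)
    also have "\<dots> \<le> real L * 1 * \<sigma> / 2 + (\<Sum>a<p. (\<phi> * (\<theta> / real q) + \<epsilon> * \<phi>\<^sup>2) / \<eta>) / (2 * \<sigma> * \<phi>)"
      using pos p_\<phi>_le
      by (intro add_mono divide_right_mono mult_right_mono mult_left_mono sum_mono energy) auto
    also have "(\<Sum>a<p. (\<phi> * (\<theta> / real q) + \<epsilon> * \<phi>\<^sup>2) / \<eta>) / (2 * \<sigma> * \<phi>)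
        = (\<theta> * (real p / real q) + \<epsilon> * (real p * \<phi>)) / (2 * \<sigma> * \<eta>)"
      using pos by (simp add: field_simps power2_eq_square)
    also have "\<dots> \<le> (\<theta> * C + \<epsilon> * 1) / (2 * \<sigma> * \<eta>)"
      using pos \<epsilon> \<theta> C q p_\<phi>_le
      by (intro divide_right_mono add_mono mult_left_mono) (auto simp: field_simps)
    finally show ?thesis by simp
  qed
  have "real L * X = (\<Sum>t<L. X)" by simp
  also have "\<dots> \<ge> (\<Sum>t<L. v * ?m + R t)"
    using X2 mult_left_mono[OF Z v(1)] by (intro sum_mono) force
  also have "(\<Sum>t<L. v * ?m + R t)
      = real L * (v * ?m) + (\<Sum>t<L. R t)"
    by (simp add: sum.distrib)
  finally have "real L * (v * ?m)
     \<le> real L * X + (real L * \<sigma> / 2 + (\<theta> * C + \<epsilon>) / (2 * \<sigma> * \<eta>))"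
    using Rsum by linarith
  also have "\<dots> = real L * (X + (\<sigma> + (\<theta> * C + \<epsilon>) / (\<sigma> * (real L * \<eta>))) / 2)"
    using L pos by (simp add: field_simps)
  finally have "v * ?m \<le> X + (\<sigma> + (\<theta> * C + \<epsilon>) / (\<sigma> * (real L * \<eta>))) / 2"
    using L by simp
  with X1 show ?thesis by linarith
qed

end

context tower_pair begin

lemma core0: "core K 0 = {(a, b). a < p \<and> b < q \<and> int b - int a \<notin> K}"
  by (auto simp: core_def row_def)

lemma core_subset: "core K L \<subseteq> {..<p} \<times> {..<q}"
  by (auto simp: core_def row_def)

lemma off_mass_nonneg: "A \<in> sets M \<Longrightarrow> 0 \<le> off_mass K A"
  unfolding off_mass_def by (intro sum_nonneg) (auto intro!: \<beta>_nonneg)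

lemma off_mass_Un:
  assumes "A \<in> sets M" "A' \<in> sets M" "A \<inter> A' = {}"
  shows "off_mass K (A \<union> A') = off_mass K A + off_mass K A'"
  unfolding off_mass_def sum.distrib[symmetric]
proof (intro sum.cong refl, clarify)
  fix a b
  have "(A \<union> A') \<inter> levF a = (A \<inter> levF a) \<union> (A' \<inter> levF a)" by auto
  then show "\<beta> ((A \<union> A') \<inter> levF a) (levE b) = \<beta> (A \<inter> levF a) (levE b) + \<beta> (A' \<inter> levF a) (levE b)"
    using assms by (simp, intro \<beta>_Un_left) auto
qed

lemma off_mass_empty [simp]: "off_mass K {} = 0"
  using off_mass_Un[of "{}" "{}" K] by simp

lemma off_mass_le_prob:
  assumes A: "A \<in> sets M" shows "off_mass K A \<le> prob A"
proof -
  have "off_mass K A \<le> (\<Sum>(a,b)\<in>{..<p} \<times> {..<q}. \<beta> (A \<inter> levF a) (levE b))"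
    unfolding off_mass_def using A core_subset by (intro sum_mono2) (auto intro!: \<beta>_nonneg)
  also have "\<dots> = (\<Sum>a<p. \<Sum>b<q. \<beta> (A \<inter> levF a) (levE b))"
    by (simp add: sum.cartesian_product)
  also have "\<dots> = (\<Sum>a<p. \<beta> (A \<inter> levF a) (\<Union>b<q. levE b))"
    using A disjoint_levE[OF order_refl] by (intro sum.cong refl, subst \<beta>_sum_right) auto
  also have "\<dots> \<le> (\<Sum>a<p. prob (A \<inter> levF a))"
    using A by (intro sum_mono \<beta>_le_left) auto
  also have "\<dots> = prob (\<Union>a<p. A \<inter> levF a)"
  proof (rule finite_measure_finite_Union[symmetric])
    show "disjoint_family_on (\<lambda>a. A \<inter> levF a) {..<p}"
      using disjoint_levF[OF order_refl] unfolding disjoint_family_on_def by blast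
  qed (use A in auto)
  also have "\<dots> \<le> prob A" using A by (intro finite_measure_mono) auto
  finally show ?thesis .
qed

lemma off_mass_mono:
  assumes "A \<in> sets M" "A' \<in> sets M" "A \<subseteq> A'" shows "off_mass K A \<le> off_mass K A'"
  unfolding off_mass_def using assms by (intro sum_mono) (auto intro!: \<beta>_mono)

lemma off_mass_perturb:
  assumes "A \<in> sets M" "A' \<in> sets M" shows "off_mass K A \<le> off_mass K A' + prob (A - A')"
proof -
  have "off_mass K A = off_mass K (A \<inter> A') + off_mass K (A - A')"
    using off_mass_Un[of "A \<inter> A'" "A - A'" K] assms by (simp add: Int_Diff_Un Int_Diff_disjoint)
  also have "\<dots> \<le> off_mass K A' + prob (A - A')"
    using assms by (intro add_mono off_mass_mono off_mass_le_prob) auto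
  finally show ?thesis .
qed

lemma off_mass_sum:
  assumes "finite I" "\<And>i. i \<in> I \<Longrightarrow> A i \<in> sets M" "disjoint_family_on A I"
  shows "off_mass K (\<Union>i\<in>I. A i) = (\<Sum>i\<in>I. off_mass K (A i))"
  by (rule additive_sum[where M = M and f = "off_mass K"]) (use assms off_mass_Un in auto)

text \<open>The set of cells off \<open>K\<close> is a union of diagonals, so shifting it by one cell changes it only on two border
lines. Its mass over \<open>A\<close> is therefore almost invariant under \<open>S\<close>.\<close>

lemma off_mass_image:
  assumes A: "A \<in> sets M"
  shows "off_mass K (S ` A) \<le> off_mass K A + (\<phi> + \<eta>)" "off_mass K A \<le> off_mass K (S ` A) + (\<phi> + \<eta>)"
proof -
  define r where "r A a b = \<beta> (A \<inter> levF a) (levE b)" for A a b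
  have SA: "S ` A \<in> sets M" by (rule aut_image(1)[OF aut_S A])
  have r0: "0 \<le> r A a b" and rw: "r A a b \<le> w a b" if "A \<in> sets M" for A a b
    using that by (auto simp: r_def w_def intro!: \<beta>_nonneg \<beta>_mono)
  have rS: "r (S ` A) (Suc a) (Suc b) = r A a b" for a b
  proof -
    have "S ` (A \<inter> levF a) = S ` A \<inter> S ` levF a"
      using aut_funpow_Int[OF aut_S A levF_sets, of 1] by simp
    then have "S ` (A \<inter> levF a) = S ` A \<inter> levF (Suc a)" by (simp add: image_comp)
    then show ?thesis
      using \<beta>_invariant[OF sets.Int[OF A levF_sets[of a]] levE_sets[of b]] by (simp add: r_def image_comp)
  qed
  let ?s = "\<lambda>(a,b). (Suc a, Suc b)"
  have inj: "inj_on ?s (core K 2)" by (auto simp: inj_on_def)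
  have shift: "(\<Sum>(a,b)\<in>?s ` core K 2. r (S ` A) a b) = (\<Sum>(a,b)\<in>core K 2. r A a b)"
    using inj by (subst sum.reindex) (auto simp: case_prod_beta rS)
  have strip: "(\<Sum>(a,b)\<in>core K 0. r A' a b) \<le> (\<Sum>(a,b)\<in>Z. r A' a b) + (\<phi> + \<eta>)"
    if A': "A' \<in> sets M" and Z: "finite Z" "core K 0 \<subseteq> Z \<union> (X \<times> {..<q} \<union> {..<p} \<times> Y)"
      and XY: "X \<subseteq> {..<p}" "Y \<subseteq> {..<q}" "card X \<le> 1" "card Y \<le> 1" for A' Z X Y
  proof -
    let ?S = "X \<times> {..<q} \<union> {..<p} \<times> Y"
    have fin: "finite X" "finite Y" using XY by (auto intro: finite_subset)
    have "(\<Sum>(a,b)\<in>core K 0. r A' a b) \<le> (\<Sum>(a,b)\<in>Z \<union> ?S. r A' a b)"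
      using Z fin r0[OF A'] by (intro sum_mono2) auto
    also have "\<dots> \<le> (\<Sum>(a,b)\<in>Z. r A' a b) + (\<Sum>(a,b)\<in>?S. r A' a b)"
      using Z fin r0[OF A'] by (subst sum.union_inter[symmetric]) (auto intro!: sum_nonneg)
    also have "(\<Sum>(a,b)\<in>?S. r A' a b) \<le> (\<Sum>(a,b)\<in>?S. w a b)"
      using rw[OF A'] by (intro sum_mono) auto
    also have "\<dots> \<le> real (card X) * \<phi> + real (card Y) * \<eta>" by (rule sum_w_strip_le[OF XY(1,2)])
    also have "\<dots> \<le> 1 * \<phi> + 1 * \<eta>" using XY by (intro add_mono mult_right_mono) auto
    finally show ?thesis by simp
  qed
  have "(\<Sum>(a,b)\<in>core K 0. r (S ` A) a b) \<le> (\<Sum>(a,b)\<in>?s ` core K 2. r (S ` A) a b) + (\<phi> + \<eta>)"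
  proof (rule strip[OF SA])
    show "core K 0 \<subseteq> ?s ` core K 2 \<union> (({0} \<inter> {..<p}) \<times> {..<q} \<union> {..<p} \<times> ({0} \<inter> {..<q}))"
    proof (rule subrelI)
      fix a b assume ab: "(a, b) \<in> core K 0"
      show "(a, b) \<in> ?s ` core K 2 \<union> (({0} \<inter> {..<p}) \<times> {..<q} \<union> {..<p} \<times> ({0} \<inter> {..<q}))"
      proof (cases "a = 0 \<or> b = 0")
        case False
        then have "(a - 1, b - 1) \<in> core K 2" using ab by (auto simp: core_def row_def of_nat_diff)
        then show ?thesis using False by (intro UnI1 image_eqI[of _ _ "(a - 1, b - 1)"]) auto
      qed (use ab in \<open>auto simp: core0\<close>)
    qed
  qed (auto simp: card_insert_if intro: order_trans[OF card_mono[of "{0}"]])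
  also have "(\<Sum>(a,b)\<in>?s ` core K 2. r (S ` A) a b) \<le> (\<Sum>(a,b)\<in>core K 0. r A a b)"
    unfolding shift using r0[OF A] by (intro sum_mono2) (auto simp: core_def row_def)
  finally show "off_mass K (S ` A) \<le> off_mass K A + (\<phi> + \<eta>)" by (simp add: off_mass_def r_def)
  have "(\<Sum>(a,b)\<in>core K 0. r A a b) \<le> (\<Sum>(a,b)\<in>core K 2. r A a b) + (\<phi> + \<eta>)"
  proof (rule strip[OF A])
    show "core K 0 \<subseteq> core K 2 \<union> (({p - 1} \<inter> {..<p}) \<times> {..<q} \<union> {..<p} \<times> ({q - 1} \<inter> {..<q}))"
      by (auto simp: core_def row_def)
  qed (auto intro: order_trans[OF card_mono[of "{p - 1}"]] order_trans[OF card_mono[of "{q - 1}"]])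
  also have "(\<Sum>(a,b)\<in>core K 2. r A a b) \<le> (\<Sum>(a,b)\<in>core K 0. r (S ` A) a b)"
    unfolding shift[symmetric] using r0[OF SA] by (intro sum_mono2) (auto simp: core_def row_def)
  finally show "off_mass K A \<le> off_mass K (S ` A) + (\<phi> + \<eta>)" by (simp add: off_mass_def r_def)
qed

lemma off_mass_funpow:
  assumes A: "A \<in> sets M"
  shows "\<bar>off_mass K ((S ^^ u) ` A) - off_mass K A\<bar> \<le> real u * (\<phi> + \<eta>)"
proof (induction u)
  case (Suc u)
  have eq: "(S ^^ Suc u) ` A = S ` ((S ^^ u) ` A)" by (simp add: image_comp)
  show ?case
    using Suc off_mass_image[OF aut_funpow_image(1)[OF aut_S A, of u], of K]
    unfolding eq abs_le_iff by (simp add: algebra_simps)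
qed simp

text \<open>An \<open>S\<close>-invariant measure below \<open>\<mu>\<close> gives equal mass to all levels of any tower of \<open>S\<close>, so on unions of
levels it is proportional to \<open>\<mu>\<close>. Here the same reasoning is applied to an almost invariant one, tested on
the levels of another tower over \<open>F0\<close>; this is how rank one of \<open>S\<close> enters.\<close>

lemma off_mass_almost_proportional:
  assumes tw0: "tower M S F0 p0" and I: "I \<subseteq> {..<p0}" and p0: "p0 > 0"
  shows "prob (union_levels S F0 I) * (off_mass K (space M) - (1 - real p0 * prob F0)) - 2 * (real p0)\<^sup>2 * (\<phi> + \<eta>)
    \<le> off_mass K (union_levels S F0 I)"
proof -
  define \<kappa> where "\<kappa> = \<phi> + \<eta>"
  have \<kappa>: "\<kappa> \<ge> 0" by (simp add: \<kappa>_def)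
  define \<Lambda> where "\<Lambda> = off_mass K F0"
  define D where "D = off_mass K (space M) - (1 - real p0 * prob F0)"
  have F0: "F0 \<in> sets M" using tw0 by (simp add: tower_def)
  have lev: "(S ^^ u) ` F0 \<in> sets M" for u by (rule aut_funpow_image(1)[OF aut_S F0])
  have dF: "disjoint_family_on (\<lambda>u. (S ^^ u) ` F0) J" if "J \<subseteq> {..<p0}" for J
    using tw0 disjoint_family_on_mono[OF that] unfolding tower_def by blast
  have lU: "off_mass K (union_levels S F0 J) = (\<Sum>u\<in>J. off_mass K ((S ^^ u) ` F0))" if "J \<subseteq> {..<p0}" for J
    unfolding union_levels_def using finite_subset[OF that] lev dF[OF that] by (intro off_mass_sum) auto
  have near: "\<bar>off_mass K ((S ^^ u) ` F0) - \<Lambda>\<bar> \<le> real p0 * \<kappa>" if "u < p0" for u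
  proof -
    have "\<bar>off_mass K ((S ^^ u) ` F0) - \<Lambda>\<bar> \<le> real u * \<kappa>" using off_mass_funpow[OF F0] by (simp add: \<Lambda>_def \<kappa>_def)
    also have "\<dots> \<le> real p0 * \<kappa>" using that \<kappa> by (intro mult_right_mono) auto
    finally show ?thesis .
  qed
  have U: "union_levels S F0 {..<p0} \<in> sets M" by (rule sets_union_levels[OF aut_S F0]) simp
  have "off_mass K (space M) \<le> off_mass K (union_levels S F0 {..<p0}) + prob (space M - union_levels S F0 {..<p0})"
    using U by (intro off_mass_perturb) auto
  also have "prob (space M - union_levels S F0 {..<p0}) = 1 - real p0 * prob F0"
    using prob_compl[OF U] measure_union_levels[OF prob_space_axioms aut_S tw0 order_refl] by simp
  also have "off_mass K (union_levels S F0 {..<p0}) \<le> (\<Sum>u<p0. \<Lambda> + real p0 * \<kappa>)"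
    unfolding lU[OF order_refl] using near by (intro sum_mono) (force simp: abs_le_iff)
  finally have D1: "D \<le> real p0 * (\<Lambda> + real p0 * \<kappa>)" by (simp add: D_def)
  have cI: "real (card I) \<le> real p0" using card_mono[OF _ I] by simp
  have "real (card I) * (\<Lambda> - real p0 * \<kappa>) \<le> (\<Sum>u\<in>I. off_mass K ((S ^^ u) ` F0))"
    using near I by (intro sum_bounded_below) (force simp: abs_le_iff)
  then have l1: "real (card I) * (\<Lambda> - real p0 * \<kappa>) \<le> off_mass K (union_levels S F0 I)"
    by (simp add: lU[OF I])
  have pI: "prob (union_levels S F0 I) = real (card I) * prob F0"
    by (rule measure_union_levels[OF prob_space_axioms aut_S tw0 I])
  have hF: "real p0 * prob F0 \<le> 1" by (rule tower_height_le[OF prob_space_axioms aut_S tw0])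
  have UI: "union_levels S F0 I \<in> sets M" using finite_subset[OF I] by (intro sets_union_levels[OF aut_S F0]) auto
  show ?thesis
  proof (cases "D \<ge> 0")
    case True
    have "prob F0 * D \<le> (1 / real p0) * D"
      using hF p0 True by (intro mult_right_mono) (auto simp: field_simps)
    also have "\<dots> \<le> \<Lambda> + real p0 * \<kappa>" using D1 p0 by (simp add: field_simps)
    finally have "real (card I) * (prob F0 * D) \<le> real (card I) * (\<Lambda> + real p0 * \<kappa>)"
      by (intro mult_left_mono) auto
    also have "\<dots> = real (card I) * (\<Lambda> - real p0 * \<kappa>) + 2 * (real (card I) * (real p0 * \<kappa>))"
      by (simp add: algebra_simps)
    also have "\<dots> \<le> off_mass K (union_levels S F0 I) + 2 * (real p0 * (real p0 * \<kappa>))"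
      using l1 cI \<kappa> by (intro add_mono mult_left_mono mult_right_mono) auto
    finally show ?thesis
      by (simp add: pI D_def[symmetric] \<kappa>_def[symmetric] power2_eq_square mult.assoc)
  next
    case False
    have "prob (union_levels S F0 I) * D \<le> 0" using False by (intro mult_nonneg_nonpos) auto
    moreover have "0 \<le> 2 * (real p0)\<^sup>2 * \<kappa>" using \<kappa> by simp
    ultimately show ?thesis using off_mass_nonneg[OF UI, of K]
      unfolding D_def[symmetric] \<kappa>_def[symmetric] by linarith
  qed
qed

end

section \<open>Spreading yields a product component\<close>

text \<open>Up to the concentration on few diagonals the two systems differ only in the role of mixing, and comparable
heights suffice. Which of the towers is taller becomes important after that.\<close>

locale tower_sequences = bijoining M S T \<beta> for M :: "'a measure" and S T :: "'a \<Rightarrow> 'a" and \<beta> +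
  fixes F :: "nat \<Rightarrow> 'a set" and p :: "nat \<Rightarrow> nat" and E :: "nat \<Rightarrow> 'a set" and q :: "nat \<Rightarrow> nat" and C :: real
  assumes lebesgue: "lebesgue_probability_space M"
    and exhS: "exhausting M S F p" and exhT: "exhausting M T E q" and mix: "mixing M T"
    and C: "C > 0"
    and pC: "\<forall>\<^sub>F j in sequentially. real (p j) \<le> C * real (q j)"
    and qC: "\<forall>\<^sub>F j in sequentially. real (q j) \<le> C * real (p j)"
begin

sublocale st: tower_pair M S T \<beta> "F j" "p j" "E j" "q j" for j
  by unfold_locales (use exhS exhT in \<open>auto simp: exhausting_def\<close>)

abbreviation "majS j \<equiv> majority M S (F j) (p j)"
abbreviation "majT j \<equiv> majority M T (E j) (q j)"

definition "approxS j A = union_levels S (F j) (majS j A)"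
definition "approxT j A = union_levels T (E j) (majT j A)"

lemma approxS_sets [simp]: "approxS j A \<in> sets M" and approxT_sets [simp]: "approxT j A \<in> sets M"
  by (simp_all add: approxS_def approxT_def majority_subset)

lemma approxS_lim: "A \<in> sets M \<Longrightarrow> (\<lambda>j. prob (sym_diff A (approxS j A))) \<longlonglongrightarrow> 0"
  using exhS by (simp add: exhausting_def approxS_def)
lemma approxT_lim: "A \<in> sets M \<Longrightarrow> (\<lambda>j. prob (sym_diff A (approxT j A))) \<longlonglongrightarrow> 0"
  using exhT by (simp add: exhausting_def approxT_def)

lemma \<phi>_lim: "(\<lambda>j. prob (F j)) \<longlonglongrightarrow> 0" and \<eta>_lim: "(\<lambda>j. prob (E j)) \<longlonglongrightarrow> 0"
  and p\<phi>_lim: "(\<lambda>j. real (p j) * prob (F j)) \<longlonglongrightarrow> 1" and q\<eta>_lim: "(\<lambda>j. real (q j) * prob (E j)) \<longlonglongrightarrow> 1"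
  using exhS exhT by (simp_all add: exhausting_def)

lemma p\<phi>_pos: "\<forall>\<^sub>F j in sequentially. 0 < real (p j) * prob (F j)" by (rule order_tendstoD(1)[OF p\<phi>_lim]) simp
lemma q\<eta>_pos: "\<forall>\<^sub>F j in sequentially. 0 < real (q j) * prob (E j)" by (rule order_tendstoD(1)[OF q\<eta>_lim]) simp

lemma Diff_le_sym_diff:
  assumes "A \<in> sets M" "B \<in> sets M"
  shows "prob (A - B) \<le> prob (sym_diff A B)" "prob (B - A) \<le> prob (sym_diff A B)"
  using assms by (auto intro!: finite_measure_mono)

lemma mixing_bound:
  assumes "A \<in> sets M" "B \<in> sets M" "\<epsilon> > 0"
  shows "\<exists>N. \<forall>m\<ge>N. \<bar>prob (A \<inter> (T ^^ m) ` B) - prob A * prob B\<bar> < \<epsilon>"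
proof -
  have "(\<lambda>m. prob (A \<inter> (T ^^ m) ` B)) \<longlonglongrightarrow> prob A * prob B"
    using mix assms by (simp add: mixing_def)
  then show ?thesis using assms(3) by (auto simp: LIMSEQ_iff)
qed

lemma level_ratio_bound:
  assumes "real (q j) \<le> C * real (p j)"
  shows "real (q j) * (prob (F j) + prob (E j)) \<le> C + 1"
proof -
  have "real (q j) * prob (F j) \<le> C * (real (p j) * prob (F j))"
    using mult_right_mono[OF assms, of "prob (F j)"] by simp
  also have "\<dots> \<le> C * 1" using C st.p_\<phi>_le[of j] by (intro mult_left_mono) auto
  finally show ?thesis using st.q_\<eta>_le[of j] by (simp add: distrib_left)
qed

text \<open>The exclusion of partial rigidity. If the levels of a late tower met their images under a large power of
\<open>T\<close> substantially, so would the sets of any fixed cover by \<open>r\<close> small sets, since these are nearly unions of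
levels; but by mixing those overlaps add up to about \<open>1 / r\<close>.\<close>

lemma self_overlap_small:
  assumes "\<zeta> > 0"
  shows "\<exists>N. \<forall>\<^sub>F j in sequentially. \<forall>m\<ge>N. (\<Sum>b<q j. prob ((T ^^ m) ` (T ^^ b) ` E j \<inter> (T ^^ b) ` E j)) < \<zeta>"
proof -
  obtain r :: nat where r: "1 / real r < \<zeta> / 4" "r > 0"
    using real_arch_inverse[of "\<zeta>/4"] \<open>\<zeta> > 0\<close> by (auto simp: inverse_eq_divide)
  obtain P :: "nat \<Rightarrow> 'a set" where P: "\<And>s. P s \<in> sets M" "\<And>s. prob (P s) \<le> 1 / real r"
    "(\<Union>s<r. P s) = space M"
    using nonatomic_small_cover[OF lebesgue r(2)] by metis
  define d where "d = \<zeta> / (16 * real r)"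
  have d: "d > 0" "real r * d = \<zeta> / 16" using \<open>\<zeta> > 0\<close> r(2) by (auto simp: d_def)
  have "\<forall>s. \<exists>N. \<forall>m\<ge>N. \<bar>prob (P s \<inter> (T ^^ m) ` P s) - prob (P s) * prob (P s)\<bar> < d"
    using mixing_bound[OF P(1) P(1) d(1)] by blast
  then obtain Ns where Ns: "\<And>s m. m \<ge> Ns s \<Longrightarrow> \<bar>prob (P s \<inter> (T ^^ m) ` P s) - prob (P s) * prob (P s)\<bar> < d"
    by metis
  define N where "N = Max (Ns ` {..<r})"
  have N: "Ns s \<le> N" if "s < r" for s using that by (simp add: N_def)
  have "\<forall>\<^sub>F j in sequentially. \<forall>s\<in>{..<r}. prob (sym_diff (P s) (approxT j (P s))) < d"
    using order_tendstoD(2)[OF approxT_lim[OF P(1)] d(1)] by (intro eventually_ball_finite) auto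
  then have "\<forall>\<^sub>F j in sequentially. \<forall>m\<ge>N. (\<Sum>b<q j. prob ((T ^^ m) ` (T ^^ b) ` E j \<inter> (T ^^ b) ` E j)) < \<zeta>"
  proof eventually_elim
    case (elim j)
    show ?case
    proof (intro allI impI)
      fix m assume m: "m \<ge> N"
      define B where "B b = (T ^^ b) ` E j" for b
      define Is where "Is s = majT j (P s)" for s
      define O' where "O' b = (T ^^ m) ` B b \<inter> B b" for b
      have B: "B b \<in> sets M" for b by (simp add: B_def)
      have TmB: "(T ^^ m) ` B b \<in> sets M" for b by (rule aut_funpow_image(1)[OF aut_T B])
      have O': "O' b \<in> sets M" for b using B TmB by (auto simp: O'_def)
      have Is: "Is s \<subseteq> {..<q j}" "finite (Is s)" for s by (auto simp: Is_def majority_def)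
      have approxT: "approxT j (P s) = (\<Union>b\<in>Is s. B b)" for s by (simp add: approxT_def Is_def union_levels_def B_def)
      have dB: "disjoint_family_on B J" if "J \<subseteq> {..<q j}" for J
        using st.disjoint_levE[OF that] by (simp add: B_def[abs_def])
      have piece: "(\<Sum>b\<in>Is s. prob (O' b)) \<le> 1 / real r * (1 / real r) + 3 * d" if s: "s < r" for s
      proof -
        have "(\<Sum>b\<in>Is s. prob (O' b)) = prob (\<Union>b\<in>Is s. O' b)"
        proof (rule finite_measure_finite_Union[symmetric])
          show "disjoint_family_on O' (Is s)"
            using dB[OF Is(1)[of s]] unfolding disjoint_family_on_def O'_def by blast
        qed (use Is O' in auto)
        also have "\<dots> \<le> prob (approxT j (P s) \<inter> (T ^^ m) ` approxT j (P s))"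
        proof (rule finite_measure_mono)
          show "(\<Union>b\<in>Is s. O' b) \<subseteq> approxT j (P s) \<inter> (T ^^ m) ` approxT j (P s)"
            by (auto simp: approxT O'_def)
        qed (intro sets.Int approxT_sets aut_funpow_image(1)[OF aut_T approxT_sets])
        also have "\<dots> \<le> prob (P s \<inter> (T ^^ m) ` P s) + prob (approxT j (P s) - P s)
            + prob (approxT j (P s) - P s)"
          unfolding Int_commute[of _ "(T ^^ m) ` _"] by (rule overlap_perturb[OF aut_T]) (use P in auto)
        also have "prob (P s \<inter> (T ^^ m) ` P s) \<le> prob (P s) * prob (P s) + d"
          using Ns[of s m] N[OF s] m by (simp add: abs_less_iff)
        also have "prob (P s) * prob (P s) \<le> 1 / real r * (1 / real r)"
          using P(2) by (intro mult_mono) auto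
        also have "prob (approxT j (P s) - P s) \<le> d"
          using Diff_le_sym_diff(2)[OF P(1)[of s] approxT_sets[of j "P s"]] bspec[OF elim, of s] s by simp
        finally show ?thesis by simp
      qed
      \<comment> \<open>levels in no majority set lie outside all approximants, hence in the errors of the cover\<close>
      define Rest where "Rest = {..<q j} - (\<Union>s<r. Is s)"
      have rest: "(\<Sum>b\<in>Rest. prob (O' b)) \<le> real r * d"
      proof -
        have "(\<Sum>b\<in>Rest. prob (O' b)) \<le> (\<Sum>b\<in>Rest. prob (B b))"
          using B by (intro sum_mono finite_measure_mono) (auto simp: O'_def)
        also have "\<dots> = prob (\<Union>b\<in>Rest. B b)"
          using B dB[of Rest] by (intro finite_measure_finite_Union[symmetric]) (auto simp: Rest_def)
        also have "\<dots> \<le> prob (\<Union>s<r. P s - approxT j (P s))"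
        proof (rule finite_measure_mono)
          show "(\<Union>b\<in>Rest. B b) \<subseteq> (\<Union>s<r. P s - approxT j (P s))"
          proof
            fix x assume "x \<in> (\<Union>b\<in>Rest. B b)"
            then obtain b where b: "b \<in> Rest" "x \<in> B b" by auto
            have "x \<in> space M" using b(2) B sets.sets_into_space by auto
            then obtain s where s: "s < r" "x \<in> P s" using P(3) by auto
            have "x \<notin> B b'" if b': "b' \<in> Is s" for b'
            proof -
              have "b \<noteq> b'" "b < q j" "b' < q j" using b(1) b' s(1) Is(1)[of s] by (auto simp: Rest_def)
              then have "B b \<inter> B b' = {}" using dB[OF order_refl] by (simp add: disjoint_family_on_def)
              then show ?thesis using b(2) by auto
            qed
            then show "x \<in> (\<Union>s<r. P s - approxT j (P s))" using s by (auto simp: approxT)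
          qed
        qed (intro sets.finite_UN sets.Diff P(1) approxT_sets finite_lessThan)
        also have "\<dots> \<le> (\<Sum>s<r. prob (P s - approxT j (P s)))"
          using P by (intro finite_measure_subadditive_finite) auto
        also have "\<dots> \<le> (\<Sum>s<r. d)"
        proof (rule sum_mono)
          fix s assume "s \<in> {..<r}"
          then show "prob (P s - approxT j (P s)) \<le> d"
            using Diff_le_sym_diff(1)[OF P(1)[of s] approxT_sets[of j "P s"]] bspec[OF elim, of s] by simp
        qed
        finally show ?thesis by simp
      qed
      have "(\<Sum>b<q j. prob (O' b)) \<le> (\<Sum>b\<in>(\<Union>s<r. Is s) \<union> Rest. prob (O' b))"
        using Is by (intro sum_mono2) (auto simp: Rest_def)
      also have "\<dots> \<le> (\<Sum>b\<in>(\<Union>s<r. Is s). prob (O' b)) + (\<Sum>b\<in>Rest. prob (O' b))"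
        using Is by (subst sum.union_inter[symmetric]) (auto simp: Rest_def intro!: sum_nonneg)
      also have "(\<Sum>b\<in>(\<Union>s<r. Is s). prob (O' b)) \<le> (\<Sum>s<r. \<Sum>b\<in>Is s. prob (O' b))"
        using Is by (intro sum_UN_le) auto
      also have "\<dots> \<le> (\<Sum>s<r. 1 / real r * (1 / real r) + 3 * d)"
        by (intro sum_mono piece) auto
      also have "\<dots> = 1 / real r + 3 * (real r * d)" using r(2) by (simp add: field_simps)
      finally have "(\<Sum>b<q j. prob (O' b)) \<le> 1 / real r + 4 * (real r * d)" using rest by simp
      also have "\<dots> < \<zeta>" using r(1) d(2) \<open>\<zeta> > 0\<close> by simp
      finally show "(\<Sum>b<q j. prob ((T ^^ m) ` (T ^^ b) ` E j \<inter> (T ^^ b) ` E j)) < \<zeta>"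
        by (simp add: O'_def B_def)
    qed
  qed
  then show ?thesis by blast
qed

text \<open>If a proportion \<open>\<rho>\<close> of the joining keeps spreading over light diagonals, however lightness is measured, then
the joining dominates \<open>\<rho>\<close> times the product measure. The constants are chosen in the order in which they
depend on each other: a stage \<open>i\<close> on which \<open>A\<close> is nearly a union of levels, the relative length \<open>\<delta>\<close> of the
segments, the tolerances \<open>\<epsilon>1\<close> and \<open>\<theta>\<close>, the time \<open>N\<close> after which \<open>B\<close> is mixed, and last a late
stage \<open>j\<close> at which the mass \<open>\<rho>\<close> is present.\<close>

lemma spread_component:
  assumes \<rho>: "0 \<le> \<rho>" "\<rho> \<le> 1"
    and spread: "\<And>\<theta> N. \<theta> > 0 \<Longrightarrow> \<exists>\<^sub>F j in sequentially. \<rho> \<le> st.off_mass j (st.heavy j \<theta> N) (space M)"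
    and A: "A \<in> sets M" and B: "B \<in> sets M"
  shows "\<rho> * prob A * prob B \<le> \<beta> A B"
proof (rule field_le_epsilon)
  fix e :: real assume "e > 0"
  define \<epsilon> where "\<epsilon> = e / 9"
  have \<epsilon>: "\<epsilon> > 0" using \<open>e > 0\<close> by (simp add: \<epsilon>_def)
  define v where "v = prob B"
  have v: "0 \<le> v" "v \<le> 1" by (auto simp: v_def)
  have "\<forall>\<^sub>F i in sequentially. prob (sym_diff A (approxS i A)) < \<epsilon> \<and> 1 - \<epsilon> < real (p i) * prob (F i) \<and> 0 < real (p i) * prob (F i)"
    using order_tendstoD(2)[OF approxS_lim[OF A] \<epsilon>] order_tendstoD(1)[OF p\<phi>_lim, of "1 - \<epsilon>"]
      order_tendstoD(1)[OF p\<phi>_lim, of 0] \<epsilon>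
    by (simp add: eventually_conj)
  then obtain i where i: "prob (sym_diff A (approxS i A)) < \<epsilon>" "1 - \<epsilon> < real (p i) * prob (F i)" "0 < p i"
    by (auto simp: eventually_sequentially zero_less_mult_iff)
  define \<delta> where "\<delta> = \<epsilon> / (1 + C)"
  have \<delta>: "\<delta> > 0" "\<delta> * (1 + C) = \<epsilon>" using \<epsilon> C by (auto simp: \<delta>_def)
  \<comment> \<open>\<open>\<theta>\<close> and \<open>\<epsilon>1\<close> make the error \<open>(\<theta> * C + \<epsilon>1) / (\<epsilon> * (L * prob (E j)))\<close> of \<open>spread_bound\<close>, taken with
    \<open>\<sigma> = \<epsilon>\<close>, at most \<open>\<epsilon>\<close>, because \<open>L * prob (E j)\<close> exceeds \<open>\<delta> / 2\<close>\<close>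
  define \<epsilon>1 where "\<epsilon>1 = \<epsilon>\<^sup>2 * \<delta> / 4"
  define \<theta> where "\<theta> = \<epsilon>1 / C"
  have \<epsilon>1: "\<epsilon>1 > 0" and \<theta>: "\<theta> > 0" "\<theta> * C = \<epsilon>1" using \<epsilon> \<delta> C by (auto simp: \<epsilon>1_def \<theta>_def)
  obtain N where N: "\<And>m. m \<ge> N \<Longrightarrow> \<bar>prob (B \<inter> (T ^^ m) ` B) - prob B * prob B\<bar> < \<epsilon>1 / 2"
    using mixing_bound[OF B B, of "\<epsilon>1 / 2"] \<epsilon>1 by auto
  have ev1: "\<forall>\<^sub>F j in sequentially. prob (sym_diff A (approxS j A)) < \<epsilon>" by (rule order_tendstoD(2)[OF approxS_lim[OF A] \<epsilon>])
  have ev2: "\<forall>\<^sub>F j in sequentially. prob (sym_diff B (approxT j B)) < min \<epsilon> (\<epsilon>1 / 8)"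
    using \<epsilon> \<epsilon>1 by (intro order_tendstoD(2)[OF approxT_lim[OF B]]) auto
  have "(\<lambda>j. 2 * (real (p i))\<^sup>2 * (prob (F j) + prob (E j))) \<longlonglongrightarrow> 2 * (real (p i))\<^sup>2 * (0 + 0)"
    by (intro tendsto_intros \<phi>_lim \<eta>_lim)
  then have ev3: "\<forall>\<^sub>F j in sequentially. 2 * (real (p i))\<^sup>2 * (prob (F j) + prob (E j)) < \<epsilon>"
    using order_tendstoD(2) \<epsilon> by fastforce
  have "(\<lambda>j. \<delta> * (real (q j) * prob (E j)) - prob (E j)) \<longlonglongrightarrow> \<delta> * 1 - 0"
    by (intro tendsto_intros q\<eta>_lim \<eta>_lim)
  then have ev4: "\<forall>\<^sub>F j in sequentially. \<delta> / 2 < \<delta> * (real (q j) * prob (E j)) - prob (E j)"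
    using order_tendstoD(1)[of _ _ _ "\<delta> / 2"] \<delta> by fastforce
  have "\<exists>\<^sub>F j in sequentially. \<rho> \<le> st.off_mass j (st.heavy j \<theta> N) (space M) \<and>
     prob (sym_diff A (approxS j A)) < \<epsilon> \<and> prob (sym_diff B (approxT j B)) < min \<epsilon> (\<epsilon>1 / 8) \<and>
     2 * (real (p i))\<^sup>2 * (prob (F j) + prob (E j)) < \<epsilon> \<and>
     \<delta> / 2 < \<delta> * (real (q j) * prob (E j)) - prob (E j) \<and>
     0 < real (p j) * prob (F j) \<and> 0 < real (q j) * prob (E j) \<and> real (p j) \<le> C * real (q j) \<and>
     real (q j) \<le> C * real (p j)"
    using ev1 ev2 ev3 ev4 p\<phi>_pos q\<eta>_pos pC qC
    by (intro frequently_eventually_frequently[OF spread[OF \<theta>(1), of N]] eventually_conj)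
  then obtain j where j: "\<rho> \<le> st.off_mass j (st.heavy j \<theta> N) (space M)"
     "prob (sym_diff A (approxS j A)) < \<epsilon>" "prob (sym_diff B (approxT j B)) < min \<epsilon> (\<epsilon>1 / 8)"
     "2 * (real (p i))\<^sup>2 * (prob (F j) + prob (E j)) < \<epsilon>"
     "\<delta> / 2 < \<delta> * (real (q j) * prob (E j)) - prob (E j)"
     "0 < real (p j) * prob (F j)" "0 < real (q j) * prob (E j)" "real (p j) \<le> C * real (q j)"
     "real (q j) \<le> C * real (p j)"
    by (auto dest!: frequently_ex)
  have pos: "0 < prob (F j)" "0 < prob (E j)" "0 < p j" "0 < q j"
    using j(6,7) by (auto simp: zero_less_mult_iff)
  define K where "K = st.heavy j \<theta> N"
  define L where "L = nat \<lfloor>\<delta> * real (q j)\<rfloor>"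
  have L1: "\<delta> * real (q j) - 1 < real L" "real L \<le> \<delta> * real (q j)"
    using \<delta>(1) by (auto simp: L_def)
  have "(\<delta> * real (q j) - 1) * prob (E j) \<le> real L * prob (E j)"
    using L1 by (intro mult_right_mono) auto
  then have L\<eta>: "\<delta> / 2 < real L * prob (E j)" using j(5) by (simp add: algebra_simps)
  have L: "L > 0" using L\<eta> \<delta>(1) by (cases L) auto
  have L2: "real L * (prob (F j) + prob (E j)) \<le> \<epsilon>"
  proof -
    have "real L * (prob (F j) + prob (E j)) \<le> \<delta> * real (q j) * (prob (F j) + prob (E j))"
      using L1 by (intro mult_right_mono) auto
    also have "\<dots> \<le> \<delta> * (C + 1)"
      unfolding mult.assoc using \<delta>(1) level_ratio_bound[OF j(9)] by (intro mult_left_mono) auto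
    finally show ?thesis using \<delta>(2) by (simp add: add.commute)
  qed
  define d where "d = prob (sym_diff B (approxT j B))"
  have d: "d < \<epsilon>1 / 8" "d < \<epsilon>" using j(3) by (auto simp: d_def)
  have dB: "prob (B - approxT j B) \<le> d" "prob (approxT j B - B) \<le> d"
    using Diff_le_sym_diff[OF B approxT_sets] by (auto simp: d_def)
  have corr: "prob ((T ^^ m) ` approxT j B \<inter> approxT j B) - 2 * v * prob (approxT j B) + v\<^sup>2 \<le> \<epsilon>1" if "m > N" for m
  proof -
    have "prob ((T ^^ m) ` approxT j B \<inter> approxT j B)
        \<le> prob ((T ^^ m) ` B \<inter> B) + prob (approxT j B - B) + prob (approxT j B - B)"
      by (rule overlap_perturb[OF aut_T]) (use B in auto)
    also have "prob ((T ^^ m) ` B \<inter> B) \<le> v * v + \<epsilon>1 / 2"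
      using N[of m] that unfolding v_def Int_commute[of "(T ^^ m) ` B" B] by linarith
    finally have 1: "prob ((T ^^ m) ` approxT j B \<inter> approxT j B) \<le> v * v + \<epsilon>1 / 2 + 2 * d"
      using dB by simp
    have "prob B \<le> prob (approxT j B) + prob (B - approxT j B)"
      using B by (intro prob_le_add_Diff) auto
    then have "v - d \<le> prob (approxT j B)" using dB by (simp add: v_def)
    then have "2 * v * (v - d) \<le> 2 * v * prob (approxT j B)" using v by (intro mult_left_mono) auto
    moreover have "2 * v * (v - d) = 2 * (v * v) - 2 * (v * d)" by (simp add: algebra_simps)
    moreover have "v * d \<le> 1 * d" using v by (intro mult_right_mono) (auto simp: d_def)
    ultimately show ?thesis using 1 d by (simp add: power2_eq_square)
  qed
  \<comment> \<open>the sets are replaced by unions of levels of stage \<open>j\<close>, where the finite estimate applies\<close>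
  have bound: "v * (st.off_mass j K (approxS j A) - real L * (prob (F j) + prob (E j)))
      - (\<epsilon> + (\<theta> * C + \<epsilon>1) / (\<epsilon> * (real L * prob (E j)))) / 2 \<le> \<beta> (approxS j A) (approxT j B)"
    unfolding approxS_def approxT_def
  proof (rule st.spread_bound)
    show "majS j A \<subseteq> {..<p j}" "majT j B \<subseteq> {..<q j}"
      by (rule majority_subset)+
    show "\<And>m. N < m \<Longrightarrow> prob ((T ^^ m) ` union_levels T (E j) (majT j B)
        \<inter> union_levels T (E j) (majT j B))
        - 2 * v * prob (union_levels T (E j) (majT j B)) + v\<^sup>2 \<le> \<epsilon>1"
      using corr by (simp add: approxT_def)
    show "\<And>k. k \<in> st.diags j \<Longrightarrow> k \<notin> K \<Longrightarrow> st.cluster j N k \<le> \<theta> / real (q j)"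
      by (auto simp: K_def st.heavy_def)
  qed (use v L pos \<epsilon> \<epsilon>1 \<theta> j in auto)
  have e1: "(\<theta> * C + \<epsilon>1) / (\<epsilon> * (real L * prob (E j))) \<le> \<epsilon>"
  proof -
    have "(\<theta> * C + \<epsilon>1) / (\<epsilon> * (real L * prob (E j))) \<le> (\<theta> * C + \<epsilon>1) / (\<epsilon> * (\<delta> / 2))"
      using L\<eta> L pos \<epsilon> \<delta> \<theta> \<epsilon>1 by (intro divide_left_mono mult_left_mono mult_pos_pos) auto
    also have "\<dots> = \<epsilon>" unfolding \<theta>(2) \<epsilon>1_def using \<epsilon> \<delta>(1) by (simp add: power2_eq_square field_simps)
    finally show ?thesis .
  qed
  \<comment> \<open>stage \<open>i\<close> supplies the proportionality of the light mass over \<open>A\<close> to \<open>prob A\<close>\<close>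
  have off_massA: "\<rho> * prob A - 5 * \<epsilon> \<le> st.off_mass j K (approxS j A)"
  proof -
    have "st.off_mass j K (approxS i A) \<le> st.off_mass j K A + prob (approxS i A - A)"
      using A by (intro st.off_mass_perturb) auto
    moreover have "st.off_mass j K A \<le> st.off_mass j K (approxS j A) + prob (A - approxS j A)"
      using A by (intro st.off_mass_perturb) auto
    moreover have "prob (approxS i A - A) \<le> \<epsilon>" "prob (A - approxS j A) \<le> \<epsilon>" "prob (A - approxS i A) \<le> \<epsilon>"
      using Diff_le_sym_diff[OF A approxS_sets[of i A]] Diff_le_sym_diff[OF A approxS_sets[of j A]] i(1) j(2) by auto
    moreover have "prob (approxS i A) * (st.off_mass j K (space M) - (1 - real (p i) * prob (F i)))
        - 2 * (real (p i))\<^sup>2 * (prob (F j) + prob (E j)) \<le> st.off_mass j K (approxS i A)"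
      unfolding approxS_def using i(3)
      by (intro st.off_mass_almost_proportional majority_subset) (rule st.tower_S)
    moreover have "prob (approxS i A) * \<rho> - \<epsilon> \<le> prob (approxS i A) * (st.off_mass j K (space M) - (1 - real (p i) * prob (F i)))"
    proof -
      have "prob (approxS i A) * (\<rho> - \<epsilon>) \<le> prob (approxS i A) * (st.off_mass j K (space M) - (1 - real (p i) * prob (F i)))"
        using j(1) i(2) by (intro mult_left_mono) (auto simp: K_def)
      moreover have "prob (approxS i A) * \<epsilon> \<le> 1 * \<epsilon>" using \<epsilon> by (intro mult_right_mono) auto
      ultimately show ?thesis by (simp add: algebra_simps)
    qed
    moreover have "prob A * \<rho> - \<epsilon> \<le> prob (approxS i A) * \<rho>"
    proof -
      have "prob A \<le> prob (approxS i A) + prob (A - approxS i A)"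
        using A by (intro prob_le_add_Diff) auto
      then have "prob A * \<rho> \<le> (prob (approxS i A) + prob (A - approxS i A)) * \<rho>"
        using \<rho> by (intro mult_right_mono) auto
      also have "\<dots> = prob (approxS i A) * \<rho> + prob (A - approxS i A) * \<rho>" by (simp add: algebra_simps)
      also have "prob (A - approxS i A) * \<rho> \<le> \<epsilon> * 1"
        using \<rho> \<epsilon> \<open>prob (A - approxS i A) \<le> \<epsilon>\<close> by (intro mult_mono) auto
      finally show ?thesis by simp
    qed
    ultimately show ?thesis using j(4) by (simp add: mult.commute)
  qed
  have "v * (\<rho> * prob A) - 6 * \<epsilon> \<le> v * (st.off_mass j K (approxS j A) - real L * (prob (F j) + prob (E j)))"
  proof -
    have "v * (\<rho> * prob A - 6 * \<epsilon>) \<le> v * (st.off_mass j K (approxS j A) - real L * (prob (F j) + prob (E j)))"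
      using v off_massA L2 by (intro mult_left_mono) auto
    moreover have "v * (6 * \<epsilon>) \<le> 1 * (6 * \<epsilon>)" using v \<epsilon> by (intro mult_right_mono) auto
    ultimately show ?thesis by (simp add: algebra_simps)
  qed
  moreover have "v * (st.off_mass j K (approxS j A) - real L * (prob (F j) + prob (E j))) \<le> \<beta> (approxS j A) (approxT j B) + \<epsilon>"
  proof -
    have "(\<epsilon> + (\<theta> * C + \<epsilon>1) / (\<epsilon> * (real L * prob (E j)))) / 2 \<le> (\<epsilon> + \<epsilon>) / 2"
      by (intro divide_right_mono add_left_mono e1) simp
    with bound have "v * (st.off_mass j K (approxS j A) - real L * (prob (F j) + prob (E j))) - (\<epsilon> + \<epsilon>) / 2
        \<le> \<beta> (approxS j A) (approxT j B)" by (rule order_trans[OF diff_left_mono, rotated])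
    then show ?thesis by simp
  qed
  moreover have "\<beta> (approxS j A) (approxT j B) \<le> \<beta> A B + prob (approxS j A - A) + prob (approxT j B - B)"
    using A B by (intro \<beta>_perturb) auto
  moreover have "prob (approxS j A - A) \<le> \<epsilon>"
    using Diff_le_sym_diff[OF A approxS_sets[of j A]] j(2) by auto
  moreover have "prob (approxT j B - B) \<le> \<epsilon>" using dB(2) d(2) by linarith
  ultimately have "v * (\<rho> * prob A) \<le> \<beta> A B + 9 * \<epsilon>" by argo
  then show "\<rho> * prob A * prob B \<le> \<beta> A B + e" by (simp add: v_def \<epsilon>_def mult_ac)
qed

end

section \<open>Concentration on few diagonals is impossible\<close>

context tower_pair begin

definition total :: real where "total = (\<Sum>a<p. \<Sum>b<q. w a b)"

lemma total_ge: "real p * \<phi> + real q * \<eta> - 1 \<le> total"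
proof -
  have S: "union_levels S F {..<p} \<in> sets M" "union_levels T E {..<q} \<in> sets M" by auto
  have "\<beta> (space M) (space M) \<le> \<beta> (union_levels S F {..<p}) (union_levels T E {..<q})
      + prob (space M - union_levels S F {..<p}) + prob (space M - union_levels T E {..<q})"
    using S by (intro \<beta>_perturb) auto
  moreover have "\<beta> (space M) (space M) = 1" by (simp add: marginal_left prob_space)
  ultimately show ?thesis
    using prob_compl[OF S(1)] prob_compl[OF S(2)]
      measure_union_levels[OF prob_space_axioms aut_S tower_S order_refl]
      measure_union_levels[OF prob_space_axioms aut_T tower_T order_refl]
    by (simp add: total_def sum_w_rect)
qed

lemma total_le: "total \<le> 1"
proof -
  have S: "union_levels S F {..<p} \<in> sets M" "union_levels T E {..<q} \<in> sets M" by auto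
  show ?thesis using order_trans[OF \<beta>_le_left[OF S] prob_le_1] by (simp add: total_def sum_w_rect)
qed

lemma off_mass_space: "off_mass K (space M) = (\<Sum>a<p. \<Sum>b\<in>row K 0 a. w a b)"
proof -
  have "space M \<inter> levF a = levF a" for a using levF_sets sets.sets_into_space by blast
  then show ?thesis unfolding off_mass_def by (subst sum_core) (simp add: w_def)
qed

definition heavy_levels :: "int set \<Rightarrow> nat \<Rightarrow> 'a set" where
  "heavy_levels K a = union_levels T E {b. b < q \<and> int b - int a \<in> K}"

lemma heavy_levels_sets [simp]: "heavy_levels K a \<in> sets M"
  unfolding heavy_levels_def by (rule sets_UE) auto

text \<open>Apart from the leftover of the tower of \<open>T\<close>, a point over \<open>levF a\<close> outside the heavy levels is in a cell off
\<open>K\<close>.\<close>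

lemma heavy_levels_complement:
  "(\<Sum>a<p. \<beta> (levF a) (space M - heavy_levels K a)) \<le> off_mass K (space M) + (1 - real q * \<eta>)"
proof -
  have one: "\<beta> (levF a) (space M - heavy_levels K a) = \<phi> - (\<Sum>b<q. w a b) + (\<Sum>b\<in>row K 0 a. w a b)" if "a < p" for a
  proof -
    have "\<beta> (levF a) (space M) = \<beta> (levF a) (space M \<inter> heavy_levels K a) + \<beta> (levF a) (space M - heavy_levels K a)"
      by (rule \<beta>_split_right) auto
    moreover have "space M \<inter> heavy_levels K a = heavy_levels K a"
      using heavy_levels_sets sets.sets_into_space by blast
    moreover have "\<beta> (levF a) (heavy_levels K a) = (\<Sum>b\<in>{b. b < q \<and> int b - int a \<in> K}. w a b)"
      unfolding heavy_levels_def by (rule sum_w_row[symmetric]) auto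
    moreover have "(\<Sum>b<q. w a b) = (\<Sum>b\<in>{b. b < q \<and> int b - int a \<in> K}. w a b) + (\<Sum>b\<in>row K 0 a. w a b)"
      using that by (subst sum.union_disjoint[symmetric]) (auto simp: row_def intro!: sum.cong)
    ultimately show ?thesis by (simp add: marginal_left)
  qed
  have "(\<Sum>a<p. \<beta> (levF a) (space M - heavy_levels K a)) = real p * \<phi> - total + off_mass K (space M)"
    by (simp add: one sum.distrib sum_subtractf total_def off_mass_space)
  then show ?thesis using total_ge by simp
qed

text \<open>A point in \<open>levF t\<close> is in \<open>levF (t + m)\<close> after \<open>m\<close> steps. At both times its partner is in a heavy level, up
to the mass off \<open>K\<close>: first in \<open>levE b\<close> with \<open>b = t + k\<close>, then in \<open>levE b'\<close> with \<open>b' = t + m + k'\<close>. Since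
\<open>T ^^ m\<close> maps \<open>levE b\<close> to \<open>T ^^ (m + b - b')\<close> applied to \<open>levE b'\<close>, the two conditions express a return of
\<open>levE b'\<close> to itself in the time \<open>m + b - b' = k - k'\<close>, which no longer depends on \<open>t\<close> and is at least \<open>m - q\<close>.\<close>

lemma heavy_overlap_bound:
  assumes K: "finite K" and mL: "m + L \<le> p" and qm: "q \<le> m" and \<zeta>: "0 \<le> \<zeta>"
    and small: "\<And>i. m - q \<le> i \<Longrightarrow> (\<Sum>b<q. prob ((T ^^ i) ` levE b \<inter> levE b)) \<le> \<zeta>"
  shows "real L * \<phi> \<le> 2 * (off_mass K (space M) + (1 - real q * \<eta>)) + (real (card K))\<^sup>2 * \<zeta>"
proof -
  define X where "X t = (T ^^ m) ` heavy_levels K t" for t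
  define Y where "Y t = heavy_levels K (t + m)" for t
  have XY: "X t \<in> sets M" "Y t \<in> sets M" for t
    by (auto simp: X_def Y_def intro: aut_funpow_image(1)[OF aut_T])
  define inside where "inside k k' t \<longleftrightarrow> 0 \<le> int t + k \<and> int t + k < int q \<and> 0 \<le> int t + int m + k' \<and> int t + int m + k' < int q" for k k' t
  define h where "h k k' t = (if inside k k' t
     then prob ((T ^^ nat (k - k')) ` levE (nat (int t + int m + k')) \<inter> levE (nat (int t + int m + k'))) else 0)" for k k' t
  let ?u = "\<lambda>a. \<beta> (levF a) (space M - heavy_levels K a)"
  have point: "\<phi> \<le> prob (X t \<inter> Y t) + ?u t + ?u (t + m)" for t
  proof -
    have "\<phi> = \<beta> (levF (t + m)) (space M)" by (simp add: marginal_left)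
    also have "\<dots> = \<beta> (levF (t + m)) (space M \<inter> X t) + \<beta> (levF (t + m)) (space M - X t)"
      using XY by (intro \<beta>_split_right) auto
    also have "space M \<inter> X t = X t" using XY sets.sets_into_space by blast
    also have "\<beta> (levF (t + m)) (X t) = \<beta> (levF (t + m)) (X t \<inter> Y t) + \<beta> (levF (t + m)) (X t - Y t)"
      using XY by (intro \<beta>_split_right) auto
    also have "\<beta> (levF (t + m)) (X t - Y t) \<le> \<beta> (levF (t + m)) (space M - Y t)"
      using XY sets.sets_into_space[OF XY(1)] by (intro \<beta>_mono) auto
    also have "\<beta> (levF (t + m)) (X t \<inter> Y t) \<le> prob (X t \<inter> Y t)"
      using XY by (intro \<beta>_le_right) auto
    also have "\<beta> (levF (t + m)) (space M - X t) = ?u t"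
    proof -
      have "(T ^^ m) ` (space M - heavy_levels K t) = space M - X t"
        unfolding X_def using aut_funpow_Diff[OF aut_T sets.top heavy_levels_sets, of m K t]
        by (simp add: aut_funpow(2)[OF aut_T])
      then show ?thesis
        using \<beta>_funpow[OF levF_sets[of t] sets.Diff[OF sets.top heavy_levels_sets[of K t]], of m]
        by (simp add: funpow_add_image[symmetric] add.commute)
    qed
    finally show ?thesis by (simp add: Y_def)
  qed
  have overlap: "prob (X t \<inter> Y t) \<le> (\<Sum>k\<in>K. \<Sum>k'\<in>K. h k k' t)" for t
  proof -
    define Z where "Z k k' = (if inside k k' t
       then (T ^^ nat (k - k')) ` levE (nat (int t + int m + k')) \<inter> levE (nat (int t + int m + k')) else {})" for k k'
    have Zs: "Z k k' \<in> sets M" for k k'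
      by (auto simp: Z_def intro: aut_funpow_image(1)[OF aut_T])
    have "X t \<inter> Y t \<subseteq> (\<Union>(k,k')\<in>K \<times> K. Z k k')"
    proof
      fix x assume x: "x \<in> X t \<inter> Y t"
      then obtain b b' where b: "b < q" "int b - int t \<in> K" "x \<in> (T ^^ m) ` levE b"
        and b': "b' < q" "int b' - int (t + m) \<in> K" "x \<in> levE b'"
        by (auto simp: X_def Y_def heavy_levels_def union_levels_def)
      define k k' where "k = int b - int t" and "k' = int b' - int (t + m)"
      have e: "nat (k - k') + b' = m + b" "nat (int t + int m + k') = b'"
        using b(1) b'(1) qm by (auto simp: k_def k'_def)
      have "(T ^^ m) ` levE b = (T ^^ nat (k - k')) ` levE b'"
        unfolding funpow_add_image[symmetric] e ..
      then have "x \<in> Z k k'"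
        using b b' e(2) by (auto simp: Z_def inside_def k_def k'_def)
      then show "x \<in> (\<Union>(k,k')\<in>K \<times> K. Z k k')"
        using b(2) b'(2) by (auto simp: k_def k'_def)
    qed
    then have "prob (X t \<inter> Y t) \<le> prob (\<Union>(k,k')\<in>K \<times> K. Z k k')"
      using Zs K by (intro finite_measure_mono) auto
    also have "\<dots> \<le> (\<Sum>(k,k')\<in>K \<times> K. prob (Z k k'))"
      using Zs K finite_measure_subadditive_finite[of "K \<times> K" "\<lambda>(k,k'). Z k k'"]
      by (auto simp: case_prod_beta)
    also have "\<dots> = (\<Sum>k\<in>K. \<Sum>k'\<in>K. h k k' t)"
      by (subst sum.cartesian_product[symmetric]) (auto simp: Z_def h_def intro!: sum.cong)
    finally show ?thesis .
  qed
  have hsum: "(\<Sum>t<L. h k k' t) \<le> \<zeta>" for k k'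
  proof -
    let ?R = "{t. t < L \<and> inside k k' t}"
    let ?g = "\<lambda>t. nat (int t + int m + k')"
    have fin: "finite ?R" by simp
    have "(\<Sum>t<L. h k k' t) = (\<Sum>t\<in>?R. prob ((T ^^ nat (k - k')) ` levE (?g t) \<inter> levE (?g t)))"
      unfolding h_def by (subst sum.inter_filter[symmetric]) (auto intro!: sum.cong)
    also have "\<dots> = (\<Sum>b\<in>?g ` ?R. prob ((T ^^ nat (k - k')) ` levE b \<inter> levE b))"
      by (subst sum.reindex) (auto simp: inj_on_def inside_def)
    also have "\<dots> \<le> \<zeta>"
    proof (cases "?R = {}")
      case False
      then obtain t where t: "t \<in> ?R" by blast
      have "(\<Sum>b\<in>?g ` ?R. prob ((T ^^ nat (k - k')) ` levE b \<inter> levE b))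
          \<le> (\<Sum>b<q. prob ((T ^^ nat (k - k')) ` levE b \<inter> levE b))"
        by (intro sum_mono2) (auto simp: inside_def)
      also have "\<dots> \<le> \<zeta>" using t qm by (intro small) (auto simp: inside_def)
      finally show ?thesis .
    qed (simp only: image_empty sum.empty \<zeta>)
    finally show ?thesis .
  qed
  have "real L * \<phi> = (\<Sum>t<L. \<phi>)" by simp
  also have "\<dots> \<le> (\<Sum>t<L. prob (X t \<inter> Y t) + ?u t + ?u (t + m))"
    by (intro sum_mono point)
  also have "\<dots> = (\<Sum>t<L. prob (X t \<inter> Y t)) + (\<Sum>t<L. ?u t)
      + (\<Sum>t<L. ?u (t + m))"
    by (simp add: sum.distrib)
  also have "(\<Sum>t<L. ?u t) \<le> (\<Sum>a<p. ?u a)"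
    using mL by (intro sum_mono2) (auto intro!: \<beta>_nonneg)
  also have "\<dots> \<le> off_mass K (space M) + (1 - real q * \<eta>)" by (rule heavy_levels_complement)
  also have "(\<Sum>t<L. ?u (t + m))
      = (\<Sum>a\<in>(\<lambda>t. t + m) ` {..<L}. ?u a)"
    by (subst sum.reindex) (auto simp: inj_on_def)
  also have "\<dots> \<le> (\<Sum>a<p. ?u a)"
    using mL by (intro sum_mono2) (auto intro!: \<beta>_nonneg)
  also have "\<dots> \<le> off_mass K (space M) + (1 - real q * \<eta>)" by (rule heavy_levels_complement)
  also have "(\<Sum>t<L. prob (X t \<inter> Y t)) \<le> (\<Sum>t<L. \<Sum>k\<in>K. \<Sum>k'\<in>K. h k k' t)"
    by (intro sum_mono overlap)
  also have "\<dots> = (\<Sum>k\<in>K. \<Sum>k'\<in>K. \<Sum>t<L. h k k' t)"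
    by (subst sum.swap, rule sum.cong[OF refl], rule sum.swap)
  also have "\<dots> \<le> (\<Sum>k\<in>K. \<Sum>k'\<in>K. \<zeta>)" by (intro sum_mono hsum)
  finally show ?thesis by (simp add: power2_eq_square)
qed

text \<open>A band of diagonals of width \<open>2 N + 1\<close>, followed over \<open>L\<close> steps, meets at most \<open>L + 2 N + 1\<close> levels of the
tower of \<open>T\<close>. For \<open>L\<close> much larger than \<open>N\<close>, the share of a level of \<open>S\<close> in the band is thus hardly more
than the measure of a single level of \<open>T\<close>.\<close>

lemma near_row_le:
  assumes a: "a < p"
  shows "real L * (\<Sum>b'\<in>{b' \<in> row {} L a. b \<le> b' + N \<and> b' \<le> b + N}. w a b') \<le> (real L + 2 * real N + 1) * \<eta>"
proof -
  let ?R = "{b' \<in> row {} L a. b \<le> b' + N \<and> b' \<le> b + N}"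
  let ?s = "\<lambda>(t, b'). (a + t, b' + t)"
  have fin: "finite ?R" by simp
  have "real L * (\<Sum>b'\<in>?R. w a b') = (\<Sum>t<L. \<Sum>b'\<in>?R. w (a + t) (b' + t))"
    by (simp add: w_shift)
  also have "\<dots> = (\<Sum>(t,b')\<in>{..<L} \<times> ?R. w (a + t) (b' + t))" by (simp add: sum.cartesian_product)
  also have "\<dots> = (\<Sum>(a',b')\<in>?s ` ({..<L} \<times> ?R). w a' b')"
    by (subst sum.reindex) (auto simp: inj_on_def case_prod_beta)
  also have "\<dots> \<le> (\<Sum>(a',b')\<in>{..<p} \<times> {b - N..b + N + L}. w a' b')"
    using fin by (intro sum_mono2) (auto simp: row_def)
  also have "\<dots> = (\<Sum>b'\<in>{b - N..b + N + L}. \<Sum>a'<p. w a' b')"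
    by (simp add: sum.cartesian_product[symmetric] sum.swap[of _ "{b - N..b + N + L}"])
  also have "\<dots> \<le> (\<Sum>b'\<in>{b - N..b + N + L}. \<eta>)" by (intro sum_mono sum_w_col_le) simp
  also have "\<dots> = real (card {b - N..b + N + L}) * \<eta>" by simp
  also have "real (card {b - N..b + N + L}) \<le> real L + 2 * real N + 1" by simp
  then have "real (card {b - N..b + N + L}) * \<eta> \<le> (real L + 2 * real N + 1) * \<eta>"
    by (intro mult_right_mono) auto
  finally show ?thesis .
qed

text \<open>Draw two partners \<open>b, b'\<close> independently over the same level \<open>a\<close>. They are near with probability at most
about \<open>\<eta> / \<phi>\<close>; each of them leaves \<open>D\<close>, averaged over the following segment, with probability at most \<open>\<eta>1\<close>;
and if they are far apart, both are in \<open>D\<close> for at most the proportion \<open>\<xi>\<close> of the segment. These cases exhaust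
the total mass, whose square is at least \<open>x\<^sup>2\<close>; here everything is multiplied by \<open>\<phi>\<close>.\<close>

lemma twin_bound:
  assumes L: "L > 0" and \<phi>0: "\<phi> > 0" and \<xi>: "\<xi> \<ge> 0"
    and D: "(\<Sum>(a,b)\<in>core {} 0. (if (a, b) \<in> D then 0 else w a b)) \<le> \<eta>1"
    and x: "0 \<le> x" "x + real L * (\<phi> + \<eta>) \<le> total"
    and far: "\<And>a b b'. a + L \<le> p \<Longrightarrow> b' + L \<le> q \<Longrightarrow> b + N < b' \<Longrightarrow>
      real (card {t. t < L \<and> (a + t, b + t) \<in> D \<and> (a + t, b' + t) \<in> D}) \<le> \<xi> * real L"
  shows "\<phi> * x\<^sup>2 \<le> (1 + (2 * real N + 1) / real L) * \<eta> + 2 * \<phi> * \<eta>1 + \<xi> * \<phi>"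
proof -
  define R where "R a = row {} L a" for a
  have finR [simp]: "finite (R a)" for a by (simp add: R_def)
  define W where "W a = (\<Sum>b\<in>R a. w a b)" for a
  have W0: "0 \<le> W a" for a by (simp add: W_def sum_nonneg)
  have W\<phi>: "W a \<le> \<phi>" for a unfolding W_def R_def by (rule sum_w_row_le[OF row_subset])
  have total_core: "total = (\<Sum>(a,b)\<in>core {} 0. w a b)"
    unfolding total_def sum_core by (intro sum.cong refl) (auto simp: row_def)
  have Wcore: "(\<Sum>a<p. W a) = (\<Sum>(a,b)\<in>core {} L. w a b)" by (simp add: sum_core W_def R_def)
  have xW: "x \<le> (\<Sum>a<p. W a)"
    using segment_shift_ge[OF L, of "\<lambda>_ _. 1" "{}"] x(2) by (simp add: total_core Wcore)
  have W1: "(\<Sum>a<p. W a) \<le> 1"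
  proof -
    have "(\<Sum>a<p. W a) \<le> total"
      unfolding Wcore total_core by (intro sum_mono2) (auto simp: core_def row_def)
    then show ?thesis using total_le by simp
  qed
  have sq: "\<phi> * x\<^sup>2 \<le> (\<Sum>a<p. (W a)\<^sup>2)"
  proof -
    have "x\<^sup>2 \<le> (\<Sum>a<p. W a)\<^sup>2" using x xW by (intro power_mono) auto
    also have "\<dots> \<le> real p * (\<Sum>a<p. (W a)\<^sup>2)"
      using sum_squared_le_sum_of_squares[of W "{..<p}"] by (simp add: mult.commute)
    finally have "\<phi> * x\<^sup>2 \<le> \<phi> * (real p * (\<Sum>a<p. (W a)\<^sup>2))" by (intro mult_left_mono) auto
    also have "\<dots> = (real p * \<phi>) * (\<Sum>a<p. (W a)\<^sup>2)" by simp
    also have "\<dots> \<le> 1 * (\<Sum>a<p. (W a)\<^sup>2)"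
      using p_\<phi>_le by (intro mult_right_mono sum_nonneg) auto
    finally show ?thesis by simp
  qed
  define n where "n a b = (\<Sum>t<L. if (a + t, b + t) \<in> D then 0 else (1::real))" for a b
  have n0: "0 \<le> n a b" for a b by (simp add: n_def sum_nonneg)
  \<comment> \<open>\<open>n a b\<close> counts the times at which the segment starting at \<open>(a, b)\<close> is outside \<open>D\<close>\<close>
  have n_sum: "(\<Sum>a<p. \<Sum>b\<in>R a. w a b * n a b) \<le> real L * \<eta>1"
  proof -
    let ?g = "\<lambda>a b t. (if (a + t, b + t) \<in> D then 0 else 1) * w a b"
    have "(\<Sum>a<p. \<Sum>b\<in>R a. w a b * n a b) = (\<Sum>a<p. \<Sum>b\<in>R a. \<Sum>t<L. ?g a b t)"
      unfolding n_def by (intro sum.cong refl) (simp add: sum_distrib_left mult.commute)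
    also have "\<dots> = (\<Sum>a<p. \<Sum>t<L. \<Sum>b\<in>R a. ?g a b t)"
      by (intro sum.cong refl sum.swap)
    also have "\<dots> = (\<Sum>t<L. \<Sum>a<p. \<Sum>b\<in>R a. ?g a b t)" by (rule sum.swap)
    also have "\<dots> = (\<Sum>t<L. \<Sum>(a,b)\<in>core {} L. ?g a b t)"
      by (simp only: sum_core R_def)
    also have "\<dots> \<le> (\<Sum>t<L. \<eta>1)"
    proof (rule sum_mono)
      fix t assume t: "t \<in> {..<L}"
      have "(\<Sum>(a,b)\<in>core {} L. (if (a + t, b + t) \<in> D then 0 else 1) * w a b)
          \<le> (\<Sum>(a,b)\<in>core {} 0. (if (a, b) \<in> D then 0 else 1) * w a b)"
        using t by (intro segment_shift_le[where g = "\<lambda>a b. if (a, b) \<in> D then 0 else 1"]) auto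
      also have "\<dots> = (\<Sum>(a,b)\<in>core {} 0. (if (a, b) \<in> D then 0 else w a b))"
        by (intro sum.cong) auto
      finally show "(\<Sum>(a,b)\<in>core {} L. (if (a + t, b + t) \<in> D then 0 else 1) * w a b) \<le> \<eta>1"
        using D by simp
    qed
    finally show ?thesis by simp
  qed
  have far': "real L \<le> n a b + n a b' + \<xi> * real L"
    if "a < p" "b \<in> R a" "b' \<in> R a" "\<not> (b \<le> b' + N \<and> b' \<le> b + N)" for a b b'
  proof -
    have one: "real L \<le> n a b + n a b' + \<xi> * real L"
      if "a + L \<le> p" "b' + L \<le> q" "b + N < b'" for b b'
    proof -
      have "real (card {t. t < L \<and> (a + t, b + t) \<in> D \<and> (a + t, b' + t) \<in> D})
          = (\<Sum>t<L. if (a + t, b + t) \<in> D \<and> (a + t, b' + t) \<in> D then 1 else 0)"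
        by (simp add: sum.If_cases) (rule arg_cong[where f = card], auto)
      moreover have "real L = (\<Sum>t<L. 1)" by simp
      moreover have "\<dots> \<le> (\<Sum>t<L. (if (a + t, b + t) \<in> D then 0 else 1) + (if (a + t, b' + t) \<in> D then 0 else 1)
          + (if (a + t, b + t) \<in> D \<and> (a + t, b' + t) \<in> D then 1 else 0))"
        by (intro sum_mono) auto
      ultimately show ?thesis using far[OF that] by (simp add: n_def sum.distrib)
    qed
    show ?thesis
    proof (cases "b + N < b'")
      case True
      then show ?thesis using that by (intro one) (auto simp: R_def row_def)
    next
      case False
      then have "real L \<le> n a b' + n a b + \<xi> * real L" using that by (intro one) (auto simp: R_def row_def)
      then show ?thesis by simp
    qed
  qed
  define nearsum where "nearsum a b = (\<Sum>b'\<in>{b' \<in> R a. b \<le> b' + N \<and> b' \<le> b + N}. w a b')" for a b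
  have inner: "real L * (\<Sum>b'\<in>R a. w a b') \<le> real L * nearsum a b + (\<Sum>b'\<in>R a. w a b' * (n a b + n a b' + \<xi> * real L))"
    if "a < p" "b \<in> R a" for a b
  proof -
    have "real L * (\<Sum>b'\<in>R a. w a b') = (\<Sum>b'\<in>R a. w a b' * real L)" by (simp add: sum_distrib_left mult.commute)
    also have "\<dots> \<le> (\<Sum>b'\<in>R a. real L * (if b \<le> b' + N \<and> b' \<le> b + N then w a b' else 0) + w a b' * (n a b + n a b' + \<xi> * real L))"
    proof (rule sum_mono)
      fix b' assume b': "b' \<in> R a"
      have nn: "0 \<le> w a b' * (n a b + n a b' + \<xi> * real L)" using n0 \<xi> by (intro mult_nonneg_nonneg add_nonneg_nonneg) auto
      show "w a b' * real L \<le> real L * (if b \<le> b' + N \<and> b' \<le> b + N then w a b' else 0) + w a b' * (n a b + n a b' + \<xi> * real L)"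
      proof (cases "b \<le> b' + N \<and> b' \<le> b + N")
        case True then show ?thesis using nn by (simp add: mult.commute)
      next
        case False
        then have "w a b' * real L \<le> w a b' * (n a b + n a b' + \<xi> * real L)"
          using far'[OF that b'] by (intro mult_left_mono) auto
        then show ?thesis using False by auto
      qed
    qed
    also have "\<dots> = real L * nearsum a b + (\<Sum>b'\<in>R a. w a b' * (n a b + n a b' + \<xi> * real L))"
      by (simp add: sum.distrib nearsum_def sum.inter_filter sum_distrib_left)
    finally show ?thesis .
  qed
  have "real L * (\<Sum>a<p. (W a)\<^sup>2) = (\<Sum>a<p. \<Sum>b\<in>R a. w a b * (real L * (\<Sum>b'\<in>R a. w a b')))"
    unfolding sum_distrib_left
    by (intro sum.cong refl) (simp add: W_def power2_eq_square sum_product sum_distrib_left mult_ac)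
  also have "\<dots> \<le> (\<Sum>a<p. \<Sum>b\<in>R a. w a b * (real L * nearsum a b + (\<Sum>b'\<in>R a. w a b' * (n a b + n a b' + \<xi> * real L))))"
    by (intro sum_mono mult_left_mono inner) auto
  also have "\<dots> = (\<Sum>a<p. \<Sum>b\<in>R a. w a b * (real L * nearsum a b))
      + (\<Sum>a<p. \<Sum>b\<in>R a. \<Sum>b'\<in>R a. w a b * w a b' * n a b)
      + (\<Sum>a<p. \<Sum>b\<in>R a. \<Sum>b'\<in>R a. w a b * w a b' * n a b')
      + (\<Sum>a<p. \<Sum>b\<in>R a. \<Sum>b'\<in>R a. w a b * w a b' * (\<xi> * real L))"
    by (simp add: distrib_left sum.distrib sum_distrib_left mult.assoc)
  also have "(\<Sum>a<p. \<Sum>b\<in>R a. \<Sum>b'\<in>R a. w a b * w a b' * n a b') = (\<Sum>a<p. \<Sum>b\<in>R a. \<Sum>b'\<in>R a. w a b * w a b' * n a b)"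
    by (rule sum.cong[OF refl], subst sum.swap) (simp add: mult.commute mult.left_commute)
  also have "(\<Sum>a<p. \<Sum>b\<in>R a. \<Sum>b'\<in>R a. w a b * w a b' * n a b) = (\<Sum>a<p. (\<Sum>b\<in>R a. w a b * n a b) * W a)"
    unfolding W_def sum_product by (intro sum.cong refl) (simp add: mult_ac)
  also have "(\<Sum>a<p. \<Sum>b\<in>R a. w a b * (real L * nearsum a b)) \<le> (\<Sum>a<p. \<Sum>b\<in>R a. w a b * ((real L + 2 * real N + 1) * \<eta>))"
    unfolding nearsum_def R_def by (intro sum_mono mult_left_mono near_row_le) auto
  also have "\<dots> = (\<Sum>a<p. W a) * ((real L + 2 * real N + 1) * \<eta>)" by (simp add: W_def sum_distrib_right)
  also have "\<dots> \<le> 1 * ((real L + 2 * real N + 1) * \<eta>)" using W1 by (intro mult_right_mono) auto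
  also have "(\<Sum>a<p. (\<Sum>b\<in>R a. w a b * n a b) * W a) \<le> (\<Sum>a<p. (\<Sum>b\<in>R a. w a b * n a b) * \<phi>)"
    using n0 W\<phi> by (intro sum_mono mult_left_mono sum_nonneg mult_nonneg_nonneg) auto
  also have "\<dots> = (\<Sum>a<p. \<Sum>b\<in>R a. w a b * n a b) * \<phi>" by (simp add: sum_distrib_right)
  also have "\<dots> \<le> real L * \<eta>1 * \<phi>" using n_sum by (intro mult_right_mono) auto
  also have "(\<Sum>a<p. \<Sum>b\<in>R a. \<Sum>b'\<in>R a. w a b * w a b' * (\<xi> * real L)) = (\<Sum>a<p. W a * W a) * (\<xi> * real L)"
    unfolding W_def sum_product unfolding sum_distrib_right ..
  also have "\<dots> \<le> (\<Sum>a<p. W a * \<phi>) * (\<xi> * real L)"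
    using W0 W\<phi> \<xi> by (intro mult_right_mono sum_mono mult_left_mono) auto
  also have "(\<Sum>a<p. W a * \<phi>) = (\<Sum>a<p. W a) * \<phi>" by (simp add: sum_distrib_right)
  also have "(\<Sum>a<p. W a) * \<phi> * (\<xi> * real L) \<le> 1 * \<phi> * (\<xi> * real L)"
    using W1 \<xi> by (intro mult_right_mono) auto
  finally have "real L * (\<Sum>a<p. (W a)\<^sup>2) \<le> (real L + 2 * real N + 1) * \<eta> + 2 * (real L * \<eta>1 * \<phi>) + \<phi> * (\<xi> * real L)"
    by (simp add: mult_ac)
  also have "\<dots> = real L * ((1 + (2 * real N + 1) / real L) * \<eta> + 2 * \<phi> * \<eta>1 + \<xi> * \<phi>)"
    using L by (simp add: field_simps)
  finally have "(\<Sum>a<p. (W a)\<^sup>2) \<le> (1 + (2 * real N + 1) / real L) * \<eta> + 2 * \<phi> * \<eta>1 + \<xi> * \<phi>"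
    using L by simp
  with sq show ?thesis by linarith
qed

end

context tower_sequences begin

definition has_component :: bool where
  "has_component \<longleftrightarrow> (\<exists>\<rho>>0. \<forall>A\<in>sets M. \<forall>B\<in>sets M. \<rho> * prob A * prob B \<le> \<beta> A B)"

text \<open>Without a product component, \<open>spread_component\<close> yields one choice of \<open>\<theta>\<close> and \<open>N\<close> for which the light
diagonals carry less than \<open>\<epsilon>\<close> at all late stages. The sets \<open>K j\<close> are the corresponding heavy diagonals.\<close>

lemma concentration:
  assumes "\<not> has_component" "\<epsilon> > 0"
  obtains K Mb where "0 \<le> Mb" "\<And>j. finite (K j)"
    "\<forall>\<^sub>F j in sequentially. st.off_mass j (K j) (space M) < \<epsilon> \<and> real (card (K j)) \<le> Mb"
proof -
  have "\<exists>\<theta> N. \<theta> > 0 \<and> (\<forall>\<^sub>F j in sequentially. st.off_mass j (st.heavy j \<theta> N) (space M) < min \<epsilon> 1)"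
  proof (rule ccontr)
    assume "\<not> ?thesis"
    then have fr: "\<exists>\<^sub>F j in sequentially. min \<epsilon> 1 \<le> st.off_mass j (st.heavy j \<theta> N) (space M)" if "\<theta> > 0" for \<theta> N
      using that unfolding frequently_def not_le by blast
    have "has_component"
      unfolding has_component_def
    proof (intro exI[of _ "min \<epsilon> 1"] conjI ballI)
      fix A B assume AB: "A \<in> sets M" "B \<in> sets M"
      show "min \<epsilon> 1 * prob A * prob B \<le> \<beta> A B"
        by (rule spread_component[OF _ _ fr AB]) (use \<open>\<epsilon> > 0\<close> in auto)
    qed (use \<open>\<epsilon> > 0\<close> in auto)
    with assms(1) show False by simp
  qed
  then obtain \<theta> N where \<theta>: "\<theta> > 0"
    and ev: "\<forall>\<^sub>F j in sequentially. st.off_mass j (st.heavy j \<theta> N) (space M) < min \<epsilon> 1" by blast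
  have "\<forall>\<^sub>F j in sequentially. st.off_mass j (st.heavy j \<theta> N) (space M) < \<epsilon> \<and>
      real (card (st.heavy j \<theta> N)) \<le> (2 * real N + 1) * (C + 1) / \<theta>"
    using ev q\<eta>_pos qC
  proof eventually_elim
    case (elim j)
    have "real (q j) * (prob (F j) + prob (E j)) \<le> C + 1" by (rule level_ratio_bound[OF elim(3)])
    then have "(2 * real N + 1) * (real (q j) * (prob (F j) + prob (E j))) / \<theta> \<le> (2 * real N + 1) * (C + 1) / \<theta>"
      using \<theta> by (intro divide_right_mono mult_left_mono) auto
    moreover have "0 < q j" using elim(2) by (auto simp: zero_less_mult_iff)
    ultimately show ?case using elim(1) st.card_heavy_le[OF \<theta>, of j N] by auto
  qed
  then show thesis
    by (rule that[rotated 2]) (use \<theta> C in auto)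
qed

lemma p_large: "\<forall>\<^sub>F j in sequentially. R < real (p j)"
proof -
  define r where "r = \<bar>R\<bar> + 1"
  have r: "r > 0" "R < r" by (auto simp: r_def)
  have "\<forall>\<^sub>F j in sequentially. prob (F j) < 1 / (2 * r)" by (rule order_tendstoD(2)[OF \<phi>_lim]) (use r in auto)
  moreover have "\<forall>\<^sub>F j in sequentially. 1 / 2 < real (p j) * prob (F j)" by (rule order_tendstoD(1)[OF p\<phi>_lim]) simp
  ultimately show ?thesis
  proof eventually_elim
    case (elim j)
    have "real (p j) * prob (F j) \<le> real (p j) * (1 / (2 * r))" using elim by (intro mult_left_mono) auto
    with elim(2) have "1 / 2 < real (p j) / (2 * r)" by simp
    then show ?case using r by (simp add: field_simps)
  qed
qed

lemma segment_length:
  assumes "\<delta> > 0"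
  shows "\<forall>\<^sub>F j in sequentially. \<delta> / 2 < real (nat \<lfloor>\<delta> * real (p j)\<rfloor>) * prob (F j)"
proof -
  have "(\<lambda>j. \<delta> * (real (p j) * prob (F j)) - prob (F j)) \<longlonglongrightarrow> \<delta> * 1 - 0"
    by (intro tendsto_intros p\<phi>_lim \<phi>_lim)
  then have "\<forall>\<^sub>F j in sequentially. \<delta> / 2 < \<delta> * (real (p j) * prob (F j)) - prob (F j)"
    using order_tendstoD(1)[of _ _ _ "\<delta> / 2"] assms by fastforce
  then show ?thesis
  proof eventually_elim
    case (elim j)
    have "\<delta> * real (p j) - 1 \<le> real (nat \<lfloor>\<delta> * real (p j)\<rfloor>)" using assms by linarith
    then have "(\<delta> * real (p j) - 1) * prob (F j) \<le> real (nat \<lfloor>\<delta> * real (p j)\<rfloor>) * prob (F j)"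
      by (intro mult_right_mono) auto
    then show ?case using elim by (simp add: algebra_simps)
  qed
qed

text \<open>Take segments of length about \<open>\<delta> p\<close> at the bottom of the tower of \<open>S\<close> and lift them to its top. The climb
exceeds \<open>q\<close> by at least \<open>\<delta> p\<close>, which tends to infinity, so that the returns of \<open>heavy_overlap_bound\<close> happen
at arbitrarily late times. They would have to account for a proportion \<open>\<delta> / 4\<close> of the space.\<close>

lemma component_if_mixing_tower_shorter:
  assumes \<gamma>: "\<gamma> < 1" and short: "\<forall>\<^sub>F j in sequentially. real (q j) \<le> \<gamma> * real (p j)"
  shows has_component
proof (rule ccontr)
  assume nc: "\<not> has_component"
  define \<delta> where "\<delta> = (1 - \<gamma>) / 2"
  have \<delta>: "\<delta> > 0" using \<gamma> by (simp add: \<delta>_def)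
  have \<delta>16: "\<delta> / 16 > 0" using \<delta> by simp
  obtain K Mb where Mb: "0 \<le> Mb" and K: "\<And>j. finite (K j)"
    and conc: "\<forall>\<^sub>F j in sequentially. st.off_mass j (K j) (space M) < \<delta> / 16 \<and> real (card (K j)) \<le> Mb"
    by (rule concentration[OF nc \<delta>16]) blast
  define \<zeta> where "\<zeta> = \<delta> / (4 * (Mb\<^sup>2 + 1))"
  have Mb2: "Mb\<^sup>2 + 1 > 0" by (smt (verit) zero_le_power2)
  have \<zeta>: "\<zeta> > 0" "(Mb\<^sup>2 + 1) * \<zeta> = \<delta> / 4"
    unfolding \<zeta>_def using \<delta> Mb2 by (simp, simp add: field_simps)
  obtain N where N: "\<forall>\<^sub>F j in sequentially. \<forall>m\<ge>N. (\<Sum>b<q j. prob ((T ^^ m) ` (T ^^ b) ` E j \<inter> (T ^^ b) ` E j)) < \<zeta>"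
    using self_overlap_small[OF \<zeta>(1)] by blast
  have ev1: "\<forall>\<^sub>F j in sequentially. 1 - \<delta> / 16 < real (q j) * prob (E j)"
    using \<delta> by (intro order_tendstoD(1)[OF q\<eta>_lim]) auto
  have "\<forall>\<^sub>F j in sequentially. False"
    using conc N ev1 short p_large[of "(real N + 1) / \<delta>"] segment_length[OF \<delta>]
  proof eventually_elim
    case (elim j)
    define L where "L = nat \<lfloor>\<delta> * real (p j)\<rfloor>"
    define m where "m = p j - L"
    have L1: "real L \<le> \<delta> * real (p j)" using \<delta> by (simp add: L_def)
    have \<gamma>0: "0 \<le> \<gamma> * real (p j)" using elim(4) by linarith
    have \<delta>p: "2 * (\<delta> * real (p j)) = real (p j) - \<gamma> * real (p j)" by (simp add: \<delta>_def field_simps)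
    have "real L \<le> real (p j)" using L1 \<delta>p \<gamma>0 \<delta> mult_nonneg_nonneg[of \<delta> "real (p j)"] by linarith
    then have m: "m + L = p j" "real m = real (p j) - real L" by (auto simp: m_def)
    have big: "real N + 1 < \<delta> * real (p j)" using elim(5) \<delta> by (simp add: field_simps)
    have "real (q j) + real N \<le> real m" using m(2) L1 \<delta>p elim(4) big by linarith
    then have mq: "q j + N \<le> m" by linarith
    have "real L * prob (F j) \<le> 2 * (st.off_mass j (K j) (space M) + (1 - real (q j) * prob (E j))) + (real (card (K j)))\<^sup>2 * \<zeta>"
    proof (rule st.heavy_overlap_bound[OF K])
      show "m + L \<le> p j" "q j \<le> m" "0 \<le> \<zeta>" using m mq \<zeta> by auto
      fix i assume "m - q j \<le> i"
      then have "N \<le> i" using mq by simp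
      then show "(\<Sum>b<q j. prob ((T ^^ i) ` (T ^^ b) ` E j \<inter> (T ^^ b) ` E j)) \<le> \<zeta>"
        using elim(2) less_imp_le by blast
    qed
    moreover have "(real (card (K j)))\<^sup>2 * \<zeta> \<le> \<delta> / 4"
    proof -
      have "(real (card (K j)))\<^sup>2 \<le> Mb\<^sup>2" using elim(1) by (intro power_mono) auto
      then have "(real (card (K j)))\<^sup>2 * \<zeta> \<le> (Mb\<^sup>2 + 1) * \<zeta>"
        using \<zeta>(1) by (intro mult_right_mono) auto
      then show ?thesis unfolding \<zeta>(2) .
    qed
    ultimately show False using elim(1)[THEN conjunct1] elim(3) elim(6)[folded L_def] by argo
  qed
  then show False by simp
qed

end

context tower_pair begin

lemma coincidence_count:
  assumes J: "J1 \<subseteq> {..<q}" "J2 \<subseteq> {..<q}" and b: "b \<le> b'" "b' + L \<le> q"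
  shows "real (card {t. t < L \<and> b + t \<in> J1 \<and> b' + t \<in> J2}) * \<eta>
    \<le> prob ((T ^^ (b' - b)) ` union_levels T E J1 \<inter> union_levels T E J2)"
proof -
  let ?R = "{t. t < L \<and> b + t \<in> J1 \<and> b' + t \<in> J2}"
  have fin: "finite ?R" by simp
  have shift: "levE (b' + t) = (T ^^ (b' - b)) ` levE (b + t)" for t
    unfolding funpow_add_image[symmetric] using b(1) by simp
  have "real (card ?R) * \<eta> = (\<Sum>t\<in>?R. prob (levE (b' + t)))" by simp
  also have "\<dots> = prob (\<Union>t\<in>?R. levE (b' + t))"
  proof (rule finite_measure_finite_Union[symmetric])
    show "disjoint_family_on (\<lambda>t. levE (b' + t)) ?R"
      using disjoint_levE[OF order_refl] b unfolding disjoint_family_on_def by simp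
  qed auto
  also have "\<dots> \<le> prob ((T ^^ (b' - b)) ` union_levels T E J1 \<inter> union_levels T E J2)"
  proof (rule finite_measure_mono)
    show "(\<Union>t\<in>?R. levE (b' + t)) \<subseteq> (T ^^ (b' - b)) ` union_levels T E J1 \<inter> union_levels T E J2"
    proof (intro UN_least Int_greatest)
      fix t assume t: "t \<in> ?R"
      show "levE (b' + t) \<subseteq> (T ^^ (b' - b)) ` union_levels T E J1"
        unfolding shift using t by (intro image_mono) (auto simp: union_levels_def)
      show "levE (b' + t) \<subseteq> union_levels T E J2"
        using t by (auto simp: union_levels_def)
    qed
  qed (intro sets.Int aut_funpow_image(1)[OF aut_T] sets_UE J)
  finally show ?thesis .
qed

end

context tower_sequences begin

text \<open>What the rectangles of stage \<open>i\<close> on the diagonals in \<open>K\<close> look like at the finer stage \<open>j\<close>, up to small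
errors.\<close>

definition coarse :: "nat \<Rightarrow> int set \<Rightarrow> nat \<Rightarrow> (nat \<times> nat) set" where
  "coarse i K j = (\<Union>(u,v)\<in>{(u,v). u < p i \<and> v < q i \<and> int v - int u \<in> K}.
     majS j ((S ^^ u) ` F i) \<times> majT j ((T ^^ v) ` E i))"

text \<open>The fine cells in \<open>coarse i K j\<close> approximate the union of the rectangles of stage \<open>i\<close> on the diagonals in \<open>K\<close>.
They form disjoint rectangles because majority sets of different levels are disjoint.\<close>

lemma coarse_mass:
  assumes dS: "\<And>u. u < p i \<Longrightarrow> prob (sym_diff ((S ^^ u) ` F i) (approxS j ((S ^^ u) ` F i))) \<le> d"
    and dT: "\<And>v. v < q i \<Longrightarrow> prob (sym_diff ((T ^^ v) ` E i) (approxT j ((T ^^ v) ` E i))) \<le> d"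
    and d: "0 \<le> d"
  shows "(\<Sum>(a,b)\<in>st.core j {} 0. if (a, b) \<in> coarse i K j then 0 else st.w j a b)
    \<le> 1 - st.total i + st.off_mass i K (space M) + 2 * d * real (p i) * real (q i)"
proof -
  define H where "H = {(u,v). u < p i \<and> v < q i \<and> int v - int u \<in> K}"
  define I where "I u = majS j ((S ^^ u) ` F i)" for u
  define J where "J v = majT j ((T ^^ v) ` E i)" for v
  have H: "H \<subseteq> {..<p i} \<times> {..<q i}" "finite H"
    by (auto simp: H_def intro: finite_subset[of _ "{..<p i} \<times> {..<q i}"])
  have IJ: "I u \<subseteq> {..<p j}" "J v \<subseteq> {..<q j}" for u v by (auto simp: I_def J_def majority_def)
  have fin: "finite (I u)" "finite (J v)" for u v by (simp_all add: I_def J_def)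
  have dI: "I u \<inter> I u' = {}" if "u < p i" "u' < p i" "u \<noteq> u'" for u u'
    unfolding I_def using st.disjoint_levF[OF order_refl, of i] that
    by (intro majority_disjoint[OF prob_space_axioms aut_S st.F_sets]) (auto simp: disjoint_family_on_def)
  have dJ: "J u \<inter> J u' = {}" if "u < q i" "u' < q i" "u \<noteq> u'" for u u'
    unfolding J_def using st.disjoint_levE[OF order_refl, of i] that
    by (intro majority_disjoint[OF prob_space_axioms aut_T st.E_sets]) (auto simp: disjoint_family_on_def)
  have coarse: "coarse i K j = (\<Union>(u,v)\<in>H. I u \<times> J v)" by (simp add: coarse_def H_def I_def J_def)
  have core: "st.core j {} 0 = {..<p j} \<times> {..<q j}" by (auto simp: st.core0)
  have sub: "coarse i K j \<subseteq> {..<p j} \<times> {..<q j}" unfolding coarse using IJ by auto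
  have fH: "finite (coarse i K j)" using sub by (rule finite_subset) simp
  have "(\<Sum>(a,b)\<in>coarse i K j. st.w j a b) = (\<Sum>x\<in>H. \<Sum>(a,b)\<in>(case x of (u,v) \<Rightarrow> I u \<times> J v). st.w j a b)"
    unfolding coarse
  proof (rule sum.UNION_disjoint)
    show "\<forall>x\<in>H. \<forall>y\<in>H. x \<noteq> y \<longrightarrow> (case x of (u,v) \<Rightarrow> I u \<times> J v) \<inter> (case y of (u,v) \<Rightarrow> I u \<times> J v) = {}"
    proof (intro ballI impI)
      fix x y assume xy: "x \<in> H" "y \<in> H" "x \<noteq> y"
      obtain u v u' v' where e: "x = (u, v)" "y = (u', v')" by (metis surj_pair)
      have "I u \<inter> I u' = {} \<or> J v \<inter> J v' = {}"
        using dI[of u u'] dJ[of v v'] xy unfolding e H_def by auto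
      then show "(case x of (u,v) \<Rightarrow> I u \<times> J v) \<inter> (case y of (u,v) \<Rightarrow> I u \<times> J v) = {}"
        unfolding e by auto
    qed
  qed (use H fin in auto)
  also have "\<dots> = (\<Sum>(u,v)\<in>H. \<beta> (approxS j ((S ^^ u) ` F i)) (approxT j ((T ^^ v) ` E i)))"
  proof (rule sum.cong[OF refl], clarify)
    fix u v
    have "(\<Sum>(a,b)\<in>I u \<times> J v. st.w j a b) = (\<Sum>a\<in>I u. \<Sum>b\<in>J v. st.w j a b)"
      by (simp add: sum.cartesian_product)
    also have "\<dots> = \<beta> (union_levels S (F j) (I u)) (union_levels T (E j) (J v))"
      by (rule st.sum_w_rect[OF IJ])
    finally show "(\<Sum>(a,b)\<in>I u \<times> J v. st.w j a b) = \<beta> (approxS j ((S ^^ u) ` F i)) (approxT j ((T ^^ v) ` E i))"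
      by (simp add: approxS_def approxT_def I_def J_def)
  qed
  also have "\<dots> \<ge> (\<Sum>(u,v)\<in>H. st.w i u v - 2 * d)"
  proof (rule sum_mono, clarify)
    fix u v assume uv: "(u, v) \<in> H"
    let ?A = "(S ^^ u) ` F i" and ?B = "(T ^^ v) ` E i"
    have "\<beta> ?A ?B \<le> \<beta> (approxS j ?A) (approxT j ?B) + prob (?A - approxS j ?A) + prob (?B - approxT j ?B)"
      by (intro \<beta>_perturb) auto
    moreover have "prob (?A - approxS j ?A) \<le> d"
      using order_trans[OF Diff_le_sym_diff(1) dS] uv by (auto simp: H_def)
    moreover have "prob (?B - approxT j ?B) \<le> d"
      using order_trans[OF Diff_le_sym_diff(1) dT] uv by (auto simp: H_def)
    ultimately show "st.w i u v - 2 * d \<le> \<beta> (approxS j ?A) (approxT j ?B)" by (simp add: st.w_def)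
  qed
  finally have 1: "(\<Sum>(u,v)\<in>H. st.w i u v - 2 * d) \<le> (\<Sum>(a,b)\<in>coarse i K j. st.w j a b)" .
  have "(\<Sum>(u,v)\<in>H. st.w i u v - 2 * d) = (\<Sum>(u,v)\<in>H. st.w i u v) - 2 * d * real (card H)"
    by (simp add: case_prod_beta sum_subtractf)
  moreover have "2 * d * real (card H) \<le> 2 * d * (real (p i) * real (q i))"
  proof -
    have "card H \<le> card ({..<p i} \<times> {..<q i})" by (rule card_mono) (use H in auto)
    then have "real (card H) \<le> real (p i) * real (q i)" by (simp flip: of_nat_mult)
    then show ?thesis using d by (intro mult_left_mono) auto
  qed
  moreover have "st.total i = (\<Sum>(u,v)\<in>H. st.w i u v) + st.off_mass i K (space M)"
  proof -
    have "st.total i = (\<Sum>(u,v)\<in>{..<p i} \<times> {..<q i}. st.w i u v)"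
      by (simp add: st.total_def sum.cartesian_product)
    also have "{..<p i} \<times> {..<q i} = H \<union> st.core i K 0" by (auto simp: H_def st.core0)
    also have "(\<Sum>(u,v)\<in>H \<union> st.core i K 0. st.w i u v) = (\<Sum>(u,v)\<in>H. st.w i u v) + (\<Sum>(u,v)\<in>st.core i K 0. st.w i u v)"
      by (rule sum.union_disjoint[OF H(2) st.finite_core]) (auto simp: H_def st.core0)
    also have "(\<Sum>(u,v)\<in>st.core i K 0. st.w i u v) = st.off_mass i K (space M)"
      by (simp add: st.off_mass_space st.sum_core)
    finally show ?thesis .
  qed
  moreover have "(\<Sum>(a,b)\<in>st.core j {} 0. if (a, b) \<in> coarse i K j then 0 else st.w j a b)
      = st.total j - (\<Sum>(a,b)\<in>coarse i K j. st.w j a b)"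
  proof -
    have "st.total j = (\<Sum>(a,b)\<in>{..<p j} \<times> {..<q j}. st.w j a b)"
      by (simp add: st.total_def sum.cartesian_product)
    also have "\<dots> = (\<Sum>(a,b)\<in>{..<p j} \<times> {..<q j} - coarse i K j. st.w j a b) + (\<Sum>(a,b)\<in>coarse i K j. st.w j a b)"
      using sub by (intro sum.subset_diff) auto
    also have "(\<Sum>(a,b)\<in>{..<p j} \<times> {..<q j} - coarse i K j. st.w j a b)
        = (\<Sum>(a,b)\<in>st.core j {} 0. if (a, b) \<in> coarse i K j then 0 else st.w j a b)"
      unfolding core by (intro sum.mono_neutral_cong_left) auto
    finally show ?thesis by simp
  qed
  ultimately show ?thesis using 1 st.total_le[of j] by (simp add: mult.assoc)
qed

text \<open>Two cells over the same fine level \<open>a + t\<close> have the same coarse level \<open>u\<close> of \<open>S\<close>. So the coarse levels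
\<open>v = u + k\<close> and \<open>v' = u + k'\<close> of the two partners differ by \<open>k' - k\<close>, and it suffices to count over
\<open>k\<close>, \<open>k'\<close> and \<open>v\<close>; the factor \<open>q i\<close> instead of its square is what makes the bound small in the end.\<close>

lemma coarse_coincidences:
  assumes K: "finite K" and b: "b \<le> b'" "b' + L \<le> q j"
    and corr: "\<And>v v'. v < q i \<Longrightarrow> v' < q i \<Longrightarrow>
      prob ((T ^^ (b' - b)) ` approxT j ((T ^^ v) ` E i) \<inter> approxT j ((T ^^ v') ` E i)) \<le> \<epsilon>"
    and \<epsilon>: "0 \<le> \<epsilon>"
  shows "real (card {t. t < L \<and> (a + t, b + t) \<in> coarse i K j \<and> (a + t, b' + t) \<in> coarse i K j}) * prob (E j)
     \<le> (real (card K))\<^sup>2 * real (q i) * \<epsilon>"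
proof -
  define I where "I u = majS j ((S ^^ u) ` F i)" for u
  define J where "J v = majT j ((T ^^ v) ` E i)" for v
  have IJ: "J v \<subseteq> {..<q j}" for v by (auto simp: J_def majority_def)
  have dI: "u = u'" if "u < p i" "u' < p i" "a' \<in> I u" "a' \<in> I u'" for u u' a'
  proof (rule ccontr)
    assume "u \<noteq> u'"
    then have "I u \<inter> I u' = {}"
      unfolding I_def using st.disjoint_levF[OF order_refl, of i] that
      by (intro majority_disjoint[OF prob_space_axioms aut_S st.F_sets]) (auto simp: disjoint_family_on_def)
    then show False using that by auto
  qed
  have coarse: "coarse i K j = {(a,b). \<exists>u v. u < p i \<and> v < q i \<and> int v - int u \<in> K \<and> a \<in> I u \<and> b \<in> J v}"
    by (auto simp: coarse_def I_def J_def)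
  define X where "X = (\<lambda>(k, k', v). if v < q i \<and> 0 \<le> int v + k' - k \<and> int v + k' - k < int (q i)
      then {t. t < L \<and> b + t \<in> J v \<and> b' + t \<in> J (nat (int v + k' - k))} else {})"
  let ?Z = "K \<times> K \<times> {..<q i}"
  have finX: "finite (X z)" for z by (cases z) (auto simp: X_def)
  let ?R = "{t. t < L \<and> (a + t, b + t) \<in> coarse i K j \<and> (a + t, b' + t) \<in> coarse i K j}"
  have sub: "?R \<subseteq> (\<Union>z\<in>?Z. X z)"
  proof
    fix t assume "t \<in> ?R"
    then obtain u v u' v' where t: "t < L" and 1: "u < p i" "v < q i" "int v - int u \<in> K" "a + t \<in> I u" "b + t \<in> J v"
      and 2: "u' < p i" "v' < q i" "int v' - int u' \<in> K" "a + t \<in> I u'" "b' + t \<in> J v'"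
      by (auto simp: coarse)
    have "u' = u" using dI 1 2 by blast
    then have "t \<in> X (int v - int u, int v' - int u, v)" using t 1 2 by (auto simp: X_def)
    then show "t \<in> (\<Union>z\<in>?Z. X z)" using 1 2 \<open>u' = u\<close> by (intro UN_I) auto
  qed
  have each: "real (card (X z)) * prob (E j) \<le> \<epsilon>" for z
  proof (cases z)
    case (fields k k' v)
    show ?thesis
    proof (cases "v < q i \<and> 0 \<le> int v + k' - k \<and> int v + k' - k < int (q i)")
      case True
      have "real (card (X z)) * prob (E j) \<le> prob ((T ^^ (b' - b)) ` union_levels T (E j) (J v)
          \<inter> union_levels T (E j) (J (nat (int v + k' - k))))"
        using True st.coincidence_count[OF IJ IJ b, of v "nat (int v + k' - k)"] by (simp add: fields X_def)
      also have "\<dots> \<le> \<epsilon>" using corr[of v "nat (int v + k' - k)"] True by (simp add: approxT_def J_def nat_less_iff)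
      finally show ?thesis .
    next
      case False
      then have "X z = {}" by (simp only: X_def fields prod.case if_not_P if_False)
      then show ?thesis using \<epsilon> by simp
    qed
  qed
  have "card ?R \<le> (\<Sum>z\<in>?Z. card (X z))"
    using K finX by (intro order_trans[OF card_mono[OF _ sub] card_UN_le]) auto
  then have "real (card ?R) \<le> (\<Sum>z\<in>?Z. real (card (X z)))"
    by (simp only: of_nat_sum[symmetric] of_nat_le_iff)
  then have "real (card ?R) * prob (E j)
      \<le> (\<Sum>z\<in>?Z. real (card (X z))) * prob (E j)"
    by (intro mult_right_mono) auto
  also have "\<dots> = (\<Sum>z\<in>?Z. real (card (X z)) * prob (E j))" by (rule sum_distrib_right)
  also have "\<dots> \<le> (\<Sum>z\<in>?Z. \<epsilon>)" by (intro sum_mono each)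
  also have "\<dots> = (real (card K))\<^sup>2 * real (q i) * \<epsilon>" by (simp add: power2_eq_square card_cartesian_product)
  finally show ?thesis .
qed

text \<open>First a coarse stage \<open>i\<close> is fixed at which nearly all mass is on at most \<open>Mb\<close> diagonals and the levels are
so small that coincidences of two independent points are negligible: their proportion is about
\<open>Mb\<^sup>2 * q i * (prob (E i))\<^sup>2\<close>, at most \<open>Mb\<^sup>2 * prob (E i)\<close>. Then \<open>N\<close> is a time by which
the levels of stage \<open>i\<close> are mixed, and a fine stage \<open>j\<close> is taken late enough for segments of length about
\<open>\<delta> p\<close> to be much longer than \<open>N\<close>. With \<open>s = 1 - \<gamma>\<close>, \<open>twin_bound\<close> becomes
\<open>(1 - s / 8)\<^sup>2 \<le> \<gamma> + s / 8 * \<gamma> + 6 * s / 64 + s / 8\<close>, which is false.\<close>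

lemma component_if_mixing_tower_taller:
  assumes \<gamma>: "0 \<le> \<gamma>" "\<gamma> < 1" and thin: "\<forall>\<^sub>F j in sequentially. prob (E j) \<le> \<gamma> * prob (F j)"
  shows has_component
proof (rule ccontr)
  assume nc: "\<not> has_component"
  define s where "s = 1 - \<gamma>"
  have s: "0 < s" "s \<le> 1" using \<gamma> by (auto simp: s_def)
  have s64: "s / 64 > 0" using s by simp
  obtain K Mb where Mb: "0 \<le> Mb" and K: "\<And>j. finite (K j)"
    and conc: "\<forall>\<^sub>F j in sequentially. st.off_mass j (K j) (space M) < s / 64 \<and> real (card (K j)) \<le> Mb"
    by (rule concentration[OF nc s64]) blast
  define \<delta> where "\<delta> = s / 32"
  \<comment> \<open>a lower bound for the measure of a segment of levels of \<open>T\<close>\<close>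
  define \<delta>0 where "\<delta>0 = \<delta> / (2 * C)"
  define \<xi> where "\<xi> = s / 8"
  have pos: "\<delta> > 0" "\<delta>0 > 0" "\<xi> > 0" using s C by (auto simp: \<delta>_def \<delta>0_def \<xi>_def)
  have pq: "\<forall>\<^sub>F j in sequentially. 1 - r < real (p j) * prob (F j) + real (q j) * prob (E j) - 1" if "r > 0" for r
  proof -
    have "(\<lambda>j. real (p j) * prob (F j) + real (q j) * prob (E j) - 1) \<longlonglongrightarrow> 1 + 1 - 1"
      by (intro tendsto_intros p\<phi>_lim q\<eta>_lim)
    then show ?thesis using that by (intro order_tendstoD(1)) auto
  qed
  have "(\<lambda>j. Mb\<^sup>2 * prob (E j)) \<longlonglongrightarrow> Mb\<^sup>2 * 0" by (intro tendsto_intros \<eta>_lim)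
  then have "\<forall>\<^sub>F j in sequentially. Mb\<^sup>2 * prob (E j) < \<xi> * \<delta>0 / 2"
    using pos by (intro order_tendstoD(2)) auto
  then have "\<forall>\<^sub>F i in sequentially. (st.off_mass i (K i) (space M) < s / 64 \<and> real (card (K i)) \<le> Mb) \<and>
      Mb\<^sup>2 * prob (E i) < \<xi> * \<delta>0 / 2 \<and> 1 - s / 64 < real (p i) * prob (F i) + real (q i) * prob (E i) - 1"
    by (intro eventually_conj conc pq s64)
  then obtain i where i: "st.off_mass i (K i) (space M) < s / 64" "real (card (K i)) \<le> Mb"
      "Mb\<^sup>2 * prob (E i) < \<xi> * \<delta>0 / 2" "1 - s / 64 < real (p i) * prob (F i) + real (q i) * prob (E i) - 1"
    by (auto simp: eventually_sequentially)
  have toti: "1 - s / 64 < st.total i" using i(4) st.total_ge[of i] by linarith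
  define \<epsilon> where "\<epsilon> = \<xi> * \<delta>0 / (4 * (Mb\<^sup>2 + 1) * (real (q i) + 1))"
  have Mb2: "Mb\<^sup>2 + 1 > 0" by (smt (verit) zero_le_power2)
  have \<epsilon>: "\<epsilon> > 0" using pos Mb2 by (simp add: \<epsilon>_def)
  have \<epsilon>2: "Mb\<^sup>2 * real (q i) * (2 * \<epsilon>) \<le> \<xi> * \<delta>0 / 2"
  proof -
    have "Mb\<^sup>2 * real (q i) * (2 * \<epsilon>) \<le> (Mb\<^sup>2 + 1) * (real (q i) + 1) * (2 * \<epsilon>)"
      using \<epsilon> by (intro mult_right_mono mult_mono) auto
    also have "\<dots> = \<xi> * \<delta>0 / 2"
    proof -
      have "real (q i) + 1 \<noteq> 0" "Mb\<^sup>2 + 1 \<noteq> 0" using Mb2 by linarith+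
      moreover have "y * z * (2 * (c / (4 * y * z))) = c / 2" if "z \<noteq> 0" "y \<noteq> 0" for y z c :: real
        using that by (simp add: field_simps)
      ultimately show ?thesis unfolding \<epsilon>_def by blast
    qed
    finally show ?thesis .
  qed
  define d where "d = min (\<epsilon> / 2) (s / (128 * (real (p i) * real (q i) + 1)))"
  have d: "d > 0" using \<epsilon> s by (auto simp: d_def intro!: divide_pos_pos add_nonneg_pos)
  have d\<epsilon>: "d \<le> \<epsilon> / 2" unfolding d_def by (rule min.cobounded1)
  have d2: "2 * d * real (p i) * real (q i) \<le> s / 64"
  proof -
    let ?P = "real (p i) * real (q i)"
    have P: "?P + 1 > 0" by (intro add_nonneg_pos) auto
    have "2 * d * ?P \<le> 2 * d * (?P + 1)" using d by (intro mult_left_mono) auto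
    also have "\<dots> \<le> 2 * (s / (128 * (?P + 1))) * (?P + 1)"
      using P by (intro mult_right_mono mult_left_mono) (auto simp: d_def)
    also have "\<dots> = s / 64" using P by (simp add: field_simps)
    finally show ?thesis by (simp add: mult.assoc)
  qed
  define B where "B v = (T ^^ v) ` E i" for v
  have B: "B v \<in> sets M" "prob (B v) = prob (E i)" for v by (simp_all add: B_def)
  have "\<forall>v v'. \<exists>N. \<forall>m\<ge>N. \<bar>prob (B v' \<inter> (T ^^ m) ` B v) - prob (B v') * prob (B v)\<bar> < \<epsilon>"
    using mixing_bound[OF B(1) B(1) \<epsilon>] by blast
  then obtain Nf where Nf: "\<And>v v' m. m \<ge> Nf v v' \<Longrightarrow> \<bar>prob (B v' \<inter> (T ^^ m) ` B v) - prob (B v') * prob (B v)\<bar> < \<epsilon>"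
    by metis
  define N where "N = Max ((\<lambda>(v, v'). Nf v v') ` ({..<q i} \<times> {..<q i}))"
  have N: "Nf v v' \<le> N" if "v < q i" "v' < q i" for v v'
    unfolding N_def using that by (intro Max_ge) force+
  have e1: "\<forall>\<^sub>F j in sequentially. \<forall>u\<in>{..<p i}. prob (sym_diff ((S ^^ u) ` F i) (approxS j ((S ^^ u) ` F i))) < d"
    using order_tendstoD(2)[OF approxS_lim[OF st.levF_sets] d] by (intro eventually_ball_finite) auto
  have e2: "\<forall>\<^sub>F j in sequentially. \<forall>v\<in>{..<q i}. prob (sym_diff (B v) (approxT j (B v))) < d"
    using order_tendstoD(2)[OF approxT_lim[OF B(1)] d] by (intro eventually_ball_finite) auto
  have s16: "s / 16 > 0" using s by simp
  have "(\<lambda>j. \<delta> / C * (real (q j) * prob (E j)) - prob (E j)) \<longlonglongrightarrow> \<delta> / C * 1 - 0"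
    by (intro tendsto_intros q\<eta>_lim \<eta>_lim)
  moreover have "\<delta>0 < \<delta> / C * 1 - 0" using pos C by (simp add: \<delta>0_def field_simps)
  ultimately have e6: "\<forall>\<^sub>F j in sequentially. \<delta>0 < \<delta> / C * (real (q j) * prob (E j)) - prob (E j)"
    by (rule order_tendstoD(1))
  have "\<forall>\<^sub>F j in sequentially. False"
    using e1 e2 thin pq[OF s16] p_large[of "((2 * real N + 1) * 8 / s + 1) / \<delta>"] e6 p\<phi>_pos qC
  proof eventually_elim
    case (elim j)
    define L where "L = nat \<lfloor>\<delta> * real (p j)\<rfloor>"
    have L1: "real L \<le> \<delta> * real (p j)" "\<delta> * real (p j) - 1 \<le> real L"
      using pos by (auto simp: L_def)
    have "(2 * real N + 1) * 8 / s + 1 < \<delta> * real (p j)" using elim(5) pos by (simp add: field_simps)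
    then have "(2 * real N + 1) * 8 / s < real L" using L1 by linarith
    then have Lbig: "(2 * real N + 1) * 8 < s * real L" using s by (simp add: field_simps)
    then have L: "L > 0" using s by (cases L) auto
    have r: "(2 * real N + 1) / real L \<le> s / 8" using Lbig L by (simp add: field_simps)
    have \<phi>0: "prob (F j) > 0" using elim(7) by (auto simp: zero_less_mult_iff)
    have L\<eta>: "\<delta>0 \<le> real L * prob (E j)"
    proof -
      have "\<delta> / C * (real (q j) * prob (E j)) \<le> \<delta> / C * (C * real (p j) * prob (E j))"
        using elim(8) pos C by (intro mult_left_mono mult_right_mono) auto
      also have "\<dots> = \<delta> * real (p j) * prob (E j)" using C by simp
      finally have "\<delta>0 < (\<delta> * real (p j) - 1) * prob (E j)" using elim(6) by (simp add: algebra_simps)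
      also have "\<dots> \<le> real L * prob (E j)" using L1 by (intro mult_right_mono) auto
      finally show ?thesis by simp
    qed
    define x where "x = 1 - s / 8"
    have "prob (F j) * x\<^sup>2 \<le> (1 + (2 * real N + 1) / real L) * prob (E j) + 2 * prob (F j) * (3 * s / 64) + \<xi> * prob (F j)"
    proof (rule st.twin_bound[OF L \<phi>0])
      show "0 \<le> \<xi>" "0 \<le> x" using pos s by (auto simp: x_def)
      have "real L * (prob (F j) + prob (E j)) \<le> real L * (2 * prob (F j))"
      proof -
        have "\<gamma> * prob (F j) \<le> 1 * prob (F j)" using \<gamma> by (intro mult_right_mono) auto
        then show ?thesis using elim(3) by (intro mult_left_mono) auto
      qed
      also have "\<dots> \<le> \<delta> * real (p j) * (2 * prob (F j))" using L1 by (intro mult_right_mono) auto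
      also have "\<dots> = 2 * \<delta> * (real (p j) * prob (F j))" by simp
      also have "\<dots> \<le> 2 * \<delta> * 1" using pos st.p_\<phi>_le[of j] by (intro mult_left_mono) auto
      finally show "x + real L * (prob (F j) + prob (E j)) \<le> st.total j"
        using elim(4) st.total_ge[of j] by (simp add: x_def \<delta>_def)
      have "(\<Sum>(a,b)\<in>st.core j {} 0. if (a, b) \<in> coarse i (K i) j then 0 else st.w j a b)
          \<le> 1 - st.total i + st.off_mass i (K i) (space M) + 2 * d * real (p i) * real (q i)"
        using elim(1,2) d by (intro coarse_mass) (auto simp: B_def intro: less_imp_le)
      then show "(\<Sum>(a,b)\<in>st.core j {} 0. if (a, b) \<in> coarse i (K i) j then 0 else st.w j a b) \<le> 3 * s / 64"
        using toti i(1) d2 by simp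
      fix a b b' assume ab: "a + L \<le> p j" "b' + L \<le> q j" "b + N < b'"
      have corr: "prob ((T ^^ (b' - b)) ` approxT j (B v) \<inter> approxT j (B v')) \<le> (prob (E i))\<^sup>2 + 2 * \<epsilon>"
        if v: "v < q i" "v' < q i" for v v'
      proof -
        have "prob ((T ^^ (b' - b)) ` approxT j (B v) \<inter> approxT j (B v'))
            \<le> prob ((T ^^ (b' - b)) ` B v \<inter> B v') + prob (approxT j (B v) - B v) + prob (approxT j (B v') - B v')"
          by (rule overlap_perturb[OF aut_T]) (use B in auto)
        also have "prob ((T ^^ (b' - b)) ` B v \<inter> B v') \<le> (prob (E i))\<^sup>2 + \<epsilon>"
        proof -
          have "Nf v v' \<le> b' - b" using N[OF v] ab(3) by linarith
          from Nf[OF this] show ?thesis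
            unfolding Int_commute[of "(T ^^ (b' - b)) ` B v"] B(2) power2_eq_square by linarith
        qed
        also have "prob (approxT j (B v) - B v) \<le> \<epsilon> / 2"
          using Diff_le_sym_diff(2)[OF B(1)[of v] approxT_sets[of j "B v"]] bspec[OF elim(2), of v] v(1) d\<epsilon> by simp
        also have "prob (approxT j (B v') - B v') \<le> \<epsilon> / 2"
          using Diff_le_sym_diff(2)[OF B(1)[of v'] approxT_sets[of j "B v'"]] bspec[OF elim(2), of v'] v(2) d\<epsilon> by simp
        finally show ?thesis by simp
      qed
      let ?n = "real (card {t. t < L \<and> (a + t, b + t) \<in> coarse i (K i) j \<and> (a + t, b' + t) \<in> coarse i (K i) j})"
      have "?n * prob (E j) \<le> (real (card (K i)))\<^sup>2 * real (q i) * ((prob (E i))\<^sup>2 + 2 * \<epsilon>)"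
        using ab \<epsilon> corr by (intro coarse_coincidences K) (auto simp: B_def)
      also have "\<dots> \<le> Mb\<^sup>2 * real (q i) * ((prob (E i))\<^sup>2 + 2 * \<epsilon>)"
        using i(2) \<epsilon> by (intro mult_right_mono power_mono) auto
      also have "\<dots> = Mb\<^sup>2 * prob (E i) * (real (q i) * prob (E i)) + Mb\<^sup>2 * real (q i) * (2 * \<epsilon>)"
        by (simp add: power2_eq_square algebra_simps)
      also have "\<dots> \<le> Mb\<^sup>2 * prob (E i) * 1 + \<xi> * \<delta>0 / 2"
        by (intro add_mono mult_left_mono \<epsilon>2 st.q_\<eta>_le) auto
      also have "\<dots> \<le> \<xi> * \<delta>0" using i(3) by simp
      also have "\<dots> \<le> \<xi> * (real L * prob (E j))" using L\<eta> pos by (intro mult_left_mono) auto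
      finally have "?n * prob (E j) \<le> \<xi> * real L * prob (E j)" by simp
      moreover have "prob (E j) > 0"
        using L\<eta> pos(2) measure_nonneg[of M "E j"] by (cases "prob (E j) = 0") (auto simp: less_le)
      ultimately show "?n \<le> \<xi> * real L"
        by simp
    qed
    also have "(1 + (2 * real N + 1) / real L) * prob (E j) \<le> (1 + s / 8) * (\<gamma> * prob (F j))"
      using r elim(3) s by (intro mult_mono) auto
    also have "\<dots> = prob (F j) * (\<gamma> + s / 8 * \<gamma>)" by (simp add: algebra_simps)
    finally have "prob (F j) * x\<^sup>2 \<le> prob (F j) * (\<gamma> + s / 8 * \<gamma> + 2 * (3 * s / 64) + \<xi>)"
      by (simp add: algebra_simps)
    then have "x\<^sup>2 \<le> \<gamma> + s / 8 * \<gamma> + 2 * (3 * s / 64) + \<xi>" using \<phi>0 by simp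
    moreover have "x\<^sup>2 = 1 - s / 4 + s * s / 64" by (simp add: x_def power2_eq_square algebra_simps)
    moreover have "s / 8 * \<gamma> \<le> s / 8 * 1" using \<gamma> s by (intro mult_left_mono) auto
    moreover have "s * s \<ge> 0" by simp
    moreover have "\<gamma> = 1 - s" by (simp add: s_def)
    ultimately show False using s(1) unfolding \<xi>_def by linarith
  qed
  then show False by simp
qed

end

section \<open>Joinings are products\<close>

text \<open>If the height ratio \<open>r\<close> exceeds 1, the levels of \<open>T\<close> are thinner by a factor close to \<open>1 / r\<close>, because both
towers fill the space.\<close>

lemma bijoining_component:
  assumes L: "lebesgue_probability_space M" and bj: "bijoining M S T \<beta>"
    and exh: "exhausting M S F p" "exhausting M T E q" and mix: "mixing M T"
    and ratio: "(\<lambda>j. real (q j) / real (p j)) \<longlonglongrightarrow> r" and r: "0 < r" "r \<noteq> 1"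
  shows "\<exists>\<rho>>0. \<forall>A\<in>sets M. \<forall>B\<in>sets M. \<rho> * measure M A * measure M B \<le> \<beta> A B"
proof -
  define C where "C = max (r + 1) (2 / r)"
  have C: "C > 0" "r + 1 \<le> C" "2 / r \<le> C" using r by (auto simp: C_def)
  have pos: "\<forall>\<^sub>F j in sequentially. 0 < p j"
  proof -
    have "\<forall>\<^sub>F j in sequentially. 0 < real (q j) / real (p j)" by (rule order_tendstoD(1)[OF ratio r(1)])
    then show ?thesis by eventually_elim (auto simp: zero_less_divide_iff)
  qed
  have up: "\<forall>\<^sub>F j in sequentially. real (q j) \<le> c * real (p j)" if "r < c" for c
    using order_tendstoD(2)[OF ratio that] pos by eventually_elim (simp add: field_simps)
  have low: "\<forall>\<^sub>F j in sequentially. c * real (p j) \<le> real (q j)" if "c < r" for c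
    using order_tendstoD(1)[OF ratio that] pos by eventually_elim (simp add: field_simps)
  interpret bijoining M S T \<beta> by (rule bj)
  interpret ts: tower_sequences M S T \<beta> F p E q C
  proof
    show "\<forall>\<^sub>F j in sequentially. real (p j) \<le> C * real (q j)"
    proof -
      have "\<forall>\<^sub>F j in sequentially. r / 2 * real (p j) \<le> real (q j)" by (rule low) (use r in simp)
      then show ?thesis
      proof eventually_elim
        case (elim j)
        then have "real (p j) \<le> 2 / r * real (q j)" using r(1) by (simp add: field_simps)
        also have "\<dots> \<le> C * real (q j)" using C by (intro mult_right_mono) auto
        finally show ?case .
      qed
    qed
    show "\<forall>\<^sub>F j in sequentially. real (q j) \<le> C * real (p j)"
      using C(2) by (intro up) simp
  qed (use L exh mix C in auto)
  have "ts.has_component"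
  proof (cases "r < 1")
    case True
    show ?thesis
      by (rule ts.component_if_mixing_tower_shorter[OF _ up, of "(r + 1) / 2"]) (use True in auto)
  next
    case False
    then have r1: "1 < r" using r by simp
    have "(\<lambda>j. (real (q j) * measure M (E j)) / (real (p j) * measure M (F j)) / (real (q j) / real (p j))) \<longlonglongrightarrow> 1 / 1 / r"
      using r by (intro tendsto_divide ts.q\<eta>_lim ts.p\<phi>_lim ratio) auto
    then have "\<forall>\<^sub>F j in sequentially. (real (q j) * measure M (E j)) / (real (p j) * measure M (F j)) / (real (q j) / real (p j)) < (1 / r + 1) / 2"
      using r1 by (intro order_tendstoD(2)) (auto simp: field_simps)
    then have "\<forall>\<^sub>F j in sequentially. measure M (E j) \<le> (1 / r + 1) / 2 * measure M (F j)"
      using ts.p\<phi>_pos ts.q\<eta>_pos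
    proof eventually_elim
      case (elim j)
      have "p j > 0" "measure M (F j) > 0" "q j > 0" using elim by (auto simp: zero_less_mult_iff)
      then have "measure M (E j) / measure M (F j) < (1 / r + 1) / 2" using elim(1) by simp
      then show ?case using \<open>measure M (F j) > 0\<close> by (simp only: pos_divide_less_eq less_imp_le)
    qed
    then show ?thesis
      using r1 by (intro ts.component_if_mixing_tower_taller[of "(1 / r + 1) / 2"]) (auto simp: field_simps)
  qed
  then show ?thesis by (simp add: ts.has_component_def)
qed

text \<open>The supremum \<open>s\<close> of the multiples of the product that lie below \<open>\<beta>\<close> is attained. If it were less than 1, the
normalised difference would again be a joining, hence dominate a further multiple, against maximality. With
\<open>s = 1\<close> equality follows by comparing with the complement of \<open>A\<close>.\<close>

lemma bijoining_is_product:
  assumes L: "lebesgue_probability_space M" and bj: "bijoining M S T \<beta>"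
    and exh: "exhausting M S F p" "exhausting M T E q" and mix: "mixing M T"
    and ratio: "(\<lambda>j. real (q j) / real (p j)) \<longlonglongrightarrow> r" and r: "0 < r" "r \<noteq> 1"
    and AB: "A \<in> sets M" "B \<in> sets M"
  shows "\<beta> A B = measure M A * measure M B"
proof -
  interpret bijoining M S T \<beta> by (rule bj)
  define X where "X = {c. 0 \<le> c \<and> (\<forall>A\<in>sets M. \<forall>B\<in>sets M. c * prob A * prob B \<le> \<beta> A B)}"
  have X0: "0 \<in> X" by (auto simp: X_def intro: \<beta>_nonneg)
  have X1: "c \<le> 1" if "c \<in> X" for c
  proof -
    have "c * prob (space M) * prob (space M) \<le> \<beta> (space M) (space M)" using that by (auto simp: X_def)
    then show ?thesis by (simp add: marginal_left prob_space)
  qed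
  have bdd: "bdd_above X" using X1 unfolding bdd_above_def by blast
  define s where "s = Sup X"
  have s0: "0 \<le> s" unfolding s_def by (rule cSup_upper[OF X0 bdd])
  have s1: "s \<le> 1" unfolding s_def using X0 X1 by (intro cSup_least) auto
  have sX: "s * (prob A * prob B) \<le> \<beta> A B" if AB: "A \<in> sets M" "B \<in> sets M" for A B
  proof (cases "prob A * prob B = 0")
    case True show ?thesis unfolding True using \<beta>_nonneg[OF AB] by simp
  next
    case False
    then have pos: "0 < prob A * prob B" using zero_le_mult_iff[of "prob A" "prob B"] by (simp add: order.not_eq_order_implies_strict)
    have "s \<le> \<beta> A B / (prob A * prob B)"
      unfolding s_def
    proof (rule cSup_least)
      fix c assume "c \<in> X"
      then have "c * prob A * prob B \<le> \<beta> A B" using AB by (auto simp: X_def)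
      then show "c \<le> \<beta> A B / (prob A * prob B)" using pos by (simp add: pos_le_divide_eq mult.assoc)
    qed (use X0 in auto)
    then show ?thesis using pos by (simp add: pos_le_divide_eq)
  qed
  have "s = 1"
  proof (rule ccontr)
    assume "s \<noteq> 1"
    then have s: "0 < 1 - s" using s1 by simp
    define \<beta>' where "\<beta>' A B = (\<beta> A B - s * (prob A * prob B)) / (1 - s)" for A B
    have "bijoining M S T \<beta>'"
    proof
      show "automorphism M S" "automorphism M T" by (fact aut_S aut_T)+
    next
      fix A B assume "A \<in> sets M" "B \<in> sets M"
      then show "0 \<le> \<beta>' A B" using sX s by (simp add: \<beta>'_def)
    next
      fix A A' B assume *: "A \<in> sets M" "A' \<in> sets M" "B \<in> sets M" "A \<inter> A' = {}"
      show "\<beta>' (A \<union> A') B = \<beta>' A B + \<beta>' A' B"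
        using \<beta>_Un_left[OF *] finite_measure_Union[OF *(1,2,4)]
        by (simp add: \<beta>'_def add_divide_distrib[symmetric] algebra_simps)
    next
      fix A B B' assume *: "A \<in> sets M" "B \<in> sets M" "B' \<in> sets M" "B \<inter> B' = {}"
      show "\<beta>' A (B \<union> B') = \<beta>' A B + \<beta>' A B'"
        using \<beta>_Un_right[OF *] finite_measure_Union[OF *(2,3,4)]
        by (simp add: \<beta>'_def add_divide_distrib[symmetric] algebra_simps)
    next
      fix A assume A: "A \<in> sets M"
      have "prob A - s * prob A = (1 - s) * prob A" by (simp add: algebra_simps)
      then show "\<beta>' A (space M) = prob A" "\<beta>' (space M) A = prob A"
        using s A by (simp_all add: \<beta>'_def marginal_left marginal_right prob_space)
    next
      fix A B assume "A \<in> sets M" "B \<in> sets M"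
      then show "\<beta>' (S ` A) (T ` B) = \<beta>' A B"
        using aut_image[OF aut_S] aut_image[OF aut_T] by (simp add: \<beta>'_def \<beta>_invariant)
    qed
    from bijoining_component[OF L this exh mix ratio r]
    obtain \<rho> where \<rho>: "\<rho> > 0" "\<And>A B. A \<in> sets M \<Longrightarrow> B \<in> sets M \<Longrightarrow> \<rho> * prob A * prob B \<le> \<beta>' A B" by blast
    have "s + \<rho> * (1 - s) \<in> X"
      unfolding X_def
    proof (intro CollectI conjI ballI)
      show "0 \<le> s + \<rho> * (1 - s)" using s0 s \<rho>(1) by simp
      fix A B assume "A \<in> sets M" "B \<in> sets M"
      then have "\<rho> * prob A * prob B \<le> (\<beta> A B - s * (prob A * prob B)) / (1 - s)"
        using \<rho>(2) by (simp add: \<beta>'_def)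
      then have "\<rho> * prob A * prob B * (1 - s) \<le> \<beta> A B - s * (prob A * prob B)"
        using s by (simp only: pos_le_divide_eq)
      then show "(s + \<rho> * (1 - s)) * prob A * prob B \<le> \<beta> A B" by (simp add: algebra_simps)
    qed
    then have "s + \<rho> * (1 - s) \<le> s" unfolding s_def by (rule cSup_upper[OF _ bdd])
    moreover have "0 < \<rho> * (1 - s)" using \<rho>(1) s by simp
    ultimately show False by simp
  qed
  then have ge: "prob A * prob B \<le> \<beta> A B" if "A \<in> sets M" "B \<in> sets M" for A B
    using sX[OF that] by simp
  have "prob B = \<beta> A B + \<beta> (space M - A) B"
    using \<beta>_split_left[of "space M" A B] AB sets.sets_into_space[OF AB(1)] by (simp add: marginal_right Int_absorb1)
  moreover have "(1 - prob A) * prob B \<le> \<beta> (space M - A) B"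
    using ge[of "space M - A" B] AB by (simp add: prob_compl)
  ultimately have "\<beta> A B \<le> prob A * prob B" by (simp add: algebra_simps)
  with ge[OF AB] show ?thesis by simp
qed

lemma joining_product:
  assumes "prob_space M" "automorphism M S" "automorphism M T"
  shows "joining M S T (M \<Otimes>\<^sub>M M)"
proof -
  interpret prob_space M by fact
  interpret P: pair_prob_space M M ..
  note meas = aut_measurable[OF assms(2)] aut_measurable[OF assms(3)]
  have distr: "distr M M S = M" "distr M M T = M"
    using assms(2,3) by (auto simp: automorphism_def measure_isomorphism_def)
  have "distr M M S \<Otimes>\<^sub>M distr M M T = distr (M \<Otimes>\<^sub>M M) (M \<Otimes>\<^sub>M M) (\<lambda>(x, y). (S x, T y))"
    using meas by (intro pair_measure_distr) (auto simp: distr sigma_finite_measure_axioms)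
  then have "distr (M \<Otimes>\<^sub>M M) (M \<Otimes>\<^sub>M M) (map_prod S T) = M \<Otimes>\<^sub>M M"
    by (simp add: distr map_prod_def)
  then show ?thesis
    unfolding joining_def by (auto simp: emeasure_pair_measure_Times emeasure_space_1)
qed

lemma bijoining_of_joining:
  assumes P: "prob_space M" and S: "automorphism M S" and T: "automorphism M T" and J: "joining M S T \<nu>"
  shows "bijoining M S T (\<lambda>A B. measure \<nu> (A \<times> B))"
proof -
  interpret prob_space M by fact
  have sets\<nu> [measurable_cong, simp]: "sets \<nu> = sets (M \<Otimes>\<^sub>M M)"
    and inv: "distr \<nu> \<nu> (map_prod S T) = \<nu>"
    and m1: "\<And>A. A \<in> sets M \<Longrightarrow> emeasure \<nu> (A \<times> space M) = emeasure M A"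
    and m2: "\<And>A. A \<in> sets M \<Longrightarrow> emeasure \<nu> (space M \<times> A) = emeasure M A"
    using J by (auto simp: joining_def)
  have space\<nu>: "space \<nu> = space M \<times> space M"
    using sets_eq_imp_space_eq[OF sets\<nu>] by (simp add: space_pair_measure)
  interpret N: finite_measure \<nu>
    by standard (use m1[of "space M"] in \<open>simp add: space\<nu> emeasure_space_1\<close>)
  have rect: "A \<times> B \<in> sets \<nu>" if "A \<in> sets M" "B \<in> sets M" for A B using that by simp
  show ?thesis
  proof
    fix A A' B assume *: "A \<in> sets M" "A' \<in> sets M" "B \<in> sets M" "A \<inter> A' = {}"
    have "(A \<union> A') \<times> B = A \<times> B \<union> A' \<times> B" by auto
    then show "measure \<nu> ((A \<union> A') \<times> B) = measure \<nu> (A \<times> B) + measure \<nu> (A' \<times> B)"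
      using * rect by (simp, intro N.finite_measure_Union) auto
  next
    fix A B B' assume *: "A \<in> sets M" "B \<in> sets M" "B' \<in> sets M" "B \<inter> B' = {}"
    have "A \<times> (B \<union> B') = A \<times> B \<union> A \<times> B'" by auto
    then show "measure \<nu> (A \<times> (B \<union> B')) = measure \<nu> (A \<times> B) + measure \<nu> (A \<times> B')"
      using * rect by (simp, intro N.finite_measure_Union) auto
  next
    fix A B assume AB: "A \<in> sets M" "B \<in> sets M"
    have img: "S ` A \<in> sets M" "T ` B \<in> sets M"
      using aut_image(1)[OF S AB(1)] aut_image(1)[OF T AB(2)] by auto
    note [measurable] = aut_measurable[OF S] aut_measurable[OF T]
    have "map_prod S T \<in> measurable (M \<Otimes>\<^sub>M M) (M \<Otimes>\<^sub>M M)"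
      unfolding map_prod_def by measurable
    then have meas: "map_prod S T \<in> measurable \<nu> \<nu>"
      by (simp cong: measurable_cong_sets)
    have "S -` (S ` A) \<inter> space M = A" "T -` (T ` B) \<inter> space M = B"
      using aut_funpow_vimage[OF S AB(1), of 1] aut_funpow_vimage[OF T AB(2), of 1] by auto
    then have "map_prod S T -` (S ` A \<times> T ` B) \<inter> space \<nu> = A \<times> B"
      unfolding space\<nu> by auto
    then show "measure \<nu> (S ` A \<times> T ` B) = measure \<nu> (A \<times> B)"
      using measure_distr[OF meas rect[OF img]] inv by simp
  qed (use S T m1 m2 in \<open>auto simp: measure_def\<close>)
qed

lemma bijoining_swap:
  assumes "bijoining M S T \<beta>" shows "bijoining M T S (\<lambda>A B. \<beta> B A)"
proof -
  interpret bijoining M S T \<beta> by fact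
  show ?thesis
    by standard (auto simp: aut_S aut_T \<beta>_nonneg \<beta>_Un_left \<beta>_Un_right marginal_left marginal_right \<beta>_invariant)
qed

theorem theorem1:
  fixes M :: "'a measure"
    and T' T :: "'a \<Rightarrow> 'a"
    and h' h :: "nat \<Rightarrow> nat"
    and \<alpha> :: real
  assumes "lebesgue_probability_space M"
    and "rank_one M T'" and "height_sequence M T' h'"
    and "rank_one M T" and "height_sequence M T h"
    and "mixing M T \<or> mixing M T'"
    and "(\<lambda>j. real (h' j) / real (h j)) \<longlonglongrightarrow> \<alpha>"
    and "0 < \<alpha>" and "\<alpha> < 1"
  shows "(\<forall>\<nu>. ergodic_joining M T' T \<nu> \<longrightarrow> \<nu> = M \<Otimes>\<^sub>M M) \<and>
         disjoint_automorphisms M T' T"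
proof -
  interpret prob_space M using assms(1) by (simp add: lebesgue_probability_space_def)
  have aut: "automorphism M T'" "automorphism M T" using assms by (auto simp: rank_one_def)
  obtain F where F: "exhausting M T' F (\<lambda>j. h' j + 1)"
    by (rule exhausting_of_height_sequence[OF assms(1) aut(1) assms(3)])
  obtain E where E: "exhausting M T E (\<lambda>j. h j + 1)"
    by (rule exhausting_of_height_sequence[OF assms(1) aut(2) assms(5)])
  \<comment> \<open>the numbers of levels \<open>h' j + 1\<close> and \<open>h j + 1\<close> have the same limiting ratio because \<open>h j\<close> tends to infinity\<close>
  have inv0: "(\<lambda>j. 1 / real (h j)) \<longlonglongrightarrow> 0"
  proof (rule tendstoI)
    fix r :: real assume r: "r > 0"
    have E0: "(\<lambda>j. measure M (E j)) \<longlonglongrightarrow> 0" and E1: "(\<lambda>j. real (h j + 1) * measure M (E j)) \<longlonglongrightarrow> 1"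
      using E by (auto simp: exhausting_def)
    have "\<forall>\<^sub>F j in sequentially. 1 / 2 < real (h j + 1) * measure M (E j) - measure M (E j)"
      by (rule order_tendstoD(1)[OF tendsto_diff[OF E1 E0]]) simp
    moreover have "\<forall>\<^sub>F j in sequentially. measure M (E j) < r / 2"
      by (rule order_tendstoD(2)[OF E0]) (use r in simp)
    ultimately show "\<forall>\<^sub>F j in sequentially. dist (1 / real (h j)) 0 < r"
    proof eventually_elim
      case (elim j)
      have 1: "1 / 2 < real (h j) * measure M (E j)" using elim(1) by (simp add: algebra_simps)
      then have h: "h j > 0" by (cases "h j") auto
      have "real (h j) * measure M (E j) < real (h j) * (r / 2)" using elim(2) h by (intro mult_strict_left_mono) auto
      then have "1 < real (h j) * r" using 1 by simp
      then show ?case using h by (simp add: field_simps)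
    qed
  qed
  have hpos: "\<forall>\<^sub>F j in sequentially. 0 < h j"
  proof -
    have "\<forall>\<^sub>F j in sequentially. 0 < real (h' j) / real (h j)" by (rule order_tendstoD(1)[OF assms(7,8)])
    then show ?thesis by eventually_elim (auto simp: zero_less_divide_iff)
  qed
  have ratio: "(\<lambda>j. real (h' j + 1) / real (h j + 1)) \<longlonglongrightarrow> \<alpha>"
  proof -
    have "(\<lambda>j. (real (h' j) / real (h j) + 1 / real (h j)) / (1 + 1 / real (h j))) \<longlonglongrightarrow> (\<alpha> + 0) / (1 + 0)"
      by (intro tendsto_intros assms(7) inv0) simp
    moreover have "\<forall>\<^sub>F j in sequentially. (real (h' j) / real (h j) + 1 / real (h j)) / (1 + 1 / real (h j)) = real (h' j + 1) / real (h j + 1)"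
      using hpos
    proof eventually_elim
      case (elim j)
      have "real (h' j) / real (h j) + 1 / real (h j) = real (h' j + 1) / real (h j)"
        "1 + 1 / real (h j) = real (h j + 1) / real (h j)"
        using elim by (simp_all add: add_divide_distrib)
      then show ?case using elim by simp
    qed
    ultimately show ?thesis by (simp add: tendsto_cong)
  qed
  have ratio': "(\<lambda>j. real (h j + 1) / real (h' j + 1)) \<longlonglongrightarrow> inverse \<alpha>"
    using tendsto_inverse[OF ratio] assms(8) by simp
  have unique: "\<nu> = M \<Otimes>\<^sub>M M" if J: "joining M T' T \<nu>" for \<nu>
  proof -
    have bj: "bijoining M T' T (\<lambda>A B. measure \<nu> (A \<times> B))"
      by (rule bijoining_of_joining[OF prob_space_axioms aut J])
    have prod: "measure \<nu> (A \<times> B) = prob A * prob B" if AB: "A \<in> sets M" "B \<in> sets M" for A B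
      using assms(6)
    proof
      assume "mixing M T"
      then show ?thesis
        by (rule bijoining_is_product[OF assms(1) bj F E _ ratio' _ _ AB]) (use assms(8,9) in auto)
    next
      \<comment> \<open>the roles of the two factors are exchanged, so that the mixing one comes second\<close>
      assume "mixing M T'"
      from bijoining_is_product[OF assms(1) bijoining_swap[OF bj] E F this ratio _ _ AB(2,1)]
      show ?thesis using assms(8,9) by (simp add: mult.commute)
    qed
    have sets\<nu>: "sets \<nu> = sets (M \<Otimes>\<^sub>M M)" using J by (simp add: joining_def)
    have fin: "emeasure \<nu> (space M \<times> space M) = 1"
      using J emeasure_space_1 by (auto simp: joining_def)
    interpret N: finite_measure \<nu>
      by standard (use fin sets_eq_imp_space_eq[OF sets\<nu>] in \<open>simp add: space_pair_measure\<close>)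
    show ?thesis
    proof (rule pair_measure_eqI[symmetric])
      fix A B assume "A \<in> sets M" "B \<in> sets M"
      then show "emeasure M A * emeasure M B = emeasure \<nu> (A \<times> B)"
        by (simp add: emeasure_eq_measure N.emeasure_eq_measure prod ennreal_mult)
    qed (use sets\<nu> in \<open>auto simp: sigma_finite_measure_axioms\<close>)
  qed
  show ?thesis
    using unique joining_product[OF prob_space_axioms aut]
    unfolding ergodic_joining_def disjoint_automorphisms_def by blast
qed

end
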